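(* Let $s\in\mathbb{R}$ and let $\Omega\subset\mathbb{R}^n$ be an open set such that $\Omega_e:=\mathbb{R}^n\setminus\overline{\Omega}\ne\emptyset$. Let $L,q\colon H^s(\mathbb{R}^n)\times H^s(\mathbb{R}^n)\to\mathbb{R}$ be bounded bilinear forms and assume that $q$ is local and that $B_{L,q}:=L+q$ is (strongly) coercive in $\widetilde{H}^s(\Omega)$. (i) If $L$ has the right UCP on a nonempty open set $W\subset\Omega_e$, then $\mathcal{R}(W):=\{u_f-f: f\in C_c^\infty(W)\}\subset\widetilde{H}^s(\Omega)$ is dense in $\widetilde{H}^s(\Omega)$. (ii) If $L$ has the left UCP on a nonempty open set $W\subset\Omega_e$, then $\mathcal{R}^*(W):=\{u_g^*-g: g\in C_c^\infty(W)\}\subset\widetilde{H}^s(\Omega)$ is dense in $\widetilde{H}^s(\Omega)$.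
   Context: $H^s(\mathbb{R}^n)$ is the $L^2$-based (real) Bessel potential space and $\widetilde{H}^s(\Omega)$ is the closure of $C_c^\infty(\Omega)$ in $H^s(\mathbb{R}^n)$. Let $B\colon H^s(\mathbb{R}^n)\times H^s(\mathbb{R}^n)\to\mathbb{R}$ be a bounded bilinear form and $W\subset\mathbb{R}^n$ open and nonempty. - $B$ has the left UCP on $W$ if: $u\in H^s(\mathbb{R}^n)$, $u|_W=0$ and $B(u,\phi)=0$ for all $\phi\in C_c^\infty(W)$ imply $u\equiv0$. - $B$ has the right UCP on $W$ if: $u\in H^s(\mathbb{R}^n)$, $u|_W=0$ and $B(\phi,u)=0$ for all $\phi\in C_c^\infty(W)$ imply $u\equiv0$. - $B$ is local if $B(u,v)=0$ whenever $u,v\in H^s(\mathbb{R}^n)$ and $\operatorname{supp}(u)\cap\operatorname{supp}(v)=\emptyset$. - $B$ is (strongly) coercive in $\widetilde{H}^s(\Omega)$ if there is $c>0$ with $B(u,u)\ge c\|u\|_{H^s(\mathbb{R}^n)}^2$ for all $u\in\widetilde{H}^s(\Omega)$. - $B^*(u,v):=B(v,u)$. With $B=B_{L,q}$: for $f\in H^s(\mathbb{R}^n)$, $u_f$ denotes the unique element of $H^s(\mathbb{R}^n)$ with $u_f-f\in\widetilde{H}^s(\Omega)$ and $B(u_f,\phi)=0$ for all $\phi\in\widetilde{H}^s(\Omega)$; for $g\in H^s(\mathbb{R}^n)$, $u_g^*$ denotes the unique element of $H^s(\mathbb{R}^n)$ with $u_g^*-g\in\widetilde{H}^s(\Omega)$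 and $B^*(u_g^*,\phi)=0$ for all $\phi\in\widetilde{H}^s(\Omega)$. *)

theory Defs
  imports "HOL-Analysis.Analysis"
begin

section \<open>Smooth functions and Schwartz functions\<close>

definition partial_deriv :: "'a::euclidean_space \<Rightarrow> ('a \<Rightarrow> 'b::real_normed_vector) \<Rightarrow> 'a \<Rightarrow> 'b"
  where "partial_deriv b f x = frechet_derivative f (at x) b"

text \<open>Multi-indices are rendered as lists of basis vectors; for smooth functions the order of the
  list is immaterial.\<close>

definition iter_deriv :: "'a::euclidean_space list \<Rightarrow> ('a \<Rightarrow> 'b::real_normed_vector) \<Rightarrow> 'a \<Rightarrow> 'b"
  where "iter_deriv bs f = foldr partial_deriv bs f"

definition smooth :: "('a::euclidean_space \<Rightarrow> 'b::real_normed_vector) \<Rightarrow> bool"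
  where "smooth f \<longleftrightarrow>
    (\<forall>bs. set bs \<subseteq> Basis \<longrightarrow> (\<forall>x. iter_deriv bs f differentiable (at x)))"

definition schwartz :: "('a::euclidean_space \<Rightarrow> 'b::real_normed_vector) \<Rightarrow> bool"
  where "schwartz f \<longleftrightarrow> smooth f \<and>
    (\<forall>N bs. set bs \<subseteq> Basis \<longrightarrow> bounded (range (\<lambda>x. (1 + norm x) ^ N *\<^sub>R iter_deriv bs f x)))"

definition schwartz_seminorm :: "nat \<Rightarrow> ('a::euclidean_space \<Rightarrow> 'b::real_normed_vector) \<Rightarrow> real"
  where "schwartz_seminorm N f =
    (SUP (x, bs) \<in> UNIV \<times> {bs. set bs \<subseteq> Basis \<and> length bs \<le> N}.
       (1 + norm x) ^ N * norm (iter_deriv bs f x))"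

definition test_functions :: "'a::euclidean_space set \<Rightarrow> ('a \<Rightarrow> real) set"  (\<open>C\<^sub>c\<^sup>\<infinity>\<close>)
  where "C\<^sub>c\<^sup>\<infinity> W =
    {f. smooth f \<and> compact (closure {x. f x \<noteq> 0}) \<and> closure {x. f x \<noteq> 0} \<subseteq> W}"

lemma iter_deriv_Cons: "iter_deriv (b # bs) f = partial_deriv b (iter_deriv bs f)"
  by (simp add: iter_deriv_def)

lemma iter_deriv_add:
  fixes f g :: "'a::euclidean_space \<Rightarrow> 'b::real_normed_vector"
  assumes "smooth f" "smooth g" "set bs \<subseteq> Basis"
  shows "iter_deriv bs (\<lambda>x. f x + g x) = (\<lambda>x. iter_deriv bs f x + iter_deriv bs g x)"
  using assms(3)
proof (induction bs)
  case (Cons b bs)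
  have d: "iter_deriv bs f differentiable (at x)" "iter_deriv bs g differentiable (at x)" for x
    using assms Cons.prems by (auto simp: smooth_def)
  have e: "frechet_derivative (\<lambda>x. iter_deriv bs f x + iter_deriv bs g x) (at x) =
      (\<lambda>h. frechet_derivative (iter_deriv bs f) (at x) h + frechet_derivative (iter_deriv bs g) (at x) h)" for x
    using d[of x, unfolded frechet_derivative_works]
    by (intro frechet_derivative_at[symmetric] has_derivative_add)
  have ih: "iter_deriv bs (\<lambda>x. f x + g x) = (\<lambda>x. iter_deriv bs f x + iter_deriv bs g x)"
    using Cons by simp
  show ?case
    by (simp add: iter_deriv_Cons ih partial_deriv_def[abs_def] e)
qed (simp add: iter_deriv_def)

lemma iter_deriv_scaleR:
  fixes f :: "'a::euclidean_space \<Rightarrow> 'b::real_normed_vector"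
  assumes "smooth f" "set bs \<subseteq> Basis"
  shows "iter_deriv bs (\<lambda>x. c *\<^sub>R f x) = (\<lambda>x. c *\<^sub>R iter_deriv bs f x)"
  using assms(2)
proof (induction bs)
  case (Cons b bs)
  have d: "iter_deriv bs f differentiable (at x)" for x
    using assms Cons.prems by (auto simp: smooth_def)
  have e: "frechet_derivative (\<lambda>x. c *\<^sub>R iter_deriv bs f x) (at x) =
      (\<lambda>h. c *\<^sub>R frechet_derivative (iter_deriv bs f) (at x) h)" for x
    using d[of x, unfolded frechet_derivative_works]
    by (intro frechet_derivative_at[symmetric] has_derivative_scaleR_right)
  have ih: "iter_deriv bs (\<lambda>x. c *\<^sub>R f x) = (\<lambda>x. c *\<^sub>R iter_deriv bs f x)"
    using Cons by simp
  show ?case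
    by (simp add: iter_deriv_Cons ih partial_deriv_def[abs_def] e)
qed (simp add: iter_deriv_def)

lemma schwartz_add:
  assumes "schwartz f" "schwartz g" shows "schwartz (\<lambda>x. f x + g x)"
  using assms unfolding schwartz_def smooth_def
  by (auto simp: iter_deriv_add[unfolded smooth_def] scaleR_right_distrib intro: bounded_plus_comp)

lemma schwartz_scaleR:
  assumes "schwartz f" shows "schwartz (\<lambda>x. c *\<^sub>R f x)"
proof -
  have "bounded (range (\<lambda>x. (1 + norm x) ^ N *\<^sub>R c *\<^sub>R iter_deriv bs f x))" if "set bs \<subseteq> Basis" for N bs
    using bounded_scaling[of "range (\<lambda>x. (1 + norm x) ^ N *\<^sub>R iter_deriv bs f x)" c] assms that
    by (auto simp: schwartz_def image_image mult.commute)
  then show ?thesis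
    using assms unfolding schwartz_def smooth_def
    by (auto simp: iter_deriv_scaleR[unfolded smooth_def] simp del: scaleR_scaleR)
qed

lemma schwartz_scale:
  fixes f :: "'a::euclidean_space \<Rightarrow> real"
  assumes "schwartz f" shows "schwartz (\<lambda>x. c * f x)"
  using schwartz_scaleR[OF assms, of c] by simp

lemma schwartz_seminorm_bdd:
  fixes f :: "'a::euclidean_space \<Rightarrow> 'b::real_normed_vector"
  assumes "schwartz f"
  shows "bdd_above ((\<lambda>(x, bs). (1 + norm x) ^ N * norm (iter_deriv bs f x)) `
           (UNIV \<times> {bs. set bs \<subseteq> Basis \<and> length bs \<le> N}))"
proof -
  let ?I = "{bs :: 'a list. set bs \<subseteq> Basis \<and> length bs \<le> N}"
  let ?h = "\<lambda>bs x. (1 + norm x) ^ N * norm (iter_deriv bs f x)"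
  have fin: "finite ?I" by (rule finite_lists_length_le) simp
  have "bdd_above (range (?h bs))" if "bs \<in> ?I" for bs
  proof -
    have "bounded (range (\<lambda>x. (1 + norm x) ^ N *\<^sub>R iter_deriv bs f x))"
      using assms that by (auto simp: schwartz_def)
    then obtain K where K: "\<And>x. norm ((1 + norm x) ^ N *\<^sub>R iter_deriv bs f x) \<le> K"
      by (auto simp: bounded_iff)
    show ?thesis using K by (intro bdd_aboveI[of _ K]) auto
  qed
  then have "bdd_above (\<Union>bs\<in>?I. range (?h bs))"
    using fin by (simp add: bdd_above_UN)
  moreover have "((\<lambda>(x, bs). ?h bs x) ` (UNIV \<times> ?I)) = (\<Union>bs\<in>?I. range (?h bs))"
    by auto
  ultimately show ?thesis by simp
qed

lemma schwartz_seminorm_upper: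
  assumes "schwartz f" "set bs \<subseteq> Basis" "length bs \<le> N"
  shows "(1 + norm x) ^ N * norm (iter_deriv bs f x) \<le> schwartz_seminorm N f"
  unfolding schwartz_seminorm_def
  using cSUP_upper[OF _ schwartz_seminorm_bdd[OF assms(1)], of "(x, bs)" N] assms by simp

lemma schwartz_seminorm_nonneg:
  assumes "schwartz f" shows "0 \<le> schwartz_seminorm N f"
  by (rule order_trans[OF _ schwartz_seminorm_upper[OF assms, of "[]" N 0]]) auto

lemma schwartz_seminorm_mono:
  assumes "schwartz f" "M \<le> N" shows "schwartz_seminorm M f \<le> schwartz_seminorm N f"
proof -
  have "(1 + norm x) ^ M * norm (iter_deriv bs f x) \<le> schwartz_seminorm N f"
    if "set bs \<subseteq> Basis" "length bs \<le> M" for x bs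
  proof -
    have "(1 + norm x) ^ M * norm (iter_deriv bs f x) \<le> (1 + norm x) ^ N * norm (iter_deriv bs f x)"
      by (intro mult_right_mono power_increasing assms(2)) auto
    also have "\<dots> \<le> schwartz_seminorm N f"
      using assms that by (intro schwartz_seminorm_upper) auto
    finally show ?thesis .
  qed
  then show ?thesis
    unfolding schwartz_seminorm_def[of M]
    by (intro cSUP_least) (auto intro!: exI[of _ "[]"])
qed


section \<open>Real tempered distributions\<close>

text \<open>Continuous linear functionals on the real-valued Schwartz functions, set to 0 on all other
  functions so that equal distributions are equal as HOL functions.\<close>

typedef (overloaded) ('a::euclidean_space) tempered_distribution =
  "{u :: ('a \<Rightarrow> real) \<Rightarrow> real.
      (\<forall>\<phi>. \<not> schwartz \<phi> \<longrightarrow> u \<phi> = 0) \<and>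
      (\<forall>\<phi> \<psi>. schwartz \<phi> \<longrightarrow> schwartz \<psi> \<longrightarrow> u (\<lambda>x. \<phi> x + \<psi> x) = u \<phi> + u \<psi>) \<and>
      (\<forall>c \<phi>. schwartz \<phi> \<longrightarrow> u (\<lambda>x. c * \<phi> x) = c * u \<phi>) \<and>
      (\<exists>C N. \<forall>\<phi>. schwartz \<phi> \<longrightarrow> \<bar>u \<phi>\<bar> \<le> C * schwartz_seminorm N \<phi>)}"
  morphisms pairing Abs_tempered_distribution
  by (rule exI[of _ "\<lambda>_. 0"]) (auto intro!: exI[of _ 0])

setup_lifting type_definition_tempered_distribution

instantiation tempered_distribution :: (euclidean_space) real_vector
begin

lift_definition zero_tempered_distribution :: "'a tempered_distribution" is "\<lambda>_. 0"
  by (auto intro!: exI[of _ 0])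

lift_definition plus_tempered_distribution ::
  "'a tempered_distribution \<Rightarrow> 'a tempered_distribution \<Rightarrow> 'a tempered_distribution"
  is "\<lambda>u v \<phi>. u \<phi> + v \<phi>"
proof safe
  fix u v :: "('a \<Rightarrow> real) \<Rightarrow> real" and C N D M
  assume u: "\<forall>\<phi>. schwartz \<phi> \<longrightarrow> \<bar>u \<phi>\<bar> \<le> C * schwartz_seminorm N \<phi>"
    and v: "\<forall>\<phi>. schwartz \<phi> \<longrightarrow> \<bar>v \<phi>\<bar> \<le> D * schwartz_seminorm M \<phi>"
  have "\<bar>u \<phi> + v \<phi>\<bar> \<le> (\<bar>C\<bar> + \<bar>D\<bar>) * schwartz_seminorm (max N M) \<phi>" if "schwartz \<phi>" for \<phi>
  proof -
    have "C * schwartz_seminorm N \<phi> \<le> \<bar>C\<bar> * schwartz_seminorm (max N M) \<phi>"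
      using that by (intro mult_mono schwartz_seminorm_mono) (auto intro: schwartz_seminorm_nonneg)
    moreover have "D * schwartz_seminorm M \<phi> \<le> \<bar>D\<bar> * schwartz_seminorm (max N M) \<phi>"
      using that by (intro mult_mono schwartz_seminorm_mono) (auto intro: schwartz_seminorm_nonneg)
    ultimately show ?thesis using u[rule_format, OF that] v[rule_format, OF that]
        abs_triangle_ineq[of "u \<phi>" "v \<phi>"] by (simp only: distrib_right)
  qed
  then show "\<exists>C N. \<forall>\<phi>. schwartz \<phi> \<longrightarrow> \<bar>u \<phi> + v \<phi>\<bar> \<le> C * schwartz_seminorm N \<phi>" by blast
qed (auto simp: algebra_simps)

lift_definition scaleR_tempered_distribution ::
  "real \<Rightarrow> 'a tempered_distribution \<Rightarrow> 'a tempered_distribution" is "\<lambda>c u \<phi>. c * u \<phi>"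
proof safe
  fix c and u :: "('a \<Rightarrow> real) \<Rightarrow> real" and C N
  assume u: "\<forall>\<phi>. schwartz \<phi> \<longrightarrow> \<bar>u \<phi>\<bar> \<le> C * schwartz_seminorm N \<phi>"
  have "\<bar>c * u \<phi>\<bar> \<le> (\<bar>c\<bar> * C) * schwartz_seminorm N \<phi>" if "schwartz \<phi>" for \<phi>
    using mult_left_mono[OF u[rule_format, OF that], of "\<bar>c\<bar>"] by (simp add: abs_mult mult.assoc)
  then show "\<exists>C N. \<forall>\<phi>. schwartz \<phi> \<longrightarrow> \<bar>c * u \<phi>\<bar> \<le> C * schwartz_seminorm N \<phi>" by blast
qed (auto simp: algebra_simps)

definition uminus_tempered_distribution :: "'a tempered_distribution \<Rightarrow> 'a tempered_distribution"
  where "- u = (-1) *\<^sub>R u" for u :: "'a tempered_distribution"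

definition minus_tempered_distribution ::
  "'a tempered_distribution \<Rightarrow> 'a tempered_distribution \<Rightarrow> 'a tempered_distribution"
  where "u - v = u + (- v)" for u v :: "'a tempered_distribution"

instance
  by standard
    (unfold minus_tempered_distribution_def uminus_tempered_distribution_def,
     (transfer, simp add: algebra_simps)+)

end

text \<open>Integration against \<open>f\<close>. This is meaningful only if the functional is continuous on Schwartz
  functions; below, \<open>f\<close> is always a test function.\<close>

definition distr_of :: "('a::euclidean_space \<Rightarrow> real) \<Rightarrow> 'a tempered_distribution"
  where "distr_of f =
    Abs_tempered_distribution (\<lambda>\<phi>. if schwartz \<phi> then \<integral>x. f x * \<phi> x \<partial>lborel else 0)"

lemma smooth_imp_continuous:
  assumes "smooth f" shows "continuous_on UNIV f"
  using assms[unfolded smooth_def, rule_format, of "[]"]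
  by (auto simp: iter_deriv_def continuous_on_eq_continuous_at intro: differentiable_imp_continuous_within)

lemma test_function_times_integrable:
  fixes f g :: "'a::euclidean_space \<Rightarrow> real"
  assumes "f \<in> C\<^sub>c\<^sup>\<infinity> W" "continuous_on UNIV g"
  shows "integrable lborel (\<lambda>x. f x * g x)"
proof -
  let ?K = "closure {x. f x \<noteq> 0}"
  have f: "smooth f" "compact ?K" using assms(1) by (auto simp: test_functions_def)
  have "integrable lborel (\<lambda>x. indicator ?K x *\<^sub>R (f x * g x))"
    using f(2) by (intro borel_integrable_compact continuous_on_mult)
      (auto intro: continuous_on_subset[OF smooth_imp_continuous[OF f(1)]] continuous_on_subset[OF assms(2)])
  moreover have "(\<lambda>x. indicator ?K x *\<^sub>R (f x * g x)) = (\<lambda>x. f x * g x)"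
    using closure_subset[of "{x. f x \<noteq> 0}"] by (auto simp: indicator_def fun_eq_iff)
  ultimately show ?thesis by (simp only:)
qed

lemma pairing_distr_of:
  fixes f :: "'a::euclidean_space \<Rightarrow> real"
  assumes f: "f \<in> C\<^sub>c\<^sup>\<infinity> W"
  shows "pairing (distr_of f) \<phi> = (if schwartz \<phi> then \<integral>x. f x * \<phi> x \<partial>lborel else 0)"
proof -
  have int: "integrable lborel (\<lambda>x. f x * \<phi> x)" if "schwartz \<phi>" for \<phi> :: "'a \<Rightarrow> real"
    using that by (intro test_function_times_integrable[OF f] smooth_imp_continuous) (simp add: schwartz_def)
  have int1: "integrable lborel f"
    using test_function_times_integrable[OF f, of "\<lambda>_. 1"] by simp
  have bound: "\<bar>\<integral>x. f x * \<phi> x \<partial>lborel\<bar> \<le> (\<integral>x. \<bar>f x\<bar> \<partial>lborel) * schwartz_seminorm 0 \<phi>"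
    if \<phi>: "schwartz \<phi>" for \<phi> :: "'a \<Rightarrow> real"
  proof -
    have "\<bar>f x * \<phi> x\<bar> \<le> \<bar>f x\<bar> * schwartz_seminorm 0 \<phi>" for x
      using schwartz_seminorm_upper[OF \<phi>, of "[]" 0 x]
      by (auto simp: abs_mult iter_deriv_def intro: mult_left_mono)
    then have "(\<integral>x. \<bar>f x * \<phi> x\<bar> \<partial>lborel) \<le> (\<integral>x. \<bar>f x\<bar> * schwartz_seminorm 0 \<phi> \<partial>lborel)"
      using int[OF \<phi>] int1 by (intro integral_mono) auto
    also have "\<dots> = (\<integral>x. \<bar>f x\<bar> \<partial>lborel) * schwartz_seminorm 0 \<phi>"
      by simp
    finally show ?thesis
      using integral_abs_bound[of lborel "\<lambda>x. f x * \<phi> x"] by linarith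
  qed
  let ?S = "{u :: ('a \<Rightarrow> real) \<Rightarrow> real.
      (\<forall>\<phi>. \<not> schwartz \<phi> \<longrightarrow> u \<phi> = 0) \<and>
      (\<forall>\<phi> \<psi>. schwartz \<phi> \<longrightarrow> schwartz \<psi> \<longrightarrow> u (\<lambda>x. \<phi> x + \<psi> x) = u \<phi> + u \<psi>) \<and>
      (\<forall>c \<phi>. schwartz \<phi> \<longrightarrow> u (\<lambda>x. c * \<phi> x) = c * u \<phi>) \<and>
      (\<exists>C N. \<forall>\<phi>. schwartz \<phi> \<longrightarrow> \<bar>u \<phi>\<bar> \<le> C * schwartz_seminorm N \<phi>)}"
  have "(\<lambda>\<phi>. if schwartz \<phi> then \<integral>x. f x * \<phi> x \<partial>lborel else 0) \<in> ?S"
    using bound int by (auto simp: distrib_left mult.left_commute schwartz_add schwartz_scale)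
  then show ?thesis
    by (simp add: distr_of_def Abs_tempered_distribution_inverse)
qed

definition vanishes_on :: "'a::euclidean_space tempered_distribution \<Rightarrow> 'a set \<Rightarrow> bool"
  where "vanishes_on u W \<longleftrightarrow> (\<forall>\<phi>\<in>C\<^sub>c\<^sup>\<infinity> W. pairing u \<phi> = 0)"

definition distr_support :: "'a::euclidean_space tempered_distribution \<Rightarrow> 'a set"
  where "distr_support u = - \<Union> {V. open V \<and> vanishes_on u V}"


section \<open>The Fourier transform and Bessel potential spaces\<close>

definition fourier :: "('a::euclidean_space \<Rightarrow> complex) \<Rightarrow> 'a \<Rightarrow> complex"
  where "fourier \<phi> \<xi> =
    complex_of_real ((2 * pi) powr (- real DIM('a) / 2)) * (\<integral>x. cis (- (x \<bullet> \<xi>)) * \<phi> x \<partial>lborel)"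

definition pairing_complex :: "'a::euclidean_space tempered_distribution \<Rightarrow> ('a \<Rightarrow> complex) \<Rightarrow> complex"
  where "pairing_complex u \<phi> = Complex (pairing u (\<lambda>x. Re (\<phi> x))) (pairing u (\<lambda>x. Im (\<phi> x)))"

text \<open>\<open>has_fourier u g\<close>: the distributional Fourier transform of \<open>u\<close>, i.e.\ the functional
  mapping \<open>\<phi>\<close> to \<open>u\<close> applied to \<open>fourier \<phi>\<close>, is the function \<open>g\<close>.\<close>

definition has_fourier :: "'a::euclidean_space tempered_distribution \<Rightarrow> ('a \<Rightarrow> complex) \<Rightarrow> bool"
  where "has_fourier u g \<longleftrightarrow> g \<in> borel_measurable borel \<and>
    (\<forall>\<phi>. schwartz \<phi> \<longrightarrow> integrable lborel (\<lambda>\<xi>. g \<xi> * \<phi> \<xi>) \<and>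
       pairing_complex u (fourier \<phi>) = (\<integral>\<xi>. g \<xi> * \<phi> \<xi> \<partial>lborel))"

definition sobolev :: "real \<Rightarrow> 'a::euclidean_space tempered_distribution set"
  where "sobolev s =
    {u. \<exists>g. has_fourier u g \<and> integrable lborel (\<lambda>\<xi>. (1 + (norm \<xi>)\<^sup>2) powr s * (norm (g \<xi>))\<^sup>2)}"

text \<open>The function \<open>g\<close> is unique up to a null set, so the choice does not affect the integral.\<close>

definition sobolev_norm :: "real \<Rightarrow> 'a::euclidean_space tempered_distribution \<Rightarrow> real"
  where "sobolev_norm s u =
    sqrt (\<integral>\<xi>. (1 + (norm \<xi>)\<^sup>2) powr s * (norm ((SOME g. has_fourier u g) \<xi>))\<^sup>2 \<partial>lborel)"

definition sobolev_closure ::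
  "real \<Rightarrow> 'a::euclidean_space tempered_distribution set \<Rightarrow> 'a tempered_distribution set"
  where "sobolev_closure s A = {u \<in> sobolev s. \<forall>\<epsilon>>0. \<exists>v\<in>A. sobolev_norm s (u - v) < \<epsilon>}"

definition sobolev_tilde :: "real \<Rightarrow> 'a::euclidean_space set \<Rightarrow> 'a tempered_distribution set"
  where "sobolev_tilde s \<Omega> = sobolev_closure s (distr_of ` C\<^sub>c\<^sup>\<infinity> \<Omega>)"


section \<open>Bilinear forms\<close>

type_synonym 'a form = "'a tempered_distribution \<Rightarrow> 'a tempered_distribution \<Rightarrow> real"

definition bounded_bilinear_form :: "real \<Rightarrow> 'a::euclidean_space form \<Rightarrow> bool"
  where "bounded_bilinear_form s B \<longleftrightarrow>
    (\<forall>u\<in>sobolev s. \<forall>v\<in>sobolev s. \<forall>w\<in>sobolev s.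
       B (u + v) w = B u w + B v w \<and> B w (u + v) = B w u + B w v) \<and>
    (\<forall>c. \<forall>u\<in>sobolev s. \<forall>v\<in>sobolev s. B (c *\<^sub>R u) v = c * B u v \<and> B u (c *\<^sub>R v) = c * B u v) \<and>
    (\<exists>C. \<forall>u\<in>sobolev s. \<forall>v\<in>sobolev s. \<bar>B u v\<bar> \<le> C * sobolev_norm s u * sobolev_norm s v)"

definition left_UCP :: "real \<Rightarrow> 'a::euclidean_space form \<Rightarrow> 'a set \<Rightarrow> bool"
  where "left_UCP s B W \<longleftrightarrow>
    (\<forall>u\<in>sobolev s. vanishes_on u W \<longrightarrow> (\<forall>\<phi>\<in>C\<^sub>c\<^sup>\<infinity> W. B u (distr_of \<phi>) = 0) \<longrightarrow> u = 0)"

definition right_UCP :: "real \<Rightarrow> 'a::euclidean_space form \<Rightarrow> 'a set \<Rightarrow> bool"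
  where "right_UCP s B W \<longleftrightarrow>
    (\<forall>u\<in>sobolev s. vanishes_on u W \<longrightarrow> (\<forall>\<phi>\<in>C\<^sub>c\<^sup>\<infinity> W. B (distr_of \<phi>) u = 0) \<longrightarrow> u = 0)"

definition local_form :: "real \<Rightarrow> 'a::euclidean_space form \<Rightarrow> bool"
  where "local_form s B \<longleftrightarrow>
    (\<forall>u\<in>sobolev s. \<forall>v\<in>sobolev s. distr_support u \<inter> distr_support v = {} \<longrightarrow> B u v = 0)"

definition coercive_form :: "real \<Rightarrow> 'a::euclidean_space set \<Rightarrow> 'a form \<Rightarrow> bool"
  where "coercive_form s \<Omega> B \<longleftrightarrow>
    (\<exists>c>0. \<forall>u\<in>sobolev_tilde s \<Omega>. B u u \<ge> c * (sobolev_norm s u)\<^sup>2)"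

definition adjoint_form :: "'a::euclidean_space form \<Rightarrow> 'a form"
  where "adjoint_form B u v = B v u"

text \<open>The solution of the exterior value problem with data \<open>f\<close>, and the set of differences
  \<open>u\<^sub>f - f\<close> for test functions \<open>f\<close> on \<open>W\<close>; the starred objects are obtained from \<open>adjoint_form B\<close>.\<close>

definition exterior_solution ::
  "real \<Rightarrow> 'a::euclidean_space set \<Rightarrow> 'a form \<Rightarrow> 'a tempered_distribution \<Rightarrow> 'a tempered_distribution"
  where "exterior_solution s \<Omega> B f =
    (THE u. u \<in> sobolev s \<and> u - f \<in> sobolev_tilde s \<Omega> \<and> (\<forall>\<phi>\<in>sobolev_tilde s \<Omega>. B u \<phi> = 0))"

definition runge_set ::
  "real \<Rightarrow> 'a::euclidean_space set \<Rightarrow> 'a form \<Rightarrow> 'a set \<Rightarrow> 'a tempered_distribution set"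
  where "runge_set s \<Omega> B W =
    {exterior_solution s \<Omega> B (distr_of f) - distr_of f | f. f \<in> C\<^sub>c\<^sup>\<infinity> W}"

definition dense_in :: "real \<Rightarrow> 'a::euclidean_space tempered_distribution set \<Rightarrow>
    'a tempered_distribution set \<Rightarrow> bool"
  where "dense_in s R X \<longleftrightarrow> R \<subseteq> X \<and> X \<subseteq> sobolev_closure s R"

end

(* The theorem reduces to a statement about forms on a Hilbert space. Let M be the closure of the
   Runge set R(W) in the space H-tilde(Omega), on which B = L + q is coercive. Given w in
   H-tilde(Omega), the Lax-Milgram theorem on M for the adjoint form gives m in M with
   B(r, m) = B(r, w) for all r in M. Put z = w - m. For a test function f on W, r = u_f - f lies in M
   and B(u_f, z) = 0, so B(f, z) = - B(r, z) = 0. Since z is supported in the closure of Omega,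
   locality gives q(f, z) = 0, hence L(f, z) = 0; as z vanishes on W, the right UCP yields z = 0 and
   w = m lies in M. Part (ii) is part (i) for the adjoint forms.

   What makes this work is that H^s is a complete normed space embedded in the tempered distributions,
   which rests on Fourier inversion for Schwartz functions and on the uniqueness (almost everywhere)
   of the function representing the Fourier transform of a distribution. *)

theory Submission
  imports Defs
begin


section \<open>Schwartz functions\<close>

text \<open>Fourier inversion is proved only up to a nonzero factor. That suffices, because
  inversion serves to write a real Schwartz function as a transform with controlled decay, which
  turns weighted square integrability of a transform into a bound on \<open>pairing\<close>. The
  embedding of H^s is then continuous, and the norm is definite. The norm is used through a triangle
  inequality with an extra factor 2, enough for closures and limits. Genuine inner products come
  from the coercive form itself: its symmetric part on a closed subspace is equivalent to the
  squared norm, so Lax-Milgram runs in the energy norm. The obstacle in completeness is that the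
  limit of the transforms has to be the transform of a real distribution; limits are therefore taken
  on both sides and then identified. The element m is an oblique projection of w onto M with respect
  to the form. Working with it gives density directly, without a separating functional that would
  first have to be represented by the form.\<close>

lemma partial_deriv_eq:
  assumes "(f has_derivative D) (at x)"
  shows "partial_deriv b f x = D b"
  using frechet_derivative_at[OF assms] by (simp add: partial_deriv_def)

lemma partial_deriv_add:
  assumes "f differentiable (at x)" "g differentiable (at x)"
  shows "partial_deriv b (\<lambda>x. f x + g x) x = partial_deriv b f x + partial_deriv b g x"
  unfolding partial_deriv_eq[OF has_derivative_add[OF assms[unfolded frechet_derivative_works]]]
  by (simp add: partial_deriv_def)

lemma partial_deriv_mult:
  fixes f g :: "'a::euclidean_space \<Rightarrow> 'b::real_normed_algebra"
  assumes "f differentiable (at x)" "g differentiable (at x)"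
  shows "partial_deriv b (\<lambda>x. f x * g x) x = f x * partial_deriv b g x + partial_deriv b f x * g x"
  unfolding partial_deriv_eq[OF has_derivative_mult[OF assms[unfolded frechet_derivative_works]]]
  by (simp add: partial_deriv_def)

text \<open>Decay of the function alone; derivatives enter through
  \<open>schwartz_coinduct\<close>.\<close>

definition rapidly_decreasing :: "('a::euclidean_space \<Rightarrow> 'b::real_normed_vector) \<Rightarrow> bool"
  where "rapidly_decreasing f \<longleftrightarrow> (\<forall>N. \<exists>C. \<forall>x. (1 + norm x) ^ N * norm (f x) \<le> C)"

text \<open>A factor growing like (1 + |x|)^K uses up K powers of the decay of \<open>f\<close>, so
  exponent \<open>N\<close> for \<open>h\<close> rests on exponent \<open>N + K\<close> for
  \<open>f\<close>.\<close>

lemma rapidly_decreasing_bound: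
  assumes "rapidly_decreasing f" "0 \<le> C" and h: "\<And>x. norm (h x) \<le> C * (1 + norm x) ^ K * norm (f x)"
  shows "rapidly_decreasing h"
  unfolding rapidly_decreasing_def
proof
  fix N
  obtain D where D: "\<And>x. (1 + norm x) ^ (N + K) * norm (f x) \<le> D"
    using assms(1) unfolding rapidly_decreasing_def by blast
  have "(1 + norm x) ^ N * norm (h x) \<le> C * D" for x
  proof -
    have "(1 + norm x) ^ N * norm (h x) \<le> (1 + norm x) ^ N * (C * (1 + norm x) ^ K * norm (f x))"
      by (intro mult_left_mono h) auto
    also have "\<dots> = C * ((1 + norm x) ^ (N + K) * norm (f x))"
      by (simp add: power_add)
    also have "\<dots> \<le> C * D"
      by (intro mult_left_mono D assms)
    finally show ?thesis .
  qed
  then show "\<exists>C. \<forall>x. (1 + norm x) ^ N * norm (h x) \<le> C" by blast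
qed

lemma rapidly_decreasing_add:
  assumes "rapidly_decreasing f" "rapidly_decreasing g"
  shows "rapidly_decreasing (\<lambda>x. f x + g x)"
  unfolding rapidly_decreasing_def
proof
  fix N
  obtain C D where CD: "\<And>x. (1 + norm x) ^ N * norm (f x) \<le> C" "\<And>x. (1 + norm x) ^ N * norm (g x) \<le> D"
    using assms unfolding rapidly_decreasing_def by meson
  have "(1 + norm x) ^ N * norm (f x + g x) \<le> C + D" for x
  proof -
    have "(1 + norm x) ^ N * norm (f x + g x) \<le> (1 + norm x) ^ N * (norm (f x) + norm (g x))"
      by (intro mult_left_mono norm_triangle_ineq) auto
    then show ?thesis using CD[of x] by (simp add: distrib_left)
  qed
  then show "\<exists>C. \<forall>x. (1 + norm x) ^ N * norm (f x + g x) \<le> C" by blast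
qed

lemma schwartz_rapidly_decreasing:
  assumes "schwartz f" shows "rapidly_decreasing f"
proof -
  have "bounded (range (\<lambda>x. (1 + norm x) ^ N *\<^sub>R f x))" for N
    using assms[unfolded schwartz_def, THEN conjunct2, rule_format, of "[]" N] by (simp add: iter_deriv_def)
  then show ?thesis
    unfolding rapidly_decreasing_def bounded_iff by (auto simp: image_iff)
qed

text \<open>Iterated derivatives never leave a class closed under \<open>partial_deriv\<close>, so
  differentiability and decay of its members give the Schwartz conditions at every order. Closure
  properties then reduce to a single derivative in a suitable invariant class, with no Leibniz
  formula of higher order.\<close>

lemma schwartz_coinduct:
  assumes P: "P f"
    and d: "\<And>f x. P f \<Longrightarrow> f differentiable (at x)"
    and p: "\<And>f b. P f \<Longrightarrow> b \<in> Basis \<Longrightarrow> P (partial_deriv b f)"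
    and r: "\<And>f. P f \<Longrightarrow> rapidly_decreasing f"
  shows "schwartz f"
proof -
  have *: "P (iter_deriv bs f)" if "set bs \<subseteq> Basis" for bs
    using that by (induction bs) (auto simp: P p iter_deriv_Cons, auto simp: iter_deriv_def P)
  have "bounded (range (\<lambda>x. (1 + norm x) ^ N *\<^sub>R iter_deriv bs f x))" if "set bs \<subseteq> Basis" for N bs
    using r[OF *[OF that]] by (auto simp: rapidly_decreasing_def bounded_iff)
  then show ?thesis
    using d[OF *] by (auto simp: schwartz_def smooth_def)
qed

lemma schwartz_differentiable:
  assumes "schwartz f" shows "f differentiable (at x)"
  using assms by (auto simp: schwartz_def smooth_def iter_deriv_def dest!: spec[of _ "[]"])

lemma schwartz_has_derivative:
  "schwartz f \<Longrightarrow> (f has_derivative frechet_derivative f (at x)) (at x)"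
  using schwartz_differentiable frechet_derivative_works by blast

lemma schwartz_continuous: "schwartz f \<Longrightarrow> continuous_on UNIV f"
  by (simp add: schwartz_def smooth_imp_continuous)

lemma schwartz_measurable [measurable_dest]: "schwartz f \<Longrightarrow> f \<in> borel_measurable borel"
  by (rule borel_measurable_continuous_onI[OF schwartz_continuous])

lemma iter_deriv_partial_deriv: "iter_deriv bs (partial_deriv b f) = iter_deriv (bs @ [b]) f"
  by (simp add: iter_deriv_def)

lemma schwartz_partial_deriv:
  "schwartz f \<Longrightarrow> b \<in> Basis \<Longrightarrow> schwartz (partial_deriv b f)"
  by (auto simp: schwartz_def smooth_def iter_deriv_partial_deriv)

lemma schwartz_zero: "schwartz (\<lambda>x. 0)"
proof (rule schwartz_coinduct[where P = "\<lambda>f. f = (\<lambda>x. 0)"])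
  show "partial_deriv b f = (\<lambda>x. 0)" if "f = (\<lambda>x. 0)" for f :: "'a \<Rightarrow> 'b" and b
    using partial_deriv_eq[OF has_derivative_const, of b "0::'b"] unfolding that by auto
qed (auto simp: rapidly_decreasing_def)

text \<open>The functions x_b g + h with \<open>g\<close> and \<open>h\<close> Schwartz form the
  invariant class: differentiating the coordinate produces a multiple of \<open>g\<close>, which the
  summand \<open>h\<close> absorbs.\<close>

lemma schwartz_coordinate_mult:
  assumes "schwartz f" "b \<in> Basis"
  shows "schwartz (\<lambda>x. (x \<bullet> b) *\<^sub>R f x)"
proof (rule schwartz_coinduct[where P = "\<lambda>f. \<exists>g h. schwartz g \<and> schwartz h \<and> f = (\<lambda>x. (x \<bullet> b) *\<^sub>R g x + h x)"])
  show "\<exists>g h. schwartz g \<and> schwartz h \<and> (\<lambda>x. (x \<bullet> b) *\<^sub>R f x) = (\<lambda>x. (x \<bullet> b) *\<^sub>R g x + h x)"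
    using assms schwartz_zero by (intro exI[of _ f] exI[of _ "\<lambda>_. 0"]) auto
next
  fix f :: "'a \<Rightarrow> 'b" and x
  assume "\<exists>g h. schwartz g \<and> schwartz h \<and> f = (\<lambda>x. (x \<bullet> b) *\<^sub>R g x + h x)"
  then show "f differentiable (at x)"
    by (elim exE conjE, hypsubst)
      (intro differentiable_add schwartz_differentiable differentiable_scaleR differentiable_inner differentiable_ident differentiable_const)
next
  fix f :: "'a \<Rightarrow> 'b" and c :: 'a
  assume "\<exists>g h. schwartz g \<and> schwartz h \<and> f = (\<lambda>x. (x \<bullet> b) *\<^sub>R g x + h x)" and c: "c \<in> Basis"
  then obtain g h where gh: "schwartz g" "schwartz h" and f: "f = (\<lambda>x. (x \<bullet> b) *\<^sub>R g x + h x)" by blast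
  have "partial_deriv c f x = (x \<bullet> b) *\<^sub>R partial_deriv c g x + ((c \<bullet> b) *\<^sub>R g x + partial_deriv c h x)" for x
  proof -
    have "(f has_derivative (\<lambda>v. ((x \<bullet> b) *\<^sub>R frechet_derivative g (at x) v + (v \<bullet> b) *\<^sub>R g x) + frechet_derivative h (at x) v)) (at x)"
      unfolding f by (auto intro!: derivative_eq_intros gh schwartz_has_derivative)
    from partial_deriv_eq[OF this] show ?thesis by (simp add: partial_deriv_def)
  qed
  then show "\<exists>g h. schwartz g \<and> schwartz h \<and> partial_deriv c f = (\<lambda>x. (x \<bullet> b) *\<^sub>R g x + h x)"
    using gh c by (intro exI[of _ "partial_deriv c g"] exI[of _ "\<lambda>x. (c \<bullet> b) *\<^sub>R g x + partial_deriv c h x"] conjI)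
      (auto intro!: schwartz_add schwartz_scaleR schwartz_partial_deriv)
next
  fix f :: "'a \<Rightarrow> 'b"
  assume "\<exists>g h. schwartz g \<and> schwartz h \<and> f = (\<lambda>x. (x \<bullet> b) *\<^sub>R g x + h x)"
  then obtain g h where gh: "schwartz g" "schwartz h" and f: "f = (\<lambda>x. (x \<bullet> b) *\<^sub>R g x + h x)" by blast
  have "rapidly_decreasing (\<lambda>x. (x \<bullet> b) *\<^sub>R g x)"
  proof (rule rapidly_decreasing_bound[OF schwartz_rapidly_decreasing[OF gh(1)], of 1 _ 1])
    fix x
    have "\<bar>x \<bullet> b\<bar> \<le> 1 + norm x" using assms(2) Basis_le_norm[of b x] by linarith
    then show "norm ((x \<bullet> b) *\<^sub>R g x) \<le> 1 * (1 + norm x) ^ 1 * norm (g x)"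
      by (simp add: mult_right_mono)
  qed simp
  then show "rapidly_decreasing f"
    unfolding f by (rule rapidly_decreasing_add[OF _ schwartz_rapidly_decreasing[OF gh(2)]])
qed

lemma schwartz_bounded_linear:
  fixes f :: "'a::euclidean_space \<Rightarrow> 'b::real_normed_vector" and h :: "'b \<Rightarrow> 'c::real_normed_vector"
  assumes "bounded_linear h" "schwartz f"
  shows "schwartz (\<lambda>x. h (f x))"
proof (rule schwartz_coinduct[where P = "\<lambda>f. \<exists>g. schwartz g \<and> f = (\<lambda>x. h (g x))"])
  interpret bounded_linear h by fact
  have D: "((\<lambda>x. h (g x)) has_derivative (\<lambda>v. h (frechet_derivative g (at x) v))) (at x)" if "schwartz g" for g :: "'a \<Rightarrow> 'b" and x
    by (rule has_derivative[OF schwartz_has_derivative[OF that]])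
  fix f :: "'a \<Rightarrow> 'c"
  assume "\<exists>g. schwartz g \<and> f = (\<lambda>x. h (g x))"
  then obtain g where g: "schwartz g" and f: "f = (\<lambda>x. h (g x))" by blast
  show "f differentiable (at x)" for x
    using D[OF g] unfolding f differentiable_def by blast
  show "\<exists>g. schwartz g \<and> partial_deriv b f = (\<lambda>x. h (g x))" if "b \<in> Basis" for b
    using D[OF g] g that unfolding f
    by (intro exI[of _ "partial_deriv b g"]) (auto simp: schwartz_partial_deriv fun_eq_iff partial_deriv_def intro!: partial_deriv_eq[unfolded partial_deriv_def])
  obtain K where K: "0 < K" "\<And>x. norm (h x) \<le> norm x * K" using pos_bounded by blast
  show "rapidly_decreasing f"
    by (rule rapidly_decreasing_bound[OF schwartz_rapidly_decreasing[OF g], of K _ 0])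
      (use K in \<open>auto simp: f mult.commute\<close>)
next
  show "\<exists>g. schwartz g \<and> (\<lambda>x. h (f x)) = (\<lambda>x. h (g x))"
    by (intro exI[of _ f] conjI assms refl)
qed

lemma schwartz_affine:
  assumes "schwartz f" "c \<noteq> 0"
  shows "schwartz (\<lambda>x. f (a + c *\<^sub>R x))"
proof (rule schwartz_coinduct[where P = "\<lambda>f. \<exists>g. schwartz g \<and> f = (\<lambda>x. g (a + c *\<^sub>R x))"])
  have D: "((\<lambda>x. g (a + c *\<^sub>R x)) has_derivative (\<lambda>v. frechet_derivative g (at (a + c *\<^sub>R x)) (c *\<^sub>R v))) (at x)"
    if "schwartz g" for g :: "'a \<Rightarrow> 'b" and x
    by (rule has_derivative_compose[OF _ schwartz_has_derivative[OF that], where f = "\<lambda>x. a + c *\<^sub>R x"])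
      (auto intro!: derivative_eq_intros)
  fix f :: "'a \<Rightarrow> 'b"
  assume "\<exists>g. schwartz g \<and> f = (\<lambda>x. g (a + c *\<^sub>R x))"
  then obtain g where g: "schwartz g" and f: "f = (\<lambda>x. g (a + c *\<^sub>R x))" by blast
  show "f differentiable (at x)" for x
    using D[OF g] unfolding f differentiable_def by blast
  show "\<exists>g. schwartz g \<and> partial_deriv b f = (\<lambda>x. g (a + c *\<^sub>R x))" if "b \<in> Basis" for b
  proof (intro exI[of _ "\<lambda>x. c *\<^sub>R partial_deriv b g x"] conjI)
    show "schwartz (\<lambda>x. c *\<^sub>R partial_deriv b g x)"
      using g that by (intro schwartz_scaleR schwartz_partial_deriv)
    show "partial_deriv b f = (\<lambda>x. c *\<^sub>R partial_deriv b g (a + c *\<^sub>R x))"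
      unfolding f fun_eq_iff partial_deriv_eq[OF D[OF g]]
      using linear_frechet_derivative[OF schwartz_differentiable[OF g]]
      by (simp add: partial_deriv_def linear_cmul)
  qed
  show "rapidly_decreasing f"
    unfolding rapidly_decreasing_def
  proof
    fix N
    obtain C where C: "\<And>x. (1 + norm x) ^ N * norm (g x) \<le> C"
      using schwartz_rapidly_decreasing[OF g] unfolding rapidly_decreasing_def by blast
    \<comment> \<open>Since |x| \<le> (|a + c x| + |a|) / |c| and |y| + |a| \<le> (1 + |a|) (1 +
      |y|), this constant compares the weight at \<open>x\<close> with the weight at its
      image.\<close>
    define K where "K = 1 + (1 + norm a) / \<bar>c\<bar>"
    have K: "0 \<le> K" by (simp add: K_def)
    have "1 + norm x \<le> K * (1 + norm (a + c *\<^sub>R x))" for x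
    proof -
      have "\<bar>c\<bar> * norm x \<le> norm (a + c *\<^sub>R x) + norm a"
        using norm_triangle_ineq4[of "a + c *\<^sub>R x" a] by simp
      then have "norm x \<le> (norm (a + c *\<^sub>R x) + norm a) / \<bar>c\<bar>"
        using assms(2) by (simp add: field_simps)
      also have "\<dots> \<le> (1 + norm a) / \<bar>c\<bar> * (1 + norm (a + c *\<^sub>R x))"
      proof -
        have "norm (a + c *\<^sub>R x) + norm a \<le> (1 + norm a) * (1 + norm (a + c *\<^sub>R x))"
          using mult_nonneg_nonneg[of "norm a" "norm (a + c *\<^sub>R x)"] by (simp add: algebra_simps)
        then show ?thesis by (simp add: divide_right_mono)
      qed
      finally show ?thesis
        using norm_ge_zero[of "a + c *\<^sub>R x"] unfolding K_def distrib_right mult_1_left by linarith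
    qed
    then have le: "(1 + norm x) ^ N \<le> K ^ N * (1 + norm (a + c *\<^sub>R x)) ^ N" for x
      by (metis power_mono power_mult_distrib add_nonneg_nonneg norm_ge_zero zero_le_one)
    have "(1 + norm x) ^ N * norm (f x) \<le> K ^ N * C" for x
    proof -
      have "(1 + norm x) ^ N * norm (f x) \<le> (K ^ N * (1 + norm (a + c *\<^sub>R x)) ^ N) * norm (f x)"
        by (intro mult_right_mono le) auto
      also have "\<dots> = K ^ N * ((1 + norm (a + c *\<^sub>R x)) ^ N * norm (g (a + c *\<^sub>R x)))"
        by (simp add: f)
      also have "\<dots> \<le> K ^ N * C"
        using K by (intro mult_left_mono C) auto
      finally show ?thesis .
    qed
    then show "\<exists>C. \<forall>x. (1 + norm x) ^ N * norm (f x) \<le> C" by blast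
  qed
next
  show "\<exists>g. schwartz g \<and> (\<lambda>x. f (a + c *\<^sub>R x)) = (\<lambda>x. g (a + c *\<^sub>R x))"
    by (intro exI[of _ f] conjI assms refl)
qed

text \<open>The product rule turns one product into a sum of two, so products alone are not
  invariant under derivatives, but their sums are.\<close>

inductive sum_of_schwartz_products :: "('a::euclidean_space \<Rightarrow> 'b::real_normed_algebra) \<Rightarrow> bool" where
  mult: "schwartz f \<Longrightarrow> schwartz g \<Longrightarrow> sum_of_schwartz_products (\<lambda>x. f x * g x)"
| add: "sum_of_schwartz_products f \<Longrightarrow> sum_of_schwartz_products g \<Longrightarrow> sum_of_schwartz_products (\<lambda>x. f x + g x)"

lemma schwartz_mult:
  fixes f g :: "'a::euclidean_space \<Rightarrow> 'b::real_normed_algebra"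
  assumes "schwartz f" "schwartz g"
  shows "schwartz (\<lambda>x. f x * g x)"
proof (rule schwartz_coinduct[where P = sum_of_schwartz_products])
  show diff: "f differentiable (at x)" if "sum_of_schwartz_products f" for f :: "'a \<Rightarrow> 'b" and x
    using that by induction (auto intro: differentiable_mult differentiable_add schwartz_differentiable)
  show "rapidly_decreasing f" if "sum_of_schwartz_products f" for f :: "'a \<Rightarrow> 'b"
    using that
  proof induction
    case (mult f g)
    obtain C where C: "\<And>x. norm (f x) \<le> C"
      using schwartz_rapidly_decreasing[OF mult(1)] unfolding rapidly_decreasing_def by (metis mult_1 power_0)
    have "norm (f x * g x) \<le> C * norm (g x)" for x
      using norm_mult_ineq[of "f x" "g x"] mult_right_mono[OF C[of x] norm_ge_zero[of "g x"]] by linarith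
    then show ?case
      using order_trans[OF norm_ge_zero C]
      by (intro rapidly_decreasing_bound[OF schwartz_rapidly_decreasing[OF mult(2)], of C _ 0]) auto
  qed (rule rapidly_decreasing_add)
  show "sum_of_schwartz_products (partial_deriv b f)" if "sum_of_schwartz_products f" and b: "b \<in> Basis" for f :: "'a \<Rightarrow> 'b" and b
    using that(1)
  proof induction
    case (mult f g)
    have "partial_deriv b (\<lambda>x. f x * g x) = (\<lambda>x. f x * partial_deriv b g x + partial_deriv b f x * g x)"
      using mult by (auto simp: partial_deriv_mult schwartz_differentiable)
    moreover have "sum_of_schwartz_products (\<lambda>x. f x * partial_deriv b g x)"
        "sum_of_schwartz_products (\<lambda>x. partial_deriv b f x * g x)"
      by (intro sum_of_schwartz_products.mult schwartz_partial_deriv mult b)+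
    ultimately show ?case
      using sum_of_schwartz_products.add by simp
  next
    case (add f g)
    have "partial_deriv b (\<lambda>x. f x + g x) = (\<lambda>x. partial_deriv b f x + partial_deriv b g x)"
      using diff[OF add(1)] diff[OF add(2)] by (auto simp: partial_deriv_add)
    then show ?case
      using sum_of_schwartz_products.add[OF add(3,4)] by simp
  qed
qed (rule sum_of_schwartz_products.mult[OF assms])

text \<open>Polynomial multiples of the Gaussian, generated by the operations that differentiation
  calls for: the Gaussian brings down -2 x_b, and a coordinate factor leaves a constant
  multiple.\<close>

inductive gaussian_polynomial :: "('a::euclidean_space \<Rightarrow> real) \<Rightarrow> bool" where
  gaussian: "gaussian_polynomial (\<lambda>x. exp (- (x \<bullet> x)))"
| scale: "gaussian_polynomial f \<Longrightarrow> gaussian_polynomial (\<lambda>x. c * f x)"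
| coordinate: "gaussian_polynomial f \<Longrightarrow> b \<in> Basis \<Longrightarrow> gaussian_polynomial (\<lambda>x. (x \<bullet> b) * f x)"
| add: "gaussian_polynomial f \<Longrightarrow> gaussian_polynomial g \<Longrightarrow> gaussian_polynomial (\<lambda>x. f x + g x)"

text \<open>(1 + |x|)^N \<le> exp(N |x|), and completing the square gives N |x| - |x|^2 \<le>
  N^2.\<close>

lemma rapidly_decreasing_gaussian: "rapidly_decreasing (\<lambda>x::'a::euclidean_space. exp (- (x \<bullet> x)))"
  unfolding rapidly_decreasing_def
proof
  fix N :: nat
  have "(1 + norm x) ^ N * norm (exp (- (x \<bullet> x))) \<le> exp (real N ^ 2)" for x :: 'a
  proof -
    have "(1 + norm x) ^ N \<le> exp (norm x) ^ N"
      using exp_ge_add_one_self[of "norm x"] by (intro power_mono) auto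
    then have "(1 + norm x) ^ N * exp (- (x \<bullet> x)) \<le> exp (real N * norm x) * exp (- (x \<bullet> x))"
      by (intro mult_right_mono) (auto simp: exp_of_nat_mult)
    also have "\<dots> = exp (real N * norm x - norm x ^ 2)"
      by (simp add: exp_diff exp_minus dot_square_norm field_simps)
    also have "\<dots> \<le> exp (real N ^ 2)"
    proof -
      have "0 \<le> (norm x - real N / 2) ^ 2 + 3/4 * real N ^ 2" by simp
      also have "\<dots> = norm x ^ 2 - real N * norm x + real N ^ 2" by (simp add: power2_eq_square algebra_simps)
      finally show ?thesis by simp
    qed
    finally show ?thesis by simp
  qed
  then show "\<exists>C. \<forall>x::'a. (1 + norm x) ^ N * norm (exp (- (x \<bullet> x))) \<le> C" by blast
qed

lemma schwartz_gaussian: "schwartz (\<lambda>x::'a::euclidean_space. exp (- (x \<bullet> x)))"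
proof (rule schwartz_coinduct[where P = gaussian_polynomial])
  have gauss: "((\<lambda>x. exp (- (x \<bullet> x))) has_derivative (\<lambda>v. exp (- (x \<bullet> x)) * (- (x \<bullet> v + v \<bullet> x)))) (at x)"
    for x :: 'a by (auto intro!: derivative_eq_intros)
  show diff: "f differentiable (at x)" if "gaussian_polynomial f" for f :: "'a \<Rightarrow> real" and x
    using that
  proof induction
    case gaussian
    show ?case using gauss[of x] unfolding differentiable_def by blast
  qed (auto intro!: differentiable_mult differentiable_add differentiable_inner)
  show "rapidly_decreasing f" if "gaussian_polynomial f" for f :: "'a \<Rightarrow> real"
    using that
  proof induction
    case gaussian
    show ?case by (rule rapidly_decreasing_gaussian)
  next
    case (scale f c)
    then show ?case by (intro rapidly_decreasing_bound[OF scale(2), of "\<bar>c\<bar>" _ 0]) (auto simp: abs_mult)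
  next
    case (coordinate f b)
    show ?case
    proof (rule rapidly_decreasing_bound[OF coordinate(3), of 1 _ 1])
      fix x
      have "\<bar>x \<bullet> b\<bar> \<le> 1 + norm x" using coordinate(2) Basis_le_norm[of b x] by linarith
      then show "norm ((x \<bullet> b) * f x) \<le> 1 * (1 + norm x) ^ 1 * norm (f x)"
        by (simp add: abs_mult mult_right_mono)
    qed simp
  qed (rule rapidly_decreasing_add)
  show "gaussian_polynomial (partial_deriv b f)" if "gaussian_polynomial f" and b: "b \<in> Basis" for f :: "'a \<Rightarrow> real" and b
    using that(1)
  proof induction
    case gaussian
    have "partial_deriv b (\<lambda>x. exp (- (x \<bullet> x))) = (\<lambda>x. (-2) * ((x \<bullet> b) * exp (- (x \<bullet> x))))"
    proof
      fix x :: 'a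
      from partial_deriv_eq[OF gauss]
      show "partial_deriv b (\<lambda>x. exp (- (x \<bullet> x))) x = (-2) * ((x \<bullet> b) * exp (- (x \<bullet> x)))"
        by (simp add: inner_commute)
    qed
    then show ?case
      by (simp only:) (intro gaussian_polynomial.scale gaussian_polynomial.coordinate gaussian_polynomial.gaussian b)
  next
    case (scale f c)
    have "partial_deriv b (\<lambda>x. c * f x) = (\<lambda>x. c * partial_deriv b f x)"
    proof
      fix x
      show "partial_deriv b (\<lambda>x. c * f x) x = c * partial_deriv b f x"
        using partial_deriv_eq[OF has_derivative_mult_right[OF diff[OF scale(1), unfolded frechet_derivative_works]]]
        by (simp add: partial_deriv_def)
    qed
    then show ?case using gaussian_polynomial.scale[OF scale(2)] by simp
  next
    case (coordinate f c)
    have "partial_deriv b (\<lambda>x. (x \<bullet> c) * f x) = (\<lambda>x. (x \<bullet> c) * partial_deriv b f x + (b \<bullet> c) * f x)"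
    proof
      fix x
      have "((\<lambda>x. (x \<bullet> c) * f x) has_derivative (\<lambda>v. (x \<bullet> c) * frechet_derivative f (at x) v + (v \<bullet> c) * f x)) (at x)"
        using diff[OF coordinate(1), of x] unfolding frechet_derivative_works by (auto intro!: derivative_eq_intros)
      from partial_deriv_eq[OF this]
      show "partial_deriv b (\<lambda>x. (x \<bullet> c) * f x) x = (x \<bullet> c) * partial_deriv b f x + (b \<bullet> c) * f x"
        by (simp add: partial_deriv_def)
    qed
    then show ?case
      using gaussian_polynomial.add[OF gaussian_polynomial.coordinate[OF coordinate(3,2)] gaussian_polynomial.scale[OF coordinate(1)]]
      by simp
  next
    case (add f g)
    have "partial_deriv b (\<lambda>x. f x + g x) = (\<lambda>x. partial_deriv b f x + partial_deriv b g x)"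
      using diff[OF add(1)] diff[OF add(2)] by (auto simp: partial_deriv_add)
    then show ?case using gaussian_polynomial.add[OF add(3,4)] by simp
  qed
qed (rule gaussian_polynomial.gaussian)

lemma frechet_derivative_zero_on_open:
  assumes "open S" "\<And>y. y \<in> S \<Longrightarrow> f y = 0" "x \<in> S"
  shows "frechet_derivative f (at x) = (\<lambda>v. 0)"
proof -
  have "(f has_derivative (\<lambda>v. 0)) (at x)"
    by (rule has_derivative_transform_within_open[OF _ assms(1,3), of "\<lambda>_. 0"]) (auto simp: assms(2))
  from frechet_derivative_at[OF this] show ?thesis by (rule sym)
qed

text \<open>The invariant class is that of smooth functions vanishing off one fixed compact set.
  Derivatives vanish there too because the complement is open, and continuity on the compact set
  gives every decay bound.\<close>

lemma schwartz_test_function: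
  assumes "f \<in> C\<^sub>c\<^sup>\<infinity> W"
  shows "schwartz f"
proof -
  let ?K = "closure {x. f x \<noteq> 0}"
  have f: "smooth f" "compact ?K" using assms by (auto simp: test_functions_def)
  show ?thesis
  proof (rule schwartz_coinduct[where P = "\<lambda>g. smooth g \<and> (\<forall>x. x \<notin> ?K \<longrightarrow> g x = 0)"])
    show "smooth f \<and> (\<forall>x. x \<notin> ?K \<longrightarrow> f x = 0)"
      using f(1) closure_subset[of "{x. f x \<noteq> 0}"] by auto
  next
    fix g :: "'a \<Rightarrow> real" and x
    assume g: "smooth g \<and> (\<forall>x. x \<notin> ?K \<longrightarrow> g x = 0)"
    then show "g differentiable (at x)"
      by (auto simp: smooth_def iter_deriv_def dest!: spec[of _ "[]"])
    show "smooth (partial_deriv b g) \<and> (\<forall>x. x \<notin> ?K \<longrightarrow> partial_deriv b g x = 0)" if "b \<in> Basis" for b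
      using g that frechet_derivative_zero_on_open[OF open_Compl[OF closed_closure], of "{x. f x \<noteq> 0}" g]
      by (auto simp: smooth_def iter_deriv_partial_deriv partial_deriv_def)
    show "rapidly_decreasing g"
      unfolding rapidly_decreasing_def
    proof
      fix N
      have "continuous_on ?K (\<lambda>x. (1 + norm x) ^ N * norm (g x))"
        using g by (intro continuous_intros continuous_on_subset[OF smooth_imp_continuous]) auto
      then have "bounded ((\<lambda>x. (1 + norm x) ^ N * norm (g x)) ` ?K)"
        by (intro compact_imp_bounded compact_continuous_image f(2))
      then obtain C where C: "\<And>x. x \<in> ?K \<Longrightarrow> (1 + norm x) ^ N * norm (g x) \<le> C"
        unfolding bounded_iff by (auto dest!: abs_le_D1)
      have "(1 + norm x) ^ N * norm (g x) \<le> max C 0" for x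
        using C[of x] g by (cases "x \<in> ?K") auto
      then show "\<exists>C. \<forall>x. (1 + norm x) ^ N * norm (g x) \<le> C" by blast
    qed
  qed
qed


section \<open>Integration of rapidly decreasing functions\<close>

text \<open>\<open>arctan\<close> is an antiderivative with a limit at infinity, which settles one
  half-line; reflection settles the other.\<close>

lemma integrable_inverse_one_plus_square: "integrable lborel (\<lambda>t::real. 1 / (1 + t\<^sup>2))"
proof (rule integrableI_nonneg)
  let ?f = "\<lambda>t::real. 1 / (1 + t\<^sup>2)"
  have half: "(\<integral>\<^sup>+t. ennreal (?f t) * indicator {0..} t \<partial>lborel) = ennreal (pi / 2 - arctan 0)"
    by (rule nn_integral_FTC_atLeast)
      (auto intro!: derivative_eq_intros tendsto_arctan_at_top simp: inverse_eq_divide)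
  have "(\<integral>\<^sup>+t. ennreal (?f t) * indicator {..0} t \<partial>lborel) = (\<integral>\<^sup>+t. ennreal (?f t) * indicator {0..} t \<partial>lborel)"
    by (subst nn_integral_real_affine[where c = "-1" and t = 0]) (auto intro!: nn_integral_cong simp: indicator_def)
  then have "(\<integral>\<^sup>+t. (ennreal (?f t) * indicator {0..} t + ennreal (?f t) * indicator {..0} t) \<partial>lborel) < \<infinity>"
    by (subst nn_integral_add) (auto simp: half)
  moreover have "(\<integral>\<^sup>+t. ennreal (?f t) \<partial>lborel) \<le> (\<integral>\<^sup>+t. (ennreal (?f t) * indicator {0..} t + ennreal (?f t) * indicator {..0} t) \<partial>lborel)"
    by (intro nn_integral_mono) (auto simp: indicator_def)
  ultimately show "(\<integral>\<^sup>+t. ennreal (?f t) \<partial>lborel) < \<infinity>"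
    by (rule order.strict_trans1[rotated])
qed auto

text \<open>A fixed integrable majorant. The exponent is twice the dimension so that every
  coordinate receives one factor (1 + |x|)^2, which dominates 1 + (x_b)^2; the integral is then
  compared with a product of one-dimensional ones.\<close>

definition decay_weight :: "'a::euclidean_space \<Rightarrow> real"
  where "decay_weight x = 1 / (1 + norm x) ^ (2 * DIM('a))"

lemma decay_weight_pos: "0 < decay_weight x"
  by (simp add: decay_weight_def add_pos_nonneg)

lemma decay_weight_measurable [measurable]: "decay_weight \<in> borel_measurable borel"
  unfolding decay_weight_def[abs_def] by measurable

lemma integrable_decay_weight: "integrable lborel (decay_weight :: 'a::euclidean_space \<Rightarrow> real)"
proof (rule integrableI_nonneg)
  have "(\<integral>\<^sup>+x. ennreal (decay_weight (x::'a)) \<partial>lborel) \<le> (\<integral>\<^sup>+(x::'a). (\<Prod>b\<in>Basis. ennreal (1 / (1 + (x \<bullet> b)\<^sup>2))) \<partial>lborel)"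
  proof (intro nn_integral_mono)
    fix x :: 'a
    have "(\<Prod>b\<in>Basis. 1 + (x \<bullet> b)\<^sup>2) \<le> (\<Prod>b\<in>(Basis::'a set). (1 + norm x)\<^sup>2)"
    proof (intro prod_mono conjI)
      fix b :: 'a assume "b \<in> Basis"
      then have "\<bar>x \<bullet> b\<bar>\<^sup>2 \<le> (norm x)\<^sup>2" by (intro power_mono Basis_le_norm) auto
      also have "1 + (norm x)\<^sup>2 \<le> (1 + norm x)\<^sup>2" by (simp add: power2_sum)
      finally show "1 + (x \<bullet> b)\<^sup>2 \<le> (1 + norm x)\<^sup>2" by simp
    qed auto
    also have "\<dots> = (1 + norm x) ^ (2 * DIM('a))" by (simp add: power_mult)
    finally have "decay_weight x \<le> 1 / (\<Prod>b\<in>Basis. 1 + (x \<bullet> b)\<^sup>2)"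
      unfolding decay_weight_def
      by (intro divide_left_mono mult_pos_pos prod_pos) (auto simp: add_pos_nonneg)
    also have "\<dots> = (\<Prod>b\<in>Basis. 1 / (1 + (x \<bullet> b)\<^sup>2))" by (simp add: prod_dividef)
    finally show "ennreal (decay_weight x) \<le> (\<Prod>b\<in>Basis. ennreal (1 / (1 + (x \<bullet> b)\<^sup>2)))"
      by (subst prod_ennreal) (auto intro: ennreal_leI)
  qed
  also have "\<dots> = (\<Prod>b\<in>(Basis::'a set). \<integral>\<^sup>+t. ennreal (1 / (1 + t\<^sup>2)) \<partial>lborel)"
    by (rule nn_integral_lborel_prod) auto
  also have "\<dots> < \<infinity>"
    using integrable_inverse_one_plus_square unfolding integrable_iff_bounded
    by (simp add: power_less_top_ennreal)
  finally show "(\<integral>\<^sup>+x. ennreal (decay_weight (x::'a)) \<partial>lborel) < \<infinity>" .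
qed (auto simp: less_imp_le[OF decay_weight_pos])

lemma integrable_by_decay:
  fixes f :: "'a::euclidean_space \<Rightarrow> 'b::{banach, second_countable_topology}"
  assumes "f \<in> borel_measurable borel" and "\<And>x. norm (f x) \<le> C * decay_weight x"
  shows "integrable lborel f"
  by (rule Bochner_Integration.integrable_bound[of _ "\<lambda>x. C * decay_weight x"])
    (use assms integrable_decay_weight in \<open>auto intro: order_trans[OF _ abs_ge_self]\<close>)

lemma rapidly_decreasing_power_bound:
  assumes "rapidly_decreasing f"
  obtains C where "0 \<le> C" "\<And>x. (1 + norm x) ^ N * norm (f x) \<le> C * decay_weight x"
proof -
  let ?n = "2 * DIM('a)"
  obtain C where C: "\<And>x. (1 + norm x) ^ (N + ?n) * norm (f x) \<le> C"
    using assms unfolding rapidly_decreasing_def by blast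
  have "0 \<le> C" using C[of 0] order_trans[OF norm_ge_zero[of "f 0"]] by simp
  moreover have "(1 + norm x) ^ N * norm (f x) \<le> C * decay_weight x" for x
    using C[of x] zero_less_power[of "1 + norm x" ?n]
    by (simp add: decay_weight_def power_add pos_le_divide_eq add_pos_nonneg mult_ac)
  ultimately show ?thesis using that by blast
qed

lemma rapidly_decreasing_integrable:
  fixes f :: "'a::euclidean_space \<Rightarrow> 'b::{banach, second_countable_topology}"
  assumes "rapidly_decreasing f" "f \<in> borel_measurable borel"
  shows "integrable lborel f"
  using rapidly_decreasing_power_bound[OF assms(1), of 0] integrable_by_decay[OF assms(2)]
  by (metis mult_1 power_0)

lemma schwartz_integrable:
  fixes f :: "'a::euclidean_space \<Rightarrow> 'b::{banach, second_countable_topology}"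
  shows "schwartz f \<Longrightarrow> integrable lborel f"
  by (intro rapidly_decreasing_integrable schwartz_rapidly_decreasing schwartz_measurable)

text \<open>The constant is a seminorm of \<open>f\<close> and not just some number, since
  continuity estimates for functionals must be uniform in \<open>f\<close>.\<close>

lemma schwartz_seminorm_le_decay_weight:
  assumes "schwartz f"
  shows "(1 + norm x) ^ N * norm (f x) \<le> schwartz_seminorm (N + 2 * DIM('a)) f * decay_weight (x::'a::euclidean_space)"
  using schwartz_seminorm_upper[OF assms, of "[]" "N + 2 * DIM('a)" x] zero_less_power[of "1 + norm x" "2 * DIM('a)"]
  by (simp add: iter_deriv_def decay_weight_def power_add pos_le_divide_eq add_pos_nonneg mult_ac)

lemma integral_norm_le_schwartz_seminorm:
  fixes f :: "'a::euclidean_space \<Rightarrow> 'b::{banach, second_countable_topology}"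
  assumes "schwartz f"
  shows "(\<integral>x. norm (f x) \<partial>lborel) \<le> schwartz_seminorm (2 * DIM('a)) f * (\<integral>x. decay_weight (x::'a) \<partial>lborel)"
proof -
  have "(\<integral>x. norm (f x) \<partial>lborel) \<le> (\<integral>x. schwartz_seminorm (2 * DIM('a)) f * decay_weight (x::'a) \<partial>lborel)"
    using schwartz_seminorm_le_decay_weight[OF assms, where N = 0]
    by (intro integral_mono integrable_norm schwartz_integrable assms integrable_mult_right integrable_decay_weight) simp
  then show ?thesis by simp
qed

text \<open>The index limits the order and fixes the weight at once: the extra derivative needs
  order \<open>Suc K\<close>, and the larger weight that comes with it only helps.\<close>

lemma schwartz_seminorm_partial_deriv:
  assumes "schwartz f" "b \<in> Basis"
  shows "schwartz_seminorm K (partial_deriv b f) \<le> schwartz_seminorm (Suc K) f"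
proof -
  have "(1 + norm x) ^ K * norm (iter_deriv bs (partial_deriv b f) x) \<le> schwartz_seminorm (Suc K) f"
    if "set bs \<subseteq> Basis" "length bs \<le> K" for x bs
  proof -
    have "(1 + norm x) ^ K * norm (iter_deriv (bs @ [b]) f x) \<le> (1 + norm x) ^ Suc K * norm (iter_deriv (bs @ [b]) f x)"
      by (intro mult_right_mono power_increasing) auto
    also have "\<dots> \<le> schwartz_seminorm (Suc K) f"
      using assms that by (intro schwartz_seminorm_upper) auto
    finally show ?thesis by (simp add: iter_deriv_partial_deriv)
  qed
  then show ?thesis
    unfolding schwartz_seminorm_def[of K]
    by (intro cSUP_least) (auto intro!: exI[of _ "[]"])
qed

section \<open>Change of variables and integration by parts\<close>

lemma integral_lborel_affine:
  fixes f :: "'a::euclidean_space \<Rightarrow> 'b::{banach, second_countable_topology}"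
  assumes [measurable]: "f \<in> borel_measurable borel" and c: "c \<noteq> 0"
  shows "(\<integral>x. f x \<partial>lborel) = \<bar>c\<bar> ^ DIM('a) *\<^sub>R (\<integral>x. f (a + c *\<^sub>R x) \<partial>lborel)"
  using c by (subst lborel_affine[OF c, of a]) (simp add: integral_density integral_distr)

lemma integral_lborel_translation:
  fixes f :: "'a::euclidean_space \<Rightarrow> 'b::{banach, second_countable_topology}"
  assumes "f \<in> borel_measurable borel"
  shows "(\<integral>x. f (x + a) \<partial>lborel) = (\<integral>x. f x \<partial>lborel)"
  using integral_lborel_affine[OF assms, of 1 a] by (simp add: add.commute)

text \<open>Difference quotients in direction \<open>b\<close> have integral 0 by translation
  invariance, and they converge to the derivative under a common integrable majorant. This yields
  integration by parts without slicing the space into lines.\<close>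

lemma integral_partial_deriv_eq_0:
  fixes h :: "'a::euclidean_space \<Rightarrow> complex"
  assumes h: "schwartz h" and b: "b \<in> Basis"
  shows "(\<integral>x. partial_deriv b h x \<partial>lborel) = 0"
proof -
  define q where "q n x = real (Suc n) *\<^sub>R (h (x + (1 / real (Suc n)) *\<^sub>R b) - h x)" for n x
  have [measurable]: "h \<in> borel_measurable borel" by (rule schwartz_measurable[OF h])
  have ih: "integrable lborel h" by (rule schwartz_integrable[OF h])
  have ihs: "integrable lborel (\<lambda>x. h (x + a))" for a
    using schwartz_integrable[OF schwartz_affine[OF h, of 1 a]] by (simp add: add.commute)
  have q0: "(\<integral>x. q n x \<partial>lborel) = 0" for n
    unfolding q_def using ih ihs by (simp add: integral_lborel_translation)
  have deriv: "((\<lambda>t. h (x + t *\<^sub>R b)) has_vector_derivative partial_deriv b h (x + t *\<^sub>R b)) (at t)" for x t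
  proof -
    have "((\<lambda>t. h (x + t *\<^sub>R b)) has_derivative (\<lambda>v. frechet_derivative h (at (x + t *\<^sub>R b)) (v *\<^sub>R b))) (at t)"
      by (rule has_derivative_compose[OF _ schwartz_has_derivative[OF h], where f = "\<lambda>t. x + t *\<^sub>R b"])
        (auto intro!: derivative_eq_intros)
    then show ?thesis
      using linear_frechet_derivative[OF schwartz_differentiable[OF h]]
      by (simp add: has_vector_derivative_def partial_deriv_def linear_cmul)
  qed
  obtain C where C: "0 \<le> C" "\<And>x. norm (partial_deriv b h x) \<le> C * decay_weight x"
    using rapidly_decreasing_power_bound[OF schwartz_rapidly_decreasing[OF schwartz_partial_deriv[OF h b]], of 0]
    by (metis mult_1 power_0)
  \<comment> \<open>By the mean value inequality the quotient is bounded by the derivative at a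
    point less than 1 away from \<open>x\<close>. Moving by less than 1 changes
    \<open>decay_weight\<close> by at most the factor 2^(2n), where n is the dimension.\<close>
  have qbound: "norm (q n x) \<le> (C * 2 ^ (2 * DIM('a))) * decay_weight x" for n x
  proof -
    let ?e = "1 / real (Suc n)"
    have "\<exists>t\<in>{0<..<?e}. norm (h (x + ?e *\<^sub>R b) - h (x + 0 *\<^sub>R b)) \<le> norm ((?e - 0) *\<^sub>R partial_deriv b h (x + t *\<^sub>R b))"
      using deriv unfolding has_vector_derivative_def
      by (intro mvt_general) (auto intro!: continuous_at_imp_continuous_on has_derivative_continuous)
    then obtain t where t: "0 < t" "t < ?e" "norm (h (x + ?e *\<^sub>R b) - h x) \<le> ?e * norm (partial_deriv b h (x + t *\<^sub>R b))"
      by auto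
    have "norm (q n x) = real (Suc n) * norm (h (x + ?e *\<^sub>R b) - h x)"
      by (simp add: q_def)
    also have "\<dots> \<le> real (Suc n) * (?e * norm (partial_deriv b h (x + t *\<^sub>R b)))"
      by (intro mult_left_mono t) auto
    also have "\<dots> = norm (partial_deriv b h (x + t *\<^sub>R b))" by simp
    also have "\<dots> \<le> C * decay_weight (x + t *\<^sub>R b)" by (rule C)
    also have "\<dots> \<le> C * (2 ^ (2 * DIM('a)) * decay_weight x)"
    proof (intro mult_left_mono C)
      have "?e \<le> 1" by simp
      then have t1: "t < 1" using t by linarith
      have "norm x \<le> norm (x + t *\<^sub>R b) + norm (t *\<^sub>R b)"
        using norm_triangle_ineq4[of "x + t *\<^sub>R b" "t *\<^sub>R b"] by simp
      also have "\<dots> \<le> norm (x + t *\<^sub>R b) + 1" using t t1 b by simp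
      finally have "norm x \<le> norm (x + t *\<^sub>R b) + 1" .
      then have "1 + norm x \<le> 2 * (1 + norm (x + t *\<^sub>R b))"
      proof -
        have "1 + u \<le> 2 * (1 + v)" if "u \<le> v + 1" "0 \<le> v" for u v :: real
          using that by simp
        then show ?thesis using \<open>norm x \<le> norm (x + t *\<^sub>R b) + 1\<close> norm_ge_zero by blast
      qed
      then have "(1 + norm x) ^ (2 * DIM('a)) \<le> (2 * (1 + norm (x + t *\<^sub>R b))) ^ (2 * DIM('a))"
        by (intro power_mono) auto
      then have "(1 + norm x) ^ (2 * DIM('a)) \<le> 2 ^ (2 * DIM('a)) * (1 + norm (x + t *\<^sub>R b)) ^ (2 * DIM('a))"
        by (simp only: power_mult_distrib)
      then show "decay_weight (x + t *\<^sub>R b) \<le> 2 ^ (2 * DIM('a)) * decay_weight x"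
        unfolding decay_weight_def
        by (simp add: divide_le_eq pos_le_divide_eq zero_less_power add_pos_nonneg field_simps)
    qed
    finally show ?thesis by simp
  qed
  have qlim: "(\<lambda>n. q n x) \<longlonglongrightarrow> partial_deriv b h x" for x
  proof -
    have "((\<lambda>t. (h (x + t *\<^sub>R b) - h x) /\<^sub>R t) \<longlongrightarrow> partial_deriv b h x) (at 0)"
    proof -
      let ?D = "partial_deriv b h x"
      have "((\<lambda>t. h (x + t *\<^sub>R b)) has_derivative (\<lambda>t. t *\<^sub>R ?D)) (at 0)"
        using deriv[of x 0] by (simp add: has_vector_derivative_def)
      then have "((\<lambda>t. norm ((h (x + t *\<^sub>R b) - h x - t *\<^sub>R ?D) /\<^sub>R norm t)) \<longlongrightarrow> 0) (at 0)"
        by (intro tendsto_norm_zero) (simp add: has_derivative_def)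
      then have "((\<lambda>t. norm ((h (x + t *\<^sub>R b) - h x) /\<^sub>R t - ?D)) \<longlongrightarrow> 0) (at 0)"
      proof (rule Lim_transform_eventually)
        \<comment> \<open>Differentiability divides the remainder by |t|, the difference quotient by
          t; in norm the two agree.\<close>
        have "norm ((u - t *\<^sub>R ?D) /\<^sub>R norm t) = norm (u /\<^sub>R t - ?D)" if "t \<noteq> 0" for t :: real and u
        proof -
          have "u /\<^sub>R t - ?D = (u - t *\<^sub>R ?D) /\<^sub>R t" using that by (simp add: scaleR_right_diff_distrib)
          then show ?thesis by simp
        qed
        then show "\<forall>\<^sub>F t in at 0. norm ((h (x + t *\<^sub>R b) - h x - t *\<^sub>R ?D) /\<^sub>R norm t) = norm ((h (x + t *\<^sub>R b) - h x) /\<^sub>R t - ?D)"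
          by (simp add: eventually_at_filter)
      qed
      then show ?thesis by (simp add: tendsto_norm_zero_iff LIM_zero_iff)
    qed
    moreover have "filterlim (\<lambda>n. 1 / real (Suc n)) (at 0) sequentially"
      by (rule filterlim_atI) (use LIMSEQ_inverse_real_of_nat in \<open>auto simp: inverse_eq_divide\<close>)
    ultimately have "(\<lambda>n. (h (x + (1 / real (Suc n)) *\<^sub>R b) - h x) /\<^sub>R (1 / real (Suc n))) \<longlonglongrightarrow> partial_deriv b h x"
      by (rule filterlim_compose)
    then show ?thesis unfolding q_def by simp
  qed
  have "(\<lambda>n. \<integral>x. q n x \<partial>lborel) \<longlonglongrightarrow> (\<integral>x. partial_deriv b h x \<partial>lborel)"
  proof (rule integral_dominated_convergence[where w = "\<lambda>x. (C * 2 ^ (2 * DIM('a))) * decay_weight x"])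
    show "partial_deriv b h \<in> borel_measurable lborel"
      using schwartz_measurable[OF schwartz_partial_deriv[OF h b]] by simp
    show "q n \<in> borel_measurable lborel" for n unfolding q_def by measurable
    show "integrable lborel (\<lambda>x::'a. (C * 2 ^ (2 * DIM('a))) * decay_weight x)"
      by (intro integrable_mult_right integrable_decay_weight)
  qed (use qlim qbound in auto)
  then show ?thesis by (simp add: q0 LIMSEQ_const_iff)
qed

section \<open>The Fourier transform of Schwartz functions\<close>

lemma borel_measurable_cis [measurable (raw)]:
  "f \<in> borel_measurable M \<Longrightarrow> (\<lambda>x. cis (f x)) \<in> borel_measurable M"
  by (rule measurable_compose[OF _ borel_measurable_continuous_onI]) (auto intro!: continuous_intros continuous_on_cis)

text \<open>The exponential has modulus 1 on the imaginary axis, a convex set, so the mean value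
  inequality holds there with constant 1.\<close>

lemma norm_cis_minus_one_le: "norm (cis t - 1) \<le> \<bar>t\<bar>"
proof -
  have "norm (exp (\<i> * t) - exp 0) \<le> 1 * norm (\<i> * t - 0)"
    by (rule field_differentiable_bound[where S = "{z. Re z = 0}" and f' = exp])
      (auto simp: convex_def intro!: derivative_eq_intros)
  then show ?thesis by (simp add: cis_conv_exp norm_mult)
qed

text \<open>The mean value inequality for exp z - z, whose derivative exp z - 1 is at most |t| on
  the part of the imaginary axis inside the ball of radius |t|. The quadratic order is the point,
  not the constant.\<close>

lemma norm_cis_minus_linear_le: "norm (cis t - 1 - \<i> * t) \<le> t\<^sup>2"
proof -
  have "norm ((exp (\<i> * t) - \<i> * t) - (exp 0 - 0)) \<le> \<bar>t\<bar> * norm (\<i> * t - 0)"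
  proof (rule field_differentiable_bound[where S = "{z. Re z = 0} \<inter> cball 0 \<bar>t\<bar>" and f' = "\<lambda>z. exp z - 1"])
    fix z :: complex assume z: "z \<in> {z. Re z = 0} \<inter> cball 0 \<bar>t\<bar>"
    then have "z = \<i> * Im z" by (simp add: complex_eq_iff)
    then have "exp z = cis (Im z)" by (metis cis_conv_exp)
    moreover have "\<bar>Im z\<bar> \<le> \<bar>t\<bar>" using z abs_Im_le_cmod[of z] by simp
    ultimately show "norm (exp z - 1) \<le> \<bar>t\<bar>" using norm_cis_minus_one_le[of "Im z"] by simp
  qed (auto intro!: derivative_eq_intros convex_Int convex_cball simp: norm_mult, auto simp: convex_def)
  then show ?thesis by (simp add: cis_conv_exp norm_mult power2_eq_square algebra_simps)
qed

lemma schwartz_complex_mult: "schwartz f \<Longrightarrow> schwartz (\<lambda>x. (c::complex) * f x)"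
  by (rule schwartz_bounded_linear[OF bounded_linear_mult_right])

text \<open>Differentiating cis(x . a) g replaces \<open>g\<close> by the Schwartz function i (b .
  a) g plus a partial derivative of \<open>g\<close>, so the modulated functions form an invariant
  class. The explicit derivative is the product rule behind integration by parts.\<close>

lemma schwartz_cis_mult:
  fixes f :: "'a::euclidean_space \<Rightarrow> complex"
  assumes "schwartz f"
  shows "schwartz (\<lambda>x. cis (x \<bullet> a) * f x)"
    and "partial_deriv b (\<lambda>x. cis (x \<bullet> a) * f x) x = cis (x \<bullet> a) * (\<i> * (b \<bullet> a) * f x + partial_deriv b f x)"
proof -
  have D: "((\<lambda>x. cis (x \<bullet> a) * g x) has_derivative
      (\<lambda>v. cis (x \<bullet> a) * frechet_derivative g (at x) v + ((v \<bullet> a) *\<^sub>R (\<i> * cis (x \<bullet> a))) * g x)) (at x)"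
    if "schwartz g" for g x
  proof (intro has_derivative_mult schwartz_has_derivative that)
    have "(cis has_vector_derivative (\<i> * cis t)) (at t)" for t
    proof -
      have "((\<lambda>t. exp (\<i> * complex_of_real t)) has_vector_derivative (\<i> * exp (\<i> * t))) (at t)"
        by (rule has_vector_derivative_real_field) (auto intro!: derivative_eq_intros)
      then show ?thesis by (simp flip: cis_conv_exp)
    qed
    then have c: "(cis has_derivative (\<lambda>v. v *\<^sub>R (\<i> * cis t))) (at t)" for t
      by (simp add: has_vector_derivative_def)
    show "((\<lambda>x. cis (x \<bullet> a)) has_derivative (\<lambda>v. (v \<bullet> a) *\<^sub>R (\<i> * cis (x \<bullet> a)))) (at x)"
      by (rule has_derivative_compose[OF _ c, where f = "\<lambda>x. x \<bullet> a"]) (auto intro!: derivative_eq_intros)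
  qed
  have pd: "partial_deriv b (\<lambda>x. cis (x \<bullet> a) * g x) x = cis (x \<bullet> a) * (\<i> * (b \<bullet> a) * g x + partial_deriv b g x)"
    if "schwartz g" for g b x
    unfolding partial_deriv_eq[OF D[OF that]]
    by (simp add: partial_deriv_def scaleR_conv_of_real algebra_simps)
  show "partial_deriv b (\<lambda>x. cis (x \<bullet> a) * f x) x = cis (x \<bullet> a) * (\<i> * (b \<bullet> a) * f x + partial_deriv b f x)"
    by (rule pd[OF assms])
  show "schwartz (\<lambda>x. cis (x \<bullet> a) * f x)"
  proof (rule schwartz_coinduct[where P = "\<lambda>f. \<exists>g. schwartz g \<and> f = (\<lambda>x. cis (x \<bullet> a) * g x)"])
    fix f :: "'a \<Rightarrow> complex"
    assume "\<exists>g. schwartz g \<and> f = (\<lambda>x. cis (x \<bullet> a) * g x)"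
    then obtain g where g: "schwartz g" and f: "f = (\<lambda>x. cis (x \<bullet> a) * g x)" by blast
    show "f differentiable (at x)" for x
      using D[OF g] unfolding f differentiable_def by blast
    show "\<exists>g. schwartz g \<and> partial_deriv b f = (\<lambda>x. cis (x \<bullet> a) * g x)" if "b \<in> Basis" for b
      using g that by (intro exI[of _ "\<lambda>x. \<i> * (b \<bullet> a) * g x + partial_deriv b g x"])
        (auto simp: f pd fun_eq_iff intro!: schwartz_add schwartz_complex_mult schwartz_partial_deriv)
    show "rapidly_decreasing f"
      by (rule rapidly_decreasing_bound[OF schwartz_rapidly_decreasing[OF g], of 1 _ 0])
        (auto simp: f norm_mult)
  next
    show "\<exists>g. schwartz g \<and> (\<lambda>x. cis (x \<bullet> a) * f x) = (\<lambda>x. cis (x \<bullet> a) * g x)"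
      by (intro exI[of _ f] conjI assms refl)
  qed
qed

lemma integrable_cis_mult:
  fixes f :: "'a::euclidean_space \<Rightarrow> complex"
  assumes "integrable lborel f"
  shows "integrable lborel (\<lambda>x. cis (- (x \<bullet> a)) * f x)"
  by (rule Bochner_Integration.integrable_bound[OF assms]) (use assms in \<open>auto simp: norm_mult\<close>)

section \<open>Decay and differentiability of the transform\<close>

definition fourier_const :: "'a::euclidean_space itself \<Rightarrow> real"
  where "fourier_const _ = (2 * pi) powr (- real DIM('a) / 2)"

lemma fourier_const_pos: "0 < fourier_const TYPE('a::euclidean_space)"
  by (simp add: fourier_const_def)

lemma fourier_eq:
  "fourier \<phi> \<xi> = complex_of_real (fourier_const TYPE('a::euclidean_space)) * (\<integral>x. cis (- (x \<bullet> \<xi>)) * \<phi> (x::'a) \<partial>lborel)"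
  by (simp add: fourier_def fourier_const_def)

lemma norm_fourier_le:
  fixes \<phi> :: "'a::euclidean_space \<Rightarrow> complex"
  assumes "integrable lborel \<phi>"
  shows "norm (fourier \<phi> \<xi>) \<le> fourier_const TYPE('a) * (\<integral>x. norm (\<phi> x) \<partial>lborel)"
proof -
  have "norm (\<integral>x. cis (- (x \<bullet> \<xi>)) * \<phi> x \<partial>lborel) \<le> (\<integral>x. norm (cis (- (x \<bullet> \<xi>)) * \<phi> x) \<partial>lborel)"
    by (rule integral_norm_bound)
  also have "\<dots> = (\<integral>x. norm (\<phi> x) \<partial>lborel)" by (simp add: norm_mult)
  finally show ?thesis
    using fourier_const_pos[where 'a = 'a] by (simp add: fourier_eq norm_mult)
qed

text \<open>The modulated function cis(-(x . \<xi>)) \<phi> has a partial derivative with integral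
  0; expanding it by the product rule gives the claim.\<close>

lemma fourier_partial_deriv:
  fixes \<phi> :: "'a::euclidean_space \<Rightarrow> complex"
  assumes "schwartz \<phi>" "b \<in> Basis"
  shows "fourier (partial_deriv b \<phi>) \<xi> = \<i> * (\<xi> \<bullet> b) * fourier \<phi> \<xi>"
proof -
  let ?e = "\<lambda>x. cis (- (x \<bullet> \<xi>))"
  have i: "integrable lborel (\<lambda>x. ?e x * \<phi> x)" "integrable lborel (\<lambda>x. ?e x * partial_deriv b \<phi> x)"
    by (intro integrable_cis_mult schwartz_integrable schwartz_partial_deriv assms)+
  have "0 = (\<integral>x. partial_deriv b (\<lambda>x. cis (x \<bullet> (- \<xi>)) * \<phi> x) x \<partial>lborel)"
    by (rule integral_partial_deriv_eq_0[OF schwartz_cis_mult(1)[OF assms(1)] assms(2), symmetric])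
  also have "\<dots> = (\<integral>x. (- \<i> * (b \<bullet> \<xi>)) * (?e x * \<phi> x) + ?e x * partial_deriv b \<phi> x \<partial>lborel)"
    unfolding schwartz_cis_mult(2)[OF assms(1)]
    by (intro Bochner_Integration.integral_cong refl) (simp add: algebra_simps)
  also have "\<dots> = (- \<i> * (b \<bullet> \<xi>)) * (\<integral>x. ?e x * \<phi> x \<partial>lborel) + (\<integral>x. ?e x * partial_deriv b \<phi> x \<partial>lborel)"
    using i by simp
  finally have "(\<integral>x. ?e x * partial_deriv b \<phi> x \<partial>lborel) = \<i> * (b \<bullet> \<xi>) * (\<integral>x. ?e x * \<phi> x \<partial>lborel)"
    by (simp add: add_eq_0_iff)
  then show ?thesis by (simp add: fourier_eq inner_commute)
qed

text \<open>Each further power of |\<xi>| is bounded by the sum of the coordinates |\<xi> . b|, and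
  a coordinate times the transform is, up to a unit factor, the transform of a partial derivative.
  The constants are chosen before \<open>\<phi>\<close> because the bound later serves as a
  continuity estimate.\<close>

lemma fourier_decay:
  "\<exists>C\<ge>0. \<exists>K. \<forall>\<phi>::'a::euclidean_space \<Rightarrow> complex. schwartz \<phi> \<longrightarrow>
     (\<forall>\<xi>. (1 + norm \<xi>) ^ N * norm (fourier \<phi> \<xi>) \<le> C * schwartz_seminorm K \<phi>)"
proof (induction N)
  case 0
  let ?C = "fourier_const TYPE('a) * (\<integral>x. decay_weight (x::'a) \<partial>lborel)"
  have "norm (fourier \<phi> \<xi>) \<le> ?C * schwartz_seminorm (2 * DIM('a)) \<phi>"
    if \<phi>: "schwartz \<phi>" for \<phi> :: "'a \<Rightarrow> complex" and \<xi>
    using norm_fourier_le[OF schwartz_integrable[OF \<phi>], of \<xi>]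
      mult_left_mono[OF integral_norm_le_schwartz_seminorm[OF \<phi>] less_imp_le[OF fourier_const_pos[where 'a = 'a]]]
    by (simp add: mult_ac)
  moreover have "0 \<le> ?C"
    using less_imp_le[OF decay_weight_pos] less_imp_le[OF fourier_const_pos[where 'a = 'a]]
    by (intro mult_nonneg_nonneg integral_nonneg_AE) auto
  ultimately show ?case by (intro exI[of _ ?C] conjI exI[of _ "2 * DIM('a)"]) auto
next
  case (Suc N)
  then obtain C K where C: "0 \<le> C" and IH: "\<And>\<phi>::'a \<Rightarrow> complex. \<And>\<xi>. schwartz \<phi> \<Longrightarrow>
      (1 + norm \<xi>) ^ N * norm (fourier \<phi> \<xi>) \<le> C * schwartz_seminorm K \<phi>" by blast
  \<comment> \<open>One summand comes from the 1 in 1 + |\<xi>| and one from each basis vector; the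
    derivative costs one step of the seminorm index.\<close>
  have "(1 + norm \<xi>) ^ Suc N * norm (fourier \<phi> \<xi>) \<le> (C * (1 + real DIM('a))) * schwartz_seminorm (Suc K) \<phi>"
    if \<phi>: "schwartz \<phi>" for \<phi> :: "'a \<Rightarrow> complex" and \<xi>
  proof -
    let ?B = "C * schwartz_seminorm (Suc K) \<phi>"
    have 1: "(1 + norm \<xi>) ^ N * norm (fourier \<phi> \<xi>) \<le> ?B"
      using IH[OF \<phi>, of \<xi>] mult_left_mono[OF schwartz_seminorm_mono[OF \<phi>, of K "Suc K"] C] by simp
    have 2: "(1 + norm \<xi>) ^ N * (\<bar>\<xi> \<bullet> b\<bar> * norm (fourier \<phi> \<xi>)) \<le> ?B" if "b \<in> Basis" for b
    proof -
      have "(1 + norm \<xi>) ^ N * norm (fourier (partial_deriv b \<phi>) \<xi>) \<le> ?B"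
        using IH[OF schwartz_partial_deriv[OF \<phi> that], of \<xi>]
          mult_left_mono[OF schwartz_seminorm_partial_deriv[OF \<phi> that, of K] C] by linarith
      then show ?thesis by (simp add: fourier_partial_deriv[OF \<phi> that] norm_mult)
    qed
    have "(1 + norm \<xi>) ^ Suc N * norm (fourier \<phi> \<xi>)
        = (1 + norm \<xi>) ^ N * norm (fourier \<phi> \<xi>) + (1 + norm \<xi>) ^ N * (norm \<xi> * norm (fourier \<phi> \<xi>))"
      by (simp add: algebra_simps)
    also have "\<dots> \<le> (1 + norm \<xi>) ^ N * norm (fourier \<phi> \<xi>) + (1 + norm \<xi>) ^ N * ((\<Sum>b\<in>Basis. \<bar>\<xi> \<bullet> b\<bar>) * norm (fourier \<phi> \<xi>))"
      by (intro add_left_mono mult_left_mono mult_right_mono norm_le_l1) auto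
    also have "\<dots> = (1 + norm \<xi>) ^ N * norm (fourier \<phi> \<xi>) + (\<Sum>b\<in>Basis. (1 + norm \<xi>) ^ N * (\<bar>\<xi> \<bullet> b\<bar> * norm (fourier \<phi> \<xi>)))"
      by (simp add: sum_distrib_left sum_distrib_right)
    also have "\<dots> \<le> ?B + (\<Sum>b\<in>(Basis::'a set). ?B)"
      by (intro add_mono sum_mono 1 2)
    finally show ?thesis by (simp add: algebra_simps)
  qed
  then show ?case
    using C by (intro exI[of _ "C * (1 + real DIM('a))"] conjI exI[of _ "Suc K"]) auto
qed

lemma fourier_rapidly_decreasing: "schwartz \<phi> \<Longrightarrow> rapidly_decreasing (fourier \<phi>)"
  unfolding rapidly_decreasing_def using fourier_decay by meson

text \<open>Differentiation under the integral sign: the exponential is linearised with a quadratic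
  remainder, and the second moment of \<phi> is finite. The derivative is expressed as a transform
  again, so that \<open>schwartz_fourier\<close> can iterate.\<close>

lemma fourier_has_derivative:
  fixes \<phi> :: "'a::euclidean_space \<Rightarrow> complex"
  assumes \<phi>: "schwartz \<phi>"
  shows "(fourier \<phi> has_derivative (\<lambda>v. fourier (\<lambda>x. - \<i> * (x \<bullet> v) * \<phi> x) \<xi>)) (at \<xi>)"
proof -
  let ?m = "\<lambda>v x. - \<i> * (x \<bullet> v) * \<phi> x" and ?e = "\<lambda>y x. cis (- (x \<bullet> y))"
  let ?c = "fourier_const TYPE('a)"
  have [measurable]: "\<phi> \<in> borel_measurable borel" by (rule schwartz_measurable[OF \<phi>])
  \<comment> \<open>The weight (1 + |x|)^2 dominates both |x|, which occurs in the linear term, and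
    |x|^2, which occurs in the remainder.\<close>
  have rd: "rapidly_decreasing (\<lambda>x. (1 + norm x) ^ 2 * norm (\<phi> x))"
    by (rule rapidly_decreasing_bound[OF schwartz_rapidly_decreasing[OF \<phi>], of 1 _ 2]) auto
  then have ip2: "integrable lborel (\<lambda>x. (1 + norm x) ^ 2 * norm (\<phi> x))"
    by (rule rapidly_decreasing_integrable) measurable
  define I where "I = (\<integral>x. (1 + norm x) ^ 2 * norm (\<phi> x) \<partial>lborel)"
  have I: "0 \<le> I" unfolding I_def by (intro integral_nonneg_AE) auto
  have le: "norm x \<le> (1 + norm x)\<^sup>2" "(norm x)\<^sup>2 \<le> (1 + norm x)\<^sup>2" for x :: 'a
    by (auto simp: power2_eq_square algebra_simps)
  have iv: "integrable lborel (\<lambda>x. ?m v x)" for v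
  proof (rule Bochner_Integration.integrable_bound[OF integrable_mult_right[OF ip2, of "norm v"]])
    show "AE x in lborel. norm (?m v x) \<le> norm (norm v * ((1 + norm x)\<^sup>2 * norm (\<phi> x)))"
    proof (intro AE_I2)
      fix x
      have "\<bar>x \<bullet> v\<bar> \<le> norm x * norm v" by (rule Cauchy_Schwarz_ineq2)
      also have "\<dots> \<le> (1 + norm x)\<^sup>2 * norm v" by (intro mult_right_mono le) auto
      finally have "\<bar>x \<bullet> v\<bar> * norm (\<phi> x) \<le> ((1 + norm x)\<^sup>2 * norm v) * norm (\<phi> x)"
        by (intro mult_right_mono) auto
      then show "norm (?m v x) \<le> norm (norm v * ((1 + norm x)\<^sup>2 * norm (\<phi> x)))"
        by (simp add: norm_mult abs_mult mult_ac)
    qed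
  qed measurable
  note ic = integrable_cis_mult[OF iv] integrable_cis_mult[OF schwartz_integrable[OF \<phi>]]
  have "linear (\<lambda>v. fourier (?m v) \<xi>)"
  proof (rule linearI)
    fix v w r
    have "(\<integral>x. ?e \<xi> x * (?m (v + w) x) \<partial>lborel)
        = (\<integral>x. ?e \<xi> x * (?m v x) + ?e \<xi> x * (?m w x) \<partial>lborel)"
      by (simp add: inner_add_right algebra_simps)
    also have "\<dots> = (\<integral>x. ?e \<xi> x * (?m v x) \<partial>lborel) + (\<integral>x. ?e \<xi> x * (?m w x) \<partial>lborel)"
      by (rule Bochner_Integration.integral_add[OF ic(1) ic(1)])
    finally show "fourier (?m (v + w)) \<xi> = fourier (?m v) \<xi> + fourier (?m w) \<xi>"
      by (simp only: fourier_eq distrib_left)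
    have "(\<integral>x. ?e \<xi> x * (?m (r *\<^sub>R v) x) \<partial>lborel)
        = (\<integral>x. r *\<^sub>R (?e \<xi> x * (?m v x)) \<partial>lborel)"
      by (intro Bochner_Integration.integral_cong refl) (simp add: scaleR_conv_of_real)
    also have "\<dots> = r *\<^sub>R (\<integral>x. ?e \<xi> x * (?m v x) \<partial>lborel)"
      by (rule integral_scaleR_right)
    finally show "fourier (?m (r *\<^sub>R v)) \<xi> = r *\<^sub>R fourier (?m v) \<xi>"
      by (simp only: fourier_eq mult_scaleR_right)
  qed
  then have bl: "bounded_linear (\<lambda>v. fourier (?m v) \<xi>)"
    by (simp add: linear_conv_bounded_linear)
  have est: "norm (fourier \<phi> y - fourier \<phi> \<xi> - fourier (?m (y - \<xi>)) \<xi>) \<le> ?c * ((norm (y - \<xi>))\<^sup>2 * I)" for y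
  proof -
    let ?v = "y - \<xi>"
    let ?r = "\<lambda>x. ?e y x * \<phi> x - ?e \<xi> x * \<phi> x - ?e \<xi> x * (?m ?v x)"
    have "fourier \<phi> y - fourier \<phi> \<xi> - fourier (?m ?v) \<xi> = ?c * (\<integral>x. ?r x \<partial>lborel)"
    proof -
      have "(\<integral>x. ?r x \<partial>lborel) = (\<integral>x. ?e y x * \<phi> x \<partial>lborel) - (\<integral>x. ?e \<xi> x * \<phi> x \<partial>lborel)
          - (\<integral>x. ?e \<xi> x * (?m ?v x) \<partial>lborel)"
        by (subst Bochner_Integration.integral_diff[OF Bochner_Integration.integrable_diff[OF ic(2) ic(2)] ic(1)],
            subst Bochner_Integration.integral_diff[OF ic(2) ic(2)]) (rule refl)
      then show ?thesis by (simp only: fourier_eq right_diff_distrib)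
    qed
    moreover have "norm (\<integral>x. ?r x \<partial>lborel) \<le> (\<integral>x. (norm ?v)\<^sup>2 * ((1 + norm x)\<^sup>2 * norm (\<phi> x)) \<partial>lborel)"
    proof (rule Bochner_Integration.integral_norm_bound_integral)
      fix x
      \<comment> \<open>Once the unimodular factor at \<xi> is pulled out, what remains is the
        Taylor remainder of the exponential in the increment \<open>?v\<close>.\<close>
      have "?r x = ?e \<xi> x * (cis (- (x \<bullet> ?v)) - 1 - \<i> * complex_of_real (- (x \<bullet> ?v))) * \<phi> x"
        by (simp add: algebra_simps cis_mult inner_diff_right)
      then have "norm (?r x) = norm (cis (- (x \<bullet> ?v)) - 1 - \<i> * complex_of_real (- (x \<bullet> ?v))) * norm (\<phi> x)"
        by (simp only: norm_mult norm_cis mult_1_left)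
      also have "\<dots> \<le> (x \<bullet> ?v)\<^sup>2 * norm (\<phi> x)"
        using norm_cis_minus_linear_le[of "- (x \<bullet> ?v)"] by (intro mult_right_mono) simp_all
      also have "(x \<bullet> ?v)\<^sup>2 \<le> (norm x)\<^sup>2 * (norm ?v)\<^sup>2"
        using Cauchy_Schwarz_ineq[of x ?v] by (simp add: power2_norm_eq_inner)
      also have "\<dots> \<le> (1 + norm x)\<^sup>2 * (norm ?v)\<^sup>2"
        by (intro mult_right_mono le) auto
      finally show "norm (?r x) \<le> (norm ?v)\<^sup>2 * ((1 + norm x)\<^sup>2 * norm (\<phi> x))"
        by (simp add: mult_ac mult_right_mono)
    next
      show "integrable lborel ?r"
        by (intro Bochner_Integration.integrable_diff ic)
    qed (intro integrable_mult_right ip2)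
    ultimately show ?thesis
      using fourier_const_pos[where 'a = 'a] by (simp add: norm_mult I_def)
  qed
  show ?thesis
  proof (rule has_derivativeI_sandwich[of 1 _ _ _ _ "\<lambda>y. ?c * (norm (y - \<xi>) * I)"])
    fix y assume "y \<noteq> \<xi>"
    then show "norm (fourier \<phi> y - fourier \<phi> \<xi> - fourier (?m (y - \<xi>)) \<xi>) / norm (y - \<xi>) \<le> ?c * (norm (y - \<xi>) * I)"
      using est[of y] by (simp add: divide_le_eq power2_eq_square mult_ac)
  next
    have "((\<lambda>y. ?c * (norm (y - \<xi>) * I)) \<longlongrightarrow> ?c * (norm (\<xi> - \<xi>) * I)) (at \<xi>)"
      by (intro tendsto_intros)
    then show "((\<lambda>y. ?c * (norm (y - \<xi>) * I)) \<longlongrightarrow> 0) (at \<xi>)" by simp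
  qed (use bl in auto)
qed

text \<open>Transforms of Schwartz functions form the invariant class, since a derivative of such a
  transform is the transform of -i x_b \<phi>.\<close>

lemma schwartz_fourier:
  fixes \<phi> :: "'a::euclidean_space \<Rightarrow> complex"
  assumes "schwartz \<phi>" shows "schwartz (fourier \<phi>)"
proof (rule schwartz_coinduct[where P = "\<lambda>f. \<exists>\<phi>. schwartz \<phi> \<and> f = fourier \<phi>"])
  fix f :: "'a \<Rightarrow> complex"
  assume "\<exists>\<phi>. schwartz \<phi> \<and> f = fourier \<phi>"
  then obtain \<phi> where \<phi>: "schwartz \<phi>" and f: "f = fourier \<phi>" by blast
  show "f differentiable (at x)" for x
    using fourier_has_derivative[OF \<phi>] unfolding f differentiable_def by blast
  show "rapidly_decreasing f" unfolding f by (rule fourier_rapidly_decreasing[OF \<phi>])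
  fix b :: 'a assume b: "b \<in> Basis"
  have "schwartz (\<lambda>x. - \<i> * ((x \<bullet> b) *\<^sub>R \<phi> x))"
    by (rule schwartz_complex_mult[OF schwartz_coordinate_mult[OF \<phi> b]])
  then have "schwartz (\<lambda>x. - \<i> * (x \<bullet> b) * \<phi> x)"
    by (simp add: scaleR_conv_of_real mult_ac)
  moreover have "partial_deriv b f = fourier (\<lambda>x. - \<i> * (x \<bullet> b) * \<phi> x)"
    unfolding f fun_eq_iff by (simp add: partial_deriv_eq[OF fourier_has_derivative[OF \<phi>]])
  ultimately show "\<exists>\<phi>. schwartz \<phi> \<and> partial_deriv b f = fourier \<phi>" by blast
next
  show "\<exists>\<psi>. schwartz \<psi> \<and> fourier \<phi> = fourier \<psi>"
    by (intro exI[of _ \<phi>] conjI assms refl)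
qed

lemma integrable_product:
  fixes f :: "'a::euclidean_space \<Rightarrow> complex" and g :: "'b::euclidean_space \<Rightarrow> complex"
  assumes f: "integrable lborel f" and g: "integrable lborel g"
  shows "integrable (lborel \<Otimes>\<^sub>M lborel) (\<lambda>(x, y). f x * g y)"
proof (rule lborel_pair.Fubini_integrable)
  have [measurable]: "f \<in> borel_measurable borel" "g \<in> borel_measurable borel" using f g by auto
  show "(\<lambda>(x, y). f x * g y) \<in> borel_measurable (lborel \<Otimes>\<^sub>M lborel)" by measurable
  show "integrable lborel (\<lambda>x. \<integral>y. norm (case (x, y) of (x, y) \<Rightarrow> f x * g y) \<partial>lborel)"
    using f by (simp add: norm_mult)
  show "AE x in lborel. integrable lborel (\<lambda>y. case (x, y) of (x, y) \<Rightarrow> f x * g y)"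
    using g by simp
qed

text \<open>The kernel cis(-(x . y)) is symmetric, so both sides are iterated integrals of f(x) g(y)
  against it, taken in different orders.\<close>

lemma fourier_multiplication_formula:
  fixes f g :: "'a::euclidean_space \<Rightarrow> complex"
  assumes f: "integrable lborel f" and g: "integrable lborel g"
  shows "(\<integral>\<xi>. fourier f \<xi> * g \<xi> \<partial>lborel) = (\<integral>x. f x * fourier g x \<partial>lborel)"
proof -
  let ?c = "complex_of_real (fourier_const TYPE('a))"
  have [measurable]: "f \<in> borel_measurable borel" "g \<in> borel_measurable borel" using f g by auto
  have i: "integrable (lborel \<Otimes>\<^sub>M lborel) (case_prod (\<lambda>x y. ?c * (cis (- (x \<bullet> y)) * (f x * g y))))"
  proof (rule Bochner_Integration.integrable_bound[OF integrable_mult_right[OF integrable_product[OF f g], of ?c]])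
    show "case_prod (\<lambda>x y. ?c * (cis (- (x \<bullet> y)) * (f x * g y))) \<in> borel_measurable (lborel \<Otimes>\<^sub>M lborel)"
      by measurable
  qed (auto simp: norm_mult)
  have "(\<integral>y. (\<integral>x. ?c * (cis (- (x \<bullet> y)) * (f x * g y)) \<partial>lborel) \<partial>lborel)
      = (\<integral>x. (\<integral>y. ?c * (cis (- (x \<bullet> y)) * (f x * g y)) \<partial>lborel) \<partial>lborel)"
    by (rule lborel_pair.Fubini_integral[OF i])
  moreover have "(\<integral>x. ?c * (cis (- (x \<bullet> y)) * (f x * g y)) \<partial>lborel) = fourier f y * g y" for y
  proof -
    have "(\<integral>x. ?c * (cis (- (x \<bullet> y)) * (f x * g y)) \<partial>lborel) = (\<integral>x. (?c * g y) * (cis (- (x \<bullet> y)) * f x) \<partial>lborel)"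
      by (intro Bochner_Integration.integral_cong refl) (simp add: mult_ac)
    then show ?thesis unfolding fourier_eq integral_mult_right_zero by (simp only: mult_ac)
  qed
  moreover have "(\<integral>y. ?c * (cis (- (x \<bullet> y)) * (f x * g y)) \<partial>lborel) = f x * fourier g x" for x
  proof -
    have "(\<integral>y. ?c * (cis (- (x \<bullet> y)) * (f x * g y)) \<partial>lborel) = (\<integral>y. (f x * ?c) * (cis (- (y \<bullet> x)) * g y) \<partial>lborel)"
      by (intro Bochner_Integration.integral_cong refl) (simp add: mult_ac inner_commute)
    then show ?thesis unfolding fourier_eq integral_mult_right_zero by (simp only: mult_ac)
  qed
  ultimately show ?thesis by (simp only:)
qed


section \<open>Fourier inversion\<close>

lemma schwartz_of_real: "schwartz f \<Longrightarrow> schwartz (\<lambda>x. complex_of_real (f x))"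
  by (rule schwartz_bounded_linear[OF bounded_linear_of_real])

text \<open>The reference function for inversion and uniqueness: 1 at the origin, nowhere zero so
  that it can be cancelled, and real and even, which makes its transform real.\<close>

definition cgauss :: "'a::euclidean_space \<Rightarrow> complex"
  where "cgauss x = complex_of_real (exp (- (x \<bullet> x)))"

lemma schwartz_cgauss: "schwartz cgauss"
  unfolding cgauss_def[abs_def] by (intro schwartz_of_real schwartz_gaussian)

lemma cgauss_simps [simp]: "cgauss 0 = 1" "cgauss x \<noteq> 0" "cgauss (- x) = cgauss x" "cnj (cgauss x) = cgauss x"
  by (auto simp: cgauss_def)

lemma norm_cgauss_le: "norm (cgauss x) \<le> 1"
  by (simp add: cgauss_def)

lemma cgauss_measurable [measurable]: "cgauss \<in> borel_measurable borel"
  by (rule schwartz_measurable[OF schwartz_cgauss])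

lemma integrable_cgauss: "integrable lborel cgauss"
  by (rule schwartz_integrable[OF schwartz_cgauss])

lemma schwartz_bounded:
  assumes "schwartz f" obtains C where "0 \<le> C" "\<And>x. norm (f x) \<le> C"
proof -
  obtain C where "\<And>x. norm (f x) \<le> C"
    using schwartz_rapidly_decreasing[OF assms] unfolding rapidly_decreasing_def by (metis mult_1 power_0)
  then show ?thesis using that order_trans[OF norm_ge_zero] by blast
qed

lemma fourier_scale:
  fixes \<psi> :: "'a::euclidean_space \<Rightarrow> complex"
  assumes [measurable]: "\<psi> \<in> borel_measurable borel" and e: "0 < e"
  shows "e ^ DIM('a) *\<^sub>R fourier (\<lambda>x. \<psi> (e *\<^sub>R x)) (e *\<^sub>R y) = fourier \<psi> y"
proof -
  have "(\<integral>x. cis (- (x \<bullet> y)) * \<psi> x \<partial>lborel) = \<bar>e\<bar> ^ DIM('a) *\<^sub>R (\<integral>x. cis (- ((0 + e *\<^sub>R x) \<bullet> y)) * \<psi> (0 + e *\<^sub>R x) \<partial>lborel)"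
    using e by (intro integral_lborel_affine) auto
  then show ?thesis using e by (simp add: fourier_eq)
qed

lemma inverse_Suc_tendsto_0: "(\<lambda>n. 1 / real (Suc n)) \<longlonglongrightarrow> 0"
  using LIMSEQ_inverse_real_of_nat by (simp add: inverse_eq_divide)

lemma tendsto_schwartz_scaled:
  assumes "schwartz f"
  shows "(\<lambda>n. f ((1 / real (Suc n)) *\<^sub>R x)) \<longlonglongrightarrow> f 0"
proof -
  have "(\<lambda>n. (1 / real (Suc n)) *\<^sub>R x) \<longlonglongrightarrow> 0 *\<^sub>R x"
    by (intro tendsto_scaleR inverse_Suc_tendsto_0 tendsto_const)
  then show ?thesis
    using schwartz_continuous[OF assms] by (auto simp: continuous_on_eq_continuous_at intro: isCont_tendsto_compose)
qed

lemma schwartz_scaled: "schwartz f \<Longrightarrow> c \<noteq> 0 \<Longrightarrow> schwartz (\<lambda>x. f (c *\<^sub>R x))"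
  using schwartz_affine[of f c 0] by simp

text \<open>As the dilation parameter tends to 0 the dilates of \<psi> flatten to the constant
  \<psi>(0); boundedness of \<psi> gives the majorant.\<close>

lemma tendsto_integral_scaled:
  fixes g \<psi> :: "'a::euclidean_space \<Rightarrow> complex"
  assumes g: "integrable lborel g" and \<psi>: "schwartz \<psi>"
  shows "(\<lambda>n. \<integral>x. g x * \<psi> ((1 / real (Suc n)) *\<^sub>R x) \<partial>lborel) \<longlonglongrightarrow> (\<integral>x. g x * \<psi> 0 \<partial>lborel)"
proof -
  obtain C where C: "0 \<le> C" "\<And>x. norm (\<psi> x) \<le> C" using schwartz_bounded[OF \<psi>] by blast
  have [measurable]: "g \<in> borel_measurable borel" "\<psi> \<in> borel_measurable borel"
    using g schwartz_measurable[OF \<psi>] by auto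
  show ?thesis
  proof (rule integral_dominated_convergence[where w = "\<lambda>x. norm (g x) * C"])
    show "integrable lborel (\<lambda>x. norm (g x) * C)" using g by auto
    show "AE x in lborel. (\<lambda>n. g x * \<psi> ((1 / real (Suc n)) *\<^sub>R x)) \<longlonglongrightarrow> g x * \<psi> 0"
      by (intro AE_I2 tendsto_mult_left tendsto_schwartz_scaled \<psi>)
  qed (auto simp: norm_mult intro!: mult_left_mono C)
qed

text \<open>Insert the dilates \<open>\<psi>(\<epsilon>x)\<close> into the multiplication formula and let \<open>\<epsilon>\<close> tend to 0; this
  replaces the explicit transform of the Gaussian.\<close>

lemma integral_fourier_proportional:
  fixes \<phi> \<psi> :: "'a::euclidean_space \<Rightarrow> complex"
  assumes \<phi>: "schwartz \<phi>" and \<psi>: "schwartz \<psi>"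
  shows "(\<integral>\<xi>. fourier \<phi> \<xi> \<partial>lborel) * \<psi> 0 = \<phi> 0 * (\<integral>\<xi>. fourier \<psi> \<xi> \<partial>lborel)"
proof -
  let ?e = "\<lambda>n. 1 / real (Suc n)"
  have [measurable]: "\<phi> \<in> borel_measurable borel" "\<psi> \<in> borel_measurable borel"
    by (intro schwartz_measurable \<phi> \<psi>)+
  have eq: "(\<integral>\<xi>. fourier \<phi> \<xi> * \<psi> (?e n *\<^sub>R \<xi>) \<partial>lborel) = (\<integral>y. fourier \<psi> y * \<phi> (?e n *\<^sub>R y) \<partial>lborel)" for n
  proof -
    let ?\<psi> = "\<lambda>x. \<psi> (?e n *\<^sub>R x)"
    have s: "schwartz ?\<psi>" by (rule schwartz_scaled[OF \<psi>]) simp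
    have [measurable]: "fourier ?\<psi> \<in> borel_measurable borel"
      by (rule schwartz_measurable[OF schwartz_fourier[OF s]])
    have m: "(\<lambda>x. \<phi> x * fourier ?\<psi> x) \<in> borel_measurable borel" by measurable
    have "(\<integral>\<xi>. fourier \<phi> \<xi> * ?\<psi> \<xi> \<partial>lborel) = (\<integral>x. \<phi> x * fourier ?\<psi> x \<partial>lborel)"
      by (rule fourier_multiplication_formula[OF schwartz_integrable[OF \<phi>] schwartz_integrable[OF s]])
    \<comment> \<open>The substitution x = \<open>?e n\<close> y moves the dilation from \<psi> to
      \<phi>, and its Jacobian is exactly the factor absorbed by
      \<open>fourier_scale\<close>.\<close>
    also have "\<dots> = \<bar>?e n\<bar> ^ DIM('a) *\<^sub>R (\<integral>x. \<phi> (0 + ?e n *\<^sub>R x) * fourier ?\<psi> (0 + ?e n *\<^sub>R x) \<partial>lborel)"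
      by (rule integral_lborel_affine[OF m]) simp
    also have "\<dots> = (\<integral>x. ?e n ^ DIM('a) *\<^sub>R (\<phi> (?e n *\<^sub>R x) * fourier ?\<psi> (?e n *\<^sub>R x)) \<partial>lborel)"
      by (simp only: integral_scaleR_right add_0_left) simp
    also have "\<dots> = (\<integral>y. fourier \<psi> y * \<phi> (?e n *\<^sub>R y) \<partial>lborel)"
    proof (intro Bochner_Integration.integral_cong refl)
      fix x :: 'a
      have "?e n ^ DIM('a) *\<^sub>R (\<phi> (?e n *\<^sub>R x) * fourier ?\<psi> (?e n *\<^sub>R x))
          = \<phi> (?e n *\<^sub>R x) * (?e n ^ DIM('a) *\<^sub>R fourier ?\<psi> (?e n *\<^sub>R x))"
        by (rule mult_scaleR_right[symmetric])
      also have "\<dots> = \<phi> (?e n *\<^sub>R x) * fourier \<psi> x"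
        by (subst fourier_scale) auto
      finally show "?e n ^ DIM('a) *\<^sub>R (\<phi> (?e n *\<^sub>R x) * fourier ?\<psi> (?e n *\<^sub>R x)) = fourier \<psi> x * \<phi> (?e n *\<^sub>R x)"
        by (simp only: mult.commute)
    qed
    finally show ?thesis .
  qed
  have "(\<lambda>n. \<integral>\<xi>. fourier \<phi> \<xi> * \<psi> (?e n *\<^sub>R \<xi>) \<partial>lborel) \<longlonglongrightarrow> (\<integral>\<xi>. fourier \<phi> \<xi> * \<psi> 0 \<partial>lborel)"
    by (rule tendsto_integral_scaled[OF schwartz_integrable[OF schwartz_fourier[OF \<phi>]] \<psi>])
  moreover have "(\<lambda>n. \<integral>\<xi>. fourier \<phi> \<xi> * \<psi> (?e n *\<^sub>R \<xi>) \<partial>lborel) \<longlonglongrightarrow> (\<integral>\<xi>. fourier \<psi> \<xi> * \<phi> 0 \<partial>lborel)"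
    unfolding eq by (rule tendsto_integral_scaled[OF schwartz_integrable[OF schwartz_fourier[OF \<psi>]] \<phi>])
  ultimately have "(\<integral>\<xi>. fourier \<phi> \<xi> * \<psi> 0 \<partial>lborel) = (\<integral>\<xi>. fourier \<psi> \<xi> * \<phi> 0 \<partial>lborel)"
    by (rule LIMSEQ_unique)
  then show ?thesis by (simp add: mult.commute)
qed

lemma fourier_translation:
  fixes \<phi> :: "'a::euclidean_space \<Rightarrow> complex"
  assumes [measurable]: "\<phi> \<in> borel_measurable borel"
  shows "fourier (\<lambda>y. \<phi> (y + a)) \<xi> = cis (a \<bullet> \<xi>) * fourier \<phi> \<xi>"
proof -
  have "(\<integral>y. cis (- (y \<bullet> \<xi>)) * \<phi> (y + a) \<partial>lborel) = (\<integral>y. cis (a \<bullet> \<xi>) * (cis (- ((y + a) \<bullet> \<xi>)) * \<phi> (y + a)) \<partial>lborel)"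
    by (intro Bochner_Integration.integral_cong refl) (simp add: cis_mult inner_add_left mult.assoc[symmetric])
  also have "\<dots> = cis (a \<bullet> \<xi>) * (\<integral>y. cis (- ((y + a) \<bullet> \<xi>)) * \<phi> (y + a) \<partial>lborel)"
    by (rule integral_mult_right_zero)
  also have "(\<integral>y. cis (- ((y + a) \<bullet> \<xi>)) * \<phi> (y + a) \<partial>lborel) = (\<integral>y. cis (- (y \<bullet> \<xi>)) * \<phi> y \<partial>lborel)"
    by (rule integral_lborel_translation) measurable
  finally show ?thesis by (simp add: fourier_eq)
qed

lemma fourier_reflect:
  fixes \<phi> :: "'a::euclidean_space \<Rightarrow> complex"
  assumes [measurable]: "\<phi> \<in> borel_measurable borel"
  shows "fourier (\<lambda>y. \<phi> (- y)) \<xi> = fourier \<phi> (- \<xi>)"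
proof -
  have "(\<integral>y. cis (- (y \<bullet> - \<xi>)) * \<phi> y \<partial>lborel) = \<bar>-1\<bar> ^ DIM('a) *\<^sub>R (\<integral>y. cis (- ((0 + (-1) *\<^sub>R y) \<bullet> - \<xi>)) * \<phi> (0 + (-1) *\<^sub>R y) \<partial>lborel)"
    by (rule integral_lborel_affine) auto
  then show ?thesis by (simp add: fourier_eq)
qed

text \<open>The set where a continuous function is nonzero is open, and a nonempty open set is not
  negligible.\<close>

lemma AE_zero_continuous:
  fixes f :: "'a::euclidean_space \<Rightarrow> 'b::real_normed_vector"
  assumes "continuous_on UNIV f" "AE x in lborel. f x = 0"
  shows "f x = 0"
proof -
  have op: "open {x. f x \<noteq> 0}"
    using assms(1) by (intro open_Collect_neq) auto
  then have "{x. f x \<noteq> 0} \<in> sets lborel" by simp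
  then have "{x. f x \<noteq> 0} \<in> null_sets lborel"
    using assms(2) by (subst (asm) AE_iff_null) auto
  then have "negligible {x. f x \<noteq> 0}"
    by (simp add: negligible_iff_null_sets null_sets_completionI)
  then show ?thesis using op open_not_negligible by blast
qed

lemma integral_cgauss_ne_0: "(\<integral>x. cgauss (x::'a::euclidean_space) \<partial>lborel) \<noteq> 0"
proof
  assume "(\<integral>x. cgauss (x::'a) \<partial>lborel) = 0"
  then have "(\<integral>x. exp (- ((x::'a) \<bullet> x)) \<partial>lborel) = 0"
    unfolding cgauss_def by (simp only: integral_complex_of_real of_real_eq_0_iff)
  then have "AE x in lborel. exp (- ((x::'a) \<bullet> x)) = 0"
    using schwartz_integrable[OF schwartz_gaussian] by (subst (asm) integral_nonneg_eq_0_iff_AE) auto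
  from AE_zero_continuous[OF _ this] show False
    by (simp add: schwartz_continuous[OF schwartz_gaussian])
qed

text \<open>Up to the normalising factor this is the ratio of the integral of
  \<open>fourier \<phi>\<close> to \<phi>(0), the same for all Schwartz functions with \<phi>(0)
  nonzero. Its classical value is 1; what is established here is that it does not vanish.\<close>

definition inversion_const :: "'a::euclidean_space itself \<Rightarrow> complex"
  where "inversion_const _ = fourier_const TYPE('a) * (\<integral>\<xi>. fourier cgauss (\<xi>::'a) \<partial>lborel)"

text \<open>Proportionality is applied to the translate of \<phi> by \<open>x\<close> and to the
  Gaussian. Translation multiplies the transform by cis(x . \<xi>), so the integral of the
  translated transform is the second transform at -x.\<close>

lemma fourier_fourier:
  fixes \<phi> :: "'a::euclidean_space \<Rightarrow> complex"
  assumes \<phi>: "schwartz \<phi>"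
  shows "fourier (fourier \<phi>) (- x) = inversion_const TYPE('a) * \<phi> x"
proof -
  have "schwartz (\<lambda>y. \<phi> (y + x))"
    using schwartz_affine[OF \<phi>, of 1 x] by (simp add: add.commute)
  from integral_fourier_proportional[OF this schwartz_cgauss]
  have "(\<integral>\<xi>. fourier (\<lambda>y. \<phi> (y + x)) \<xi> \<partial>lborel) = \<phi> x * (\<integral>\<xi>. fourier cgauss (\<xi>::'a) \<partial>lborel)"
    by simp
  then show ?thesis
    by (simp add: fourier_translation[OF schwartz_measurable[OF \<phi>]] fourier_eq[of "fourier \<phi>"] inversion_const_def inner_commute)
qed

text \<open>If the factor were 0, transforming the Gaussian twice would give 0, and by the
  multiplication formula the square of its transform would have integral 0. The transform would then
  vanish, and so would the integral of the Gaussian.\<close>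

lemma inversion_const_ne_0: "inversion_const TYPE('a::euclidean_space) \<noteq> 0"
proof
  assume 0: "inversion_const TYPE('a) = 0"
  let ?g = "fourier (cgauss :: 'a \<Rightarrow> complex)"
  have s: "schwartz ?g" by (rule schwartz_fourier[OF schwartz_cgauss])
  have "(\<integral>\<xi>. ?g \<xi> * ?g \<xi> \<partial>lborel) = (\<integral>x. cgauss x * fourier ?g x \<partial>lborel)"
    by (rule fourier_multiplication_formula[OF integrable_cgauss schwartz_integrable[OF s]])
  also have "\<dots> = 0"
  proof -
    have "fourier ?g x = 0" for x
      using fourier_fourier[OF schwartz_cgauss, of "- x"] 0 by simp
    then show ?thesis by simp
  qed
  finally have z: "(\<integral>\<xi>. ?g \<xi> * ?g \<xi> \<partial>lborel) = 0" .
  \<comment> \<open>The multiplication formula carries no complex conjugate; the square becomes a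
    squared modulus only because the transform of a real even function is real.\<close>
  have real: "cnj (?g \<xi>) = ?g \<xi>" for \<xi>
  proof -
    have "cnj (\<integral>x. cis (- (x \<bullet> \<xi>)) * cgauss x \<partial>lborel) = (\<integral>x. cnj (cis (- (x \<bullet> \<xi>)) * cgauss x) \<partial>lborel)"
      by (rule Bochner_Integration.integral_cnj[symmetric])
    then have "cnj (?g \<xi>) = ?g (- \<xi>)"
      unfolding fourier_eq by (simp only: complex_cnj_mult complex_cnj_complex_of_real cis_cnj cgauss_simps inner_minus_right)
    then show ?thesis using fourier_reflect[of "cgauss :: 'a \<Rightarrow> complex" \<xi>] by simp
  qed
  have "?g \<xi> * ?g \<xi> = complex_of_real ((norm (?g \<xi>))\<^sup>2)" for \<xi>
    using complex_norm_square[of "?g \<xi>"] real[of \<xi>] by simp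
  then have "(\<integral>\<xi>. (norm (?g \<xi>))\<^sup>2 \<partial>lborel) = 0"
    using z by (simp only: integral_complex_of_real of_real_eq_0_iff)
  moreover have "integrable lborel (\<lambda>\<xi>. (norm (?g \<xi>))\<^sup>2)"
    using integrable_norm[OF schwartz_integrable[OF schwartz_mult[OF s s]]] by (simp add: norm_mult power2_eq_square)
  ultimately have "AE \<xi> in lborel. (norm (?g \<xi>))\<^sup>2 = 0"
    by (subst (asm) integral_nonneg_eq_0_iff_AE) auto
  then have "AE \<xi> in lborel. ?g \<xi> = 0" by simp
  from AE_zero_continuous[OF schwartz_continuous[OF s] this] have "?g 0 = 0" .
  then show False
    using integral_cgauss_ne_0[where 'a = 'a] fourier_const_pos[where 'a = 'a] by (simp add: fourier_eq)
qed

section \<open>Real Schwartz functions as Fourier transforms\<close>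

lemma iter_deriv_of_real:
  assumes "schwartz f" "set bs \<subseteq> Basis"
  shows "iter_deriv bs (\<lambda>x. complex_of_real (f x)) = (\<lambda>x. complex_of_real (iter_deriv bs f x))"
  using assms(2)
proof (induction bs)
  case (Cons b bs)
  have d: "iter_deriv bs f differentiable (at x)" for x
    using assms Cons.prems by (auto simp: schwartz_def smooth_def)
  have e: "partial_deriv b (\<lambda>x. complex_of_real (iter_deriv bs f x)) x = complex_of_real (partial_deriv b (iter_deriv bs f) x)" for x
    using partial_deriv_eq[OF bounded_linear.has_derivative[OF bounded_linear_of_real d[of x, unfolded frechet_derivative_works]]]
    by (simp add: partial_deriv_def)
  have ih: "iter_deriv bs (\<lambda>x. complex_of_real (f x)) = (\<lambda>x. complex_of_real (iter_deriv bs f x))"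
    using Cons by simp
  show ?case unfolding iter_deriv_Cons ih by (rule ext) (rule e)
qed (simp add: iter_deriv_def)

lemma schwartz_seminorm_of_real:
  assumes "schwartz f"
  shows "schwartz_seminorm K (\<lambda>x. complex_of_real (f x)) = schwartz_seminorm K f"
  unfolding schwartz_seminorm_def
  by (intro SUP_cong refl) (auto simp: iter_deriv_of_real[OF assms])

text \<open>The preimage is the reflected transform of \<psi> divided by
  \<open>inversion_const\<close>. Since \<open>has_fourier\<close> describes a distribution only on
  functions \<open>fourier \<phi>\<close>, this is the way back to its values on real Schwartz
  functions; the decay bound in terms of \<psi> carries the continuity.\<close>

lemma real_schwartz_fourier_preimage:
  "\<exists>C\<ge>0. \<exists>K. \<forall>\<psi>::'a::euclidean_space \<Rightarrow> real. schwartz \<psi> \<longrightarrow>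
     (\<exists>\<phi>. schwartz \<phi> \<and> fourier \<phi> = (\<lambda>x. complex_of_real (\<psi> x)) \<and>
        (\<forall>x. (1 + norm x) ^ N * norm (\<phi> x) \<le> C * schwartz_seminorm K \<psi>))"
proof -
  obtain C K where C: "0 \<le> C" and decay: "\<And>\<phi>::'a \<Rightarrow> complex. \<And>\<xi>. schwartz \<phi> \<Longrightarrow>
      (1 + norm \<xi>) ^ N * norm (fourier \<phi> \<xi>) \<le> C * schwartz_seminorm K \<phi>"
    using fourier_decay[of N, where 'a = 'a] by blast
  let ?k = "inversion_const TYPE('a)"
  have "\<exists>\<phi>. schwartz \<phi> \<and> fourier \<phi> = (\<lambda>x. complex_of_real (\<psi> x)) \<and>
        (\<forall>x. (1 + norm x) ^ N * norm (\<phi> x) \<le> (C / norm ?k) * schwartz_seminorm K \<psi>)"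
    if \<psi>: "schwartz \<psi>" for \<psi> :: "'a \<Rightarrow> real"
  proof (intro exI[of _ "\<lambda>x. 1 / ?k * fourier (\<lambda>x. complex_of_real (\<psi> x)) (- x)"] conjI allI)
    have s: "schwartz (\<lambda>x. complex_of_real (\<psi> x))" by (rule schwartz_of_real[OF \<psi>])
    have "schwartz (\<lambda>x. fourier (\<lambda>x. complex_of_real (\<psi> x)) (0 + (-1) *\<^sub>R x))"
      by (rule schwartz_affine[OF schwartz_fourier[OF s]]) simp
    then show "schwartz (\<lambda>x. 1 / ?k * fourier (\<lambda>x. complex_of_real (\<psi> x)) (- x))"
      by (intro schwartz_complex_mult) simp
    have "fourier (\<lambda>x. fourier (\<lambda>x. complex_of_real (\<psi> x)) (- x)) \<xi> = ?k * complex_of_real (\<psi> \<xi>)" for \<xi>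
      using fourier_reflect[OF schwartz_measurable[OF schwartz_fourier[OF s]], of \<xi>] fourier_fourier[OF s, of \<xi>] by simp
    moreover have "fourier (\<lambda>x. 1 / ?k * f x) \<xi> = 1 / ?k * fourier f \<xi>" for f :: "'a \<Rightarrow> complex" and \<xi>
    proof -
      have "(\<integral>x. cis (- (x \<bullet> \<xi>)) * (1 / ?k * f x) \<partial>lborel) = (\<integral>x. 1 / ?k * (cis (- (x \<bullet> \<xi>)) * f x) \<partial>lborel)"
        by (simp only: mult.left_commute)
      also have "\<dots> = 1 / ?k * (\<integral>x. cis (- (x \<bullet> \<xi>)) * f x \<partial>lborel)"
        by (rule integral_mult_right_zero)
      finally show ?thesis unfolding fourier_eq by (simp only: mult.left_commute)
    qed
    ultimately show "fourier (\<lambda>x. 1 / ?k * fourier (\<lambda>x. complex_of_real (\<psi> x)) (- x)) = (\<lambda>x. complex_of_real (\<psi> x))"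
      using inversion_const_ne_0[where 'a = 'a] by (simp add: fun_eq_iff)
    fix x
    have "(1 + norm (- x)) ^ N * norm (fourier (\<lambda>x. complex_of_real (\<psi> x)) (- x)) \<le> C * schwartz_seminorm K \<psi>"
      using decay[OF s] by (simp only: schwartz_seminorm_of_real[OF \<psi>])
    then show "(1 + norm x) ^ N * norm (1 / ?k * fourier (\<lambda>x. complex_of_real (\<psi> x)) (- x)) \<le> (C / norm ?k) * schwartz_seminorm K \<psi>"
      by (simp add: norm_mult norm_divide divide_right_mono)
  qed
  then show ?thesis
    using C by (intro exI[of _ "C / norm ?k"] conjI exI[of _ K]) auto
qed

section \<open>Functions with vanishing integrals against Schwartz functions\<close>

lemma AE_not_in_box_boundary:
  fixes p q :: "'a::euclidean_space"
  shows "AE x in lborel. x \<notin> cbox p q - box p q"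
proof -
  have "cbox p q - box p q \<in> null_sets lebesgue"
    using negligible_frontier_interval[of p q] by (simp add: negligible_iff_null_sets)
  then have "cbox p q - box p q \<in> null_sets lborel"
    by (subst (asm) null_sets_completion_iff) auto
  then show ?thesis by (rule AE_not_in)
qed

text \<open>Boxes are stable under intersection and generate the Borel sets. The sets of integral 0
  are closed under complements, by \<open>k0\<close>, and under countable disjoint unions.\<close>

lemma set_integral_eq_0_from_boxes:
  fixes k :: "'a::euclidean_space \<Rightarrow> complex"
  assumes k: "integrable lborel k" and k0: "(\<integral>x. k x \<partial>lborel) = 0"
    and box: "\<And>p q. (LINT x:box p q|lborel. k x) = 0"
    and A: "A \<in> sets borel"
  shows "(LINT x:A|lborel. k x) = 0"
proof -
  let ?G = "range (\<lambda>(a, b). box a b :: 'a set)"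
  have si: "set_integrable lborel A k" if "A \<in> sets borel" for A
    using k that unfolding set_integrable_def by (intro integrable_mult_indicator) auto
  have sets: "sets borel = sigma_sets UNIV ?G"
    by (simp add: borel_eq_box sets_measure_of)
  have "Int_stable ?G" "?G \<subseteq> Pow UNIV" "A \<in> sigma_sets UNIV ?G"
    using A by (auto simp: Int_stable_def box_Int_box sets)
  then show ?thesis
  proof (induction rule: sigma_sets_induct_disjoint)
    case (basic A)
    then show ?case using box by auto
  next
    case empty
    then show ?case by (simp add: set_lebesgue_integral_def)
  next
    case (compl A)
    then have A: "A \<in> sets borel" by (simp add: sets)
    have "(LINT x:UNIV - A|lborel. k x) = (\<integral>x. k x - indicator A x *\<^sub>R k x \<partial>lborel)"
      unfolding set_lebesgue_integral_def
      by (intro Bochner_Integration.integral_cong refl) (auto simp: indicator_def)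
    also have "\<dots> = (\<integral>x. k x \<partial>lborel) - (\<integral>x. indicator A x *\<^sub>R k x \<partial>lborel)"
      by (intro Bochner_Integration.integral_diff k si[OF A, unfolded set_integrable_def])
    also have "\<dots> = 0" using compl k0 by (simp add: set_lebesgue_integral_def)
    finally show ?case .
  next
    case (union A)
    then have "\<And>i. A i \<in> sets lborel" by (auto simp: sets)
    then have "(LINT x:(\<Union>i. A i)|lborel. k x) = (\<Sum>i. (LINT x:(A i)|lborel. k x))"
      using union by (intro lebesgue_integral_countable_add si) (auto simp: disjoint_family_on_def)
    then show ?case using union by simp
  qed
qed

text \<open>The integral of \<open>k\<close> over a box is approximated by testing \<open>k\<close> with the convolution of the
  indicator function of the box and a narrow Gaussian.\<close>

lemma box_integral_eq_0:
  fixes k :: "'a::euclidean_space \<Rightarrow> complex"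
  assumes k: "integrable lborel k"
    and zero: "\<And>\<phi>. schwartz \<phi> \<Longrightarrow> (\<integral>x. k x * \<phi> x \<partial>lborel) = 0"
  shows "(LINT x:box p q|lborel. k x) = 0"
proof -
  let ?e = "\<lambda>n. 1 / real (Suc n)"
  let ?\<chi> = "\<lambda>x. indicator (box p q) x :: complex"
  let ?I = "\<integral>y. cgauss (y::'a) \<partial>lborel"
  have [measurable]: "k \<in> borel_measurable borel" using k by auto
  \<comment> \<open>An average of the indicator around \<xi> at scale 1 / (n + 1), with the Gaussian
    as weight. The variable is rescaled so that the weight is independent of \<open>n\<close>, which
    gives the pointwise limit and the uniform bound.\<close>
  define H where "H n \<xi> = (\<integral>y. ?\<chi> (\<xi> + ?e n *\<^sub>R y) * cgauss y \<partial>lborel)" for n \<xi>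
  have [measurable]: "box p q \<in> sets borel" by simp
  have H_eq: "(\<integral>a. ?\<chi> a * cgauss (real (Suc n) *\<^sub>R (\<xi> - a)) \<partial>lborel) = ?e n ^ DIM('a) *\<^sub>R H n \<xi>" for n \<xi>
  proof -
    have m: "(\<lambda>a. ?\<chi> a * cgauss (real (Suc n) *\<^sub>R (\<xi> - a))) \<in> borel_measurable borel" by measurable
    have "(\<integral>a. ?\<chi> a * cgauss (real (Suc n) *\<^sub>R (\<xi> - a)) \<partial>lborel)
        = \<bar>?e n\<bar> ^ DIM('a) *\<^sub>R (\<integral>y. ?\<chi> (\<xi> + ?e n *\<^sub>R y) * cgauss (real (Suc n) *\<^sub>R (\<xi> - (\<xi> + ?e n *\<^sub>R y))) \<partial>lborel)"
      by (rule integral_lborel_affine) auto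
    also have "(\<lambda>y. cgauss (real (Suc n) *\<^sub>R (\<xi> - (\<xi> + ?e n *\<^sub>R y)))) = cgauss"
      by (auto simp: fun_eq_iff)
    finally show ?thesis by (simp add: H_def)
  qed
  have i\<chi>: "integrable lborel ?\<chi>"
  proof -
    have "integrable lborel (\<lambda>x. complex_of_real (indicator (box p q) x))"
      by (intro integrable_of_real integrable_real_indicator) (auto simp: emeasure_lborel_box_eq)
    moreover have "(\<lambda>x. complex_of_real (indicator (box p q) x)) = ?\<chi>" by (auto simp: indicator_def)
    ultimately show ?thesis by (simp only:)
  qed
  \<comment> \<open>Up to a power of the scale, \<open>H n\<close> is a superposition of translated
    narrow Gaussians. After Fubini each of them is tested against \<open>k\<close> separately, and
    the hypothesis gives 0.\<close>
  have kH: "(\<integral>\<xi>. k \<xi> * H n \<xi> \<partial>lborel) = 0" for n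
  proof -
    let ?g = "\<lambda>\<xi> a. cgauss (real (Suc n) *\<^sub>R (\<xi> - a))"
    have "integrable (lborel \<Otimes>\<^sub>M lborel) (case_prod (\<lambda>\<xi> a. k \<xi> * ?\<chi> a * ?g \<xi> a))"
      by (rule Bochner_Integration.integrable_bound[OF integrable_product[OF k i\<chi>]])
        (measurable, auto simp del: of_nat_Suc simp: norm_mult intro!: AE_I2 mult_left_le norm_cgauss_le)
    then have "(\<integral>a. (\<integral>\<xi>. k \<xi> * ?\<chi> a * ?g \<xi> a \<partial>lborel) \<partial>lborel) = (\<integral>\<xi>. (\<integral>a. k \<xi> * ?\<chi> a * ?g \<xi> a \<partial>lborel) \<partial>lborel)"
      by (rule lborel_pair.Fubini_integral)
    moreover have "(\<integral>\<xi>. k \<xi> * ?\<chi> a * ?g \<xi> a \<partial>lborel) = 0" for a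
    proof -
      have "schwartz (\<lambda>\<xi>. cgauss (- (real (Suc n) *\<^sub>R a) + real (Suc n) *\<^sub>R \<xi>))"
        by (rule schwartz_affine[OF schwartz_cgauss]) simp
      then have "schwartz (\<lambda>\<xi>. ?\<chi> a * ?g \<xi> a)"
        by (intro schwartz_complex_mult) (simp add: algebra_simps)
      from zero[OF this] show ?thesis by (simp only: mult.assoc)
    qed
    moreover have "(\<integral>a. k \<xi> * ?\<chi> a * ?g \<xi> a \<partial>lborel) = ?e n ^ DIM('a) *\<^sub>R (k \<xi> * H n \<xi>)" for \<xi>
    proof -
      have "(\<integral>a. k \<xi> * ?\<chi> a * ?g \<xi> a \<partial>lborel) = k \<xi> * (\<integral>a. ?\<chi> a * ?g \<xi> a \<partial>lborel)"
        unfolding mult.assoc by (rule integral_mult_right_zero)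
      then show ?thesis by (simp only: H_eq mult_scaleR_right)
    qed
    ultimately have "?e n ^ DIM('a) *\<^sub>R (\<integral>\<xi>. k \<xi> * H n \<xi> \<partial>lborel) = 0"
      by (simp only: integral_scaleR_right integral_zero)
    then show ?thesis by simp
  qed
  have [measurable]: "H n \<in> borel_measurable borel" for n
    unfolding H_def by measurable
  have Hb: "norm (H n \<xi>) \<le> (\<integral>y. norm (cgauss (y::'a)) \<partial>lborel)" for n \<xi>
    unfolding H_def using integrable_cgauss
    by (intro Bochner_Integration.integral_norm_bound_integral integrable_norm
          Bochner_Integration.integrable_bound[OF integrable_cgauss]) (auto simp: norm_mult indicator_def)
  \<comment> \<open>Off the boundary, \<xi> is interior to the box or to its complement, so the
    indicator is eventually constant along points tending to \<xi>.\<close>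
  have Hlim: "(\<lambda>n. H n \<xi>) \<longlonglongrightarrow> ?\<chi> \<xi> * ?I" if \<xi>: "\<xi> \<notin> cbox p q - box p q" for \<xi>
  proof -
    have "(\<lambda>n. H n \<xi>) \<longlonglongrightarrow> (\<integral>y. ?\<chi> \<xi> * cgauss (y::'a) \<partial>lborel)"
      unfolding H_def
    proof (rule integral_dominated_convergence[where w = "\<lambda>y. norm (cgauss (y::'a))"])
      have "(\<lambda>n. ?\<chi> (\<xi> + ?e n *\<^sub>R y) * cgauss y) \<longlonglongrightarrow> ?\<chi> \<xi> * cgauss y" for y
      proof -
        have t: "(\<lambda>n. \<xi> + ?e n *\<^sub>R y) \<longlonglongrightarrow> \<xi> + 0 *\<^sub>R y"
          by (intro tendsto_intros inverse_Suc_tendsto_0)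
        have "\<forall>\<^sub>F n in sequentially. ?\<chi> (\<xi> + ?e n *\<^sub>R y) = ?\<chi> \<xi>"
        proof (cases "\<xi> \<in> box p q")
          case True
          then have "\<forall>\<^sub>F n in sequentially. \<xi> + ?e n *\<^sub>R y \<in> box p q"
            using topological_tendstoD[OF t, of "box p q"] by (simp add: open_box)
          then show ?thesis by eventually_elim (use True in simp)
        next
          case False
          then have "\<forall>\<^sub>F n in sequentially. \<xi> + ?e n *\<^sub>R y \<in> - cbox p q"
            using topological_tendstoD[OF t, of "- cbox p q"] \<xi> by (simp add: closed_cbox open_Compl)
          then show ?thesis
            by eventually_elim (use False box_subset_cbox[of p q] in \<open>auto simp: indicator_def\<close>)
        qed
        then show ?thesis
          by (intro tendsto_eventually) (auto elim: eventually_mono)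
      qed
      then show "AE y in lborel. (\<lambda>n. ?\<chi> (\<xi> + ?e n *\<^sub>R y) * cgauss y) \<longlonglongrightarrow> ?\<chi> \<xi> * cgauss y" by simp
      show "integrable lborel (\<lambda>y. norm (cgauss (y::'a)))" by (intro integrable_norm integrable_cgauss)
    qed (auto simp: norm_mult indicator_def)
    then show ?thesis by simp
  qed
  have "(\<lambda>n. \<integral>\<xi>. k \<xi> * H n \<xi> \<partial>lborel) \<longlonglongrightarrow> (\<integral>\<xi>. k \<xi> * (?\<chi> \<xi> * ?I) \<partial>lborel)"
  proof (rule integral_dominated_convergence[where w = "\<lambda>\<xi>. norm (k \<xi>) * (\<integral>y. norm (cgauss (y::'a)) \<partial>lborel)"])
    show "AE \<xi> in lborel. (\<lambda>n. k \<xi> * H n \<xi>) \<longlonglongrightarrow> k \<xi> * (?\<chi> \<xi> * ?I)"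
      using AE_not_in_box_boundary[of p q] by eventually_elim (intro tendsto_mult_left Hlim)
    show "integrable lborel (\<lambda>\<xi>. norm (k \<xi>) * (\<integral>y. norm (cgauss (y::'a)) \<partial>lborel))"
      using k by auto
  qed (auto simp: norm_mult intro!: mult_left_mono Hb)
  then have "(\<integral>\<xi>. k \<xi> * (?\<chi> \<xi> * ?I) \<partial>lborel) = 0"
    by (simp only: kH LIMSEQ_const_iff)
  then have "(\<integral>\<xi>. (k \<xi> * ?\<chi> \<xi>) * ?I \<partial>lborel) = 0" by (simp only: mult.assoc)
  then have "(\<integral>\<xi>. k \<xi> * ?\<chi> \<xi> \<partial>lborel) = 0"
    using integral_cgauss_ne_0[where 'a = 'a] by simp
  moreover have "(\<lambda>\<xi>. k \<xi> * ?\<chi> \<xi>) = (\<lambda>\<xi>. indicator (box p q) \<xi> *\<^sub>R k \<xi>)"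
    by (auto simp: indicator_def)
  ultimately show ?thesis by (simp add: set_lebesgue_integral_def)
qed

text \<open>Multiplying by the nowhere vanishing Gaussian makes \<open>g\<close> integrable,
  preserves the hypothesis and does not change the zero set. The product has integral 0 over every
  box, hence over every Borel set.\<close>

lemma AE_zero_if_schwartz_integrals_zero:
  fixes g :: "'a::euclidean_space \<Rightarrow> complex"
  assumes int: "\<And>\<phi>. schwartz \<phi> \<Longrightarrow> integrable lborel (\<lambda>x. g x * \<phi> x)"
    and zero: "\<And>\<phi>. schwartz \<phi> \<Longrightarrow> (\<integral>x. g x * \<phi> x \<partial>lborel) = 0"
  shows "AE x in lborel. g x = 0"
proof -
  define k where "k x = g x * cgauss x" for x
  have k: "integrable lborel k" unfolding k_def by (rule int[OF schwartz_cgauss])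
  have k0: "(\<integral>x. k x * \<phi> x \<partial>lborel) = 0" if "schwartz \<phi>" for \<phi>
    using zero[OF schwartz_mult[OF schwartz_cgauss that]] by (simp add: k_def mult.assoc)
  \<comment> \<open>The constant 1 is not a Schwartz function, so the total integral is recovered as
    a limit of tests with ever wider Gaussians.\<close>
  have "(\<lambda>n. \<integral>x. k x * cgauss ((1 / real (Suc n)) *\<^sub>R x) \<partial>lborel) \<longlonglongrightarrow> (\<integral>x. k x * cgauss (0::'a) \<partial>lborel)"
    by (rule tendsto_integral_scaled[OF k schwartz_cgauss])
  moreover have "(\<integral>x. k x * cgauss ((1 / real (Suc n)) *\<^sub>R x) \<partial>lborel) = 0" for n
    by (intro k0 schwartz_scaled schwartz_cgauss) simp
  ultimately have ik: "(\<integral>x. k x \<partial>lborel) = 0" by (simp add: LIMSEQ_const_iff)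
  have A: "(\<integral>x. indicator A x *\<^sub>R k x \<partial>lborel) = 0" and ikA: "integrable lborel (\<lambda>x. indicator A x *\<^sub>R k x)"
    if "A \<in> sets lborel" for A
    using set_integral_eq_0_from_boxes[OF k ik box_integral_eq_0[OF k k0], of A] that k
    by (auto simp: set_lebesgue_integral_def intro: integrable_mult_indicator)
  have "AE x in lborel. Re (k x) = 0"
  proof (rule density_unique_real)
    fix A :: "'a set" assume "A \<in> sets lborel"
    from integral_Re[OF ikA[OF this]] A[OF this]
    show "(LINT x:A|lborel. Re (k x)) = (LINT x:A|lborel. 0)"
      by (simp add: set_lebesgue_integral_def)
  qed (use k in auto)
  moreover have "AE x in lborel. Im (k x) = 0"
  proof (rule density_unique_real)
    fix A :: "'a set" assume "A \<in> sets lborel"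
    from integral_Im[OF ikA[OF this]] A[OF this]
    show "(LINT x:A|lborel. Im (k x)) = (LINT x:A|lborel. 0)"
      by (simp add: set_lebesgue_integral_def)
  qed (use k in auto)
  ultimately show ?thesis
  proof eventually_elim
    case (elim x)
    then have "k x = 0" by (simp add: complex_eq_iff)
    then show ?case by (simp add: k_def)
  qed
qed


section \<open>Bessel potential spaces\<close>

definition bessel_weight :: "real \<Rightarrow> 'a::euclidean_space \<Rightarrow> real"
  where "bessel_weight s \<xi> = (1 + (norm \<xi>)\<^sup>2) powr s"

abbreviation weighted_L2 :: "real \<Rightarrow> ('a::euclidean_space \<Rightarrow> complex) \<Rightarrow> bool"
  where "weighted_L2 s g \<equiv> integrable lborel (\<lambda>\<xi>. bessel_weight s \<xi> * (norm (g \<xi>))\<^sup>2)"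

abbreviation weighted_L2_sq :: "real \<Rightarrow> ('a::euclidean_space \<Rightarrow> complex) \<Rightarrow> real"
  where "weighted_L2_sq s g \<equiv> \<integral>\<xi>. bessel_weight s \<xi> * (norm (g \<xi>))\<^sup>2 \<partial>lborel"

lemma bessel_weight_pos: "0 < bessel_weight s \<xi>"
proof -
  have "0 < 1 + (norm \<xi>)\<^sup>2" by (simp add: add_pos_nonneg)
  then show ?thesis by (simp add: bessel_weight_def)
qed

lemma bessel_weight_nonneg [simp]: "0 \<le> bessel_weight s \<xi>"
  by (rule less_imp_le[OF bessel_weight_pos])

lemma decay_weight_nonneg [simp]: "0 \<le> decay_weight x"
  by (rule less_imp_le[OF decay_weight_pos])

lemma bessel_weight_measurable [measurable]: "bessel_weight s \<in> borel_measurable borel"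
  unfolding bessel_weight_def[abs_def] by measurable

lemma bessel_weight_add: "bessel_weight (s + t) \<xi> = bessel_weight s \<xi> * bessel_weight t \<xi>"
  by (simp add: bessel_weight_def powr_add)

lemma bessel_weight_half_square: "(bessel_weight (s / 2) \<xi>)\<^sup>2 = bessel_weight s \<xi>"
  by (simp add: power2_eq_square bessel_weight_add[symmetric])

lemma bessel_weight_le_power:
  obtains m where "\<And>\<xi>::'a::euclidean_space. bessel_weight s \<xi> \<le> (1 + norm \<xi>) ^ m"
proof -
  obtain k :: nat where k: "s \<le> real k" using real_arch_simple by blast
  have "bessel_weight s \<xi> \<le> (1 + norm \<xi>) ^ (2 * k)" for \<xi> :: 'a
  proof -
    have "bessel_weight s \<xi> \<le> (1 + (norm \<xi>)\<^sup>2) powr real k"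
      unfolding bessel_weight_def by (intro powr_mono k) auto
    also have "\<dots> = (1 + (norm \<xi>)\<^sup>2) ^ k"
      by (intro powr_realpow) (simp add: add_pos_nonneg)
    also have "\<dots> \<le> ((1 + norm \<xi>)\<^sup>2) ^ k"
      by (intro power_mono) (auto simp: power2_sum)
    finally show ?thesis by (simp add: power_mult)
  qed
  then show ?thesis using that by blast
qed

lemma decay_weight_le_1: "decay_weight (x::'a::euclidean_space) \<le> 1"
proof -
  have "1 \<le> (1 + norm x) ^ (2 * DIM('a))" by (rule one_le_power) simp
  then have "1 / (1 + norm x) ^ (2 * DIM('a)) \<le> 1 / 1"
    by (intro divide_left_mono) (auto intro!: zero_less_power add_pos_nonneg)
  then show ?thesis by (simp add: decay_weight_def)
qed

lemma integrable_decay_weight_square: "integrable lborel (\<lambda>x::'a::euclidean_space. (decay_weight x)\<^sup>2)"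
proof (rule Bochner_Integration.integrable_bound[OF integrable_decay_weight])
  show "AE x in lborel. norm ((decay_weight (x::'a))\<^sup>2) \<le> norm (decay_weight x)"
    by (intro AE_I2) (simp add: power2_eq_square mult_left_le decay_weight_le_1)
qed measurable

text \<open>The two summands stem from the two terms of the pointwise bound in
  \<open>weighted_L2_pairing\<close>, each of which integrates to a multiple of the norm of
  \<open>g\<close>.\<close>

definition pairing_const :: "'a::euclidean_space itself \<Rightarrow> real"
  where "pairing_const _ = 1 + (\<integral>x. (decay_weight (x::'a))\<^sup>2 \<partial>lborel)"

lemma pairing_const_pos: "0 < pairing_const TYPE('a::euclidean_space)"
  unfolding pairing_const_def by (intro add_pos_nonneg integral_nonneg_AE) auto

text \<open>A Cauchy-Schwarz estimate obtained pointwise: h W \<le> h^2 / t + t W^2 for every t > 0.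
  After integration, a \<open>t\<close> close to the norm of \<open>g\<close> makes both terms
  proportional to that norm.\<close>

lemma weighted_L2_pairing:
  fixes g \<phi> :: "'a::euclidean_space \<Rightarrow> complex"
  assumes [measurable]: "g \<in> borel_measurable borel" "\<phi> \<in> borel_measurable borel"
    and ig: "weighted_L2 s g"
    and D: "0 \<le> D" "\<And>\<xi>. norm (\<phi> \<xi>) \<le> D * (bessel_weight (s / 2) \<xi> * decay_weight \<xi>)"
  shows "integrable lborel (\<lambda>\<xi>. g \<xi> * \<phi> \<xi>)"
    and "norm (\<integral>\<xi>. g \<xi> * \<phi> \<xi> \<partial>lborel) \<le>
      D * pairing_const TYPE('a) * sqrt (weighted_L2_sq s g)"
proof -
  let ?h2 = "\<lambda>\<xi>. bessel_weight s \<xi> * (norm (g \<xi>))\<^sup>2"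
  let ?W2 = "\<lambda>\<xi>::'a. (decay_weight \<xi>)\<^sup>2"
  have pw: "norm (g \<xi> * \<phi> \<xi>) \<le> D * (1 / t * ?h2 \<xi> + t * ?W2 \<xi>)" if "0 < t" for t \<xi>
  proof -
    let ?h = "bessel_weight (s / 2) \<xi> * norm (g \<xi>)" and ?W = "decay_weight \<xi>"
    have "norm (g \<xi> * \<phi> \<xi>) \<le> norm (g \<xi>) * (D * (bessel_weight (s / 2) \<xi> * ?W))"
      unfolding norm_mult by (intro mult_left_mono D) auto
    also have "\<dots> = D * (?h * ?W)" by (simp add: mult_ac)
    also have "\<dots> \<le> D * (1 / t * ?h\<^sup>2 + t * ?W\<^sup>2)"
    proof (intro mult_left_mono D)
      have h0: "0 \<le> ?h * ?W"
        by (intro mult_nonneg_nonneg) auto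
      have "0 \<le> (?h - t * ?W)\<^sup>2" by simp
      then have "2 * t * (?h * ?W) \<le> ?h\<^sup>2 + t\<^sup>2 * ?W\<^sup>2" by (simp add: power2_eq_square algebra_simps)
      then have "t * (?h * ?W) \<le> ?h\<^sup>2 + t\<^sup>2 * ?W\<^sup>2" using mult_nonneg_nonneg[OF less_imp_le[OF that] h0] by linarith
      also have "\<dots> = t * (1 / t * ?h\<^sup>2 + t * ?W\<^sup>2)" using that by (simp add: field_simps power2_eq_square)
      finally show "?h * ?W \<le> 1 / t * ?h\<^sup>2 + t * ?W\<^sup>2" using that by simp
    qed
    also have "?h\<^sup>2 = ?h2 \<xi>" by (simp add: power_mult_distrib bessel_weight_half_square)
    finally show ?thesis .
  qed
  have ib: "integrable lborel (\<lambda>\<xi>. D * (1 / t * ?h2 \<xi> + t * ?W2 \<xi>))" for t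
    by (intro integrable_mult_right Bochner_Integration.integrable_add ig integrable_decay_weight_square)
  show i: "integrable lborel (\<lambda>\<xi>. g \<xi> * \<phi> \<xi>)"
  proof (rule Bochner_Integration.integrable_bound[OF ib[of 1]])
    show "AE \<xi> in lborel. norm (g \<xi> * \<phi> \<xi>) \<le> norm (D * (1 / 1 * ?h2 \<xi> + 1 * ?W2 \<xi>))"
      using pw[of 1] by (intro AE_I2) (auto intro: order_trans[OF _ abs_ge_self])
  qed measurable
  let ?A = "sqrt (\<integral>\<xi>. ?h2 \<xi> \<partial>lborel)" and ?I = "\<integral>\<xi>. ?W2 \<xi> \<partial>lborel"
  have nn: "0 \<le> (\<integral>\<xi>. ?h2 \<xi> \<partial>lborel)" "0 \<le> ?I"
    by (intro integral_nonneg_AE AE_I2, simp)+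
  \<comment> \<open>The natural parameter is the norm \<open>?A\<close>, which may be 0; the added
    \<open>e\<close> keeps it positive and disappears in the limit.\<close>
  have bound: "norm (\<integral>\<xi>. g \<xi> * \<phi> \<xi> \<partial>lborel) \<le> D * (1 + ?I) * (?A + e)" if "0 < e" for e
  proof -
    let ?t = "?A + e"
    have t: "0 < ?t" "?A \<le> ?t" "0 \<le> ?A" using that nn by (auto intro: add_nonneg_pos)
    have "norm (\<integral>\<xi>. g \<xi> * \<phi> \<xi> \<partial>lborel) \<le> (\<integral>\<xi>. D * (1 / ?t * ?h2 \<xi> + ?t * ?W2 \<xi>) \<partial>lborel)"
      by (rule Bochner_Integration.integral_norm_bound_integral[OF i ib]) (rule pw[OF t(1)])
    also have "\<dots> = D * (1 / ?t * ?A\<^sup>2 + ?t * ?I)"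
      using nn by (subst integral_mult_right_zero, subst Bochner_Integration.integral_add)
        (auto intro!: integrable_mult_right integrable_divide ig integrable_decay_weight_square)
    also have "\<dots> \<le> D * (?t + ?t * ?I)"
    proof -
      have "?A\<^sup>2 \<le> ?t\<^sup>2" using t by (intro power_mono) auto
      then have "1 / ?t * ?A\<^sup>2 \<le> ?t" using t(1) by (simp add: divide_le_eq power2_eq_square)
      then show ?thesis by (intro mult_left_mono D add_right_mono)
    qed
    finally show ?thesis by (simp add: algebra_simps)
  qed
  have "norm (\<integral>\<xi>. g \<xi> * \<phi> \<xi> \<partial>lborel) \<le> D * (1 + ?I) * ?A"
  proof (rule tendsto_lowerbound)
    show "((\<lambda>e. D * (1 + ?I) * (?A + e)) \<longlongrightarrow> D * (1 + ?I) * ?A) (at_right 0)"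
      by (auto intro!: tendsto_eq_intros)
    show "\<forall>\<^sub>F e in at_right 0. norm (\<integral>\<xi>. g \<xi> * \<phi> \<xi> \<partial>lborel) \<le> D * (1 + ?I) * (?A + e)"
      using bound by (auto simp: eventually_at_filter)
  qed simp
  then show "norm (\<integral>\<xi>. g \<xi> * \<phi> \<xi> \<partial>lborel) \<le> D * pairing_const TYPE('a) * ?A"
    by (simp add: pairing_const_def)
qed

text \<open>The weights with exponents s/2 and -s/2 are reciprocal, so a polynomial bound on the
  latter converts decay into the majorant that \<open>weighted_L2_pairing\<close> asks for.\<close>

lemma le_bessel_weight_decay_weight:
  fixes \<xi> :: "'a::euclidean_space"
  assumes m: "\<And>\<xi>::'a. bessel_weight (- s / 2) \<xi> \<le> (1 + norm \<xi>) ^ m"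
    and D: "(1 + norm \<xi>) ^ m * x \<le> D * decay_weight \<xi>" and x: "0 \<le> x"
  shows "x \<le> D * (bessel_weight (s / 2) \<xi> * decay_weight \<xi>)"
proof -
  have "bessel_weight (- s / 2) \<xi> * x \<le> D * decay_weight \<xi>"
    using mult_right_mono[OF m x, of \<xi>] D by linarith
  then have "bessel_weight (s / 2) \<xi> * (bessel_weight (- s / 2) \<xi> * x) \<le> bessel_weight (s / 2) \<xi> * (D * decay_weight \<xi>)"
    by (rule mult_left_mono) simp
  moreover have "bessel_weight (s / 2) \<xi> * bessel_weight (- s / 2) \<xi> = 1"
  proof -
    have "0 < 1 + (norm \<xi>)\<^sup>2" by (simp add: add_pos_nonneg)
    then have "bessel_weight (s / 2 + - s / 2) \<xi> = 1" by (simp add: bessel_weight_def)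
    then show ?thesis by (simp only: bessel_weight_add)
  qed
  ultimately have "1 * x \<le> bessel_weight (s / 2) \<xi> * (D * decay_weight \<xi>)"
    by (simp only: mult.assoc[symmetric])
  then show ?thesis by (simp add: mult_ac)
qed

lemma schwartz_weight_bound:
  assumes "schwartz \<phi>"
  obtains D where "0 \<le> D" "\<And>\<xi>. norm (\<phi> \<xi>) \<le> D * (bessel_weight (s / 2) \<xi> * decay_weight \<xi>)"
proof -
  obtain m where m: "\<And>\<xi>::'a. bessel_weight (- s / 2) \<xi> \<le> (1 + norm \<xi>) ^ m"
    using bessel_weight_le_power by blast
  obtain D where "0 \<le> D" "\<And>x. (1 + norm x) ^ m * norm (\<phi> x) \<le> D * decay_weight x"
    using rapidly_decreasing_power_bound[OF schwartz_rapidly_decreasing[OF assms]] by blast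
  then show ?thesis
    by (intro that[of D]) (auto intro!: le_bessel_weight_decay_weight[OF m])
qed

section \<open>Linear operations, representatives of the transform and the Sobolev norm\<close>

lemma pairing_add: "pairing (u + v) \<phi> = pairing u \<phi> + pairing v \<phi>"
  by (simp add: plus_tempered_distribution.rep_eq)

lemma pairing_scaleR: "pairing (c *\<^sub>R u) \<phi> = c * pairing u \<phi>"
  by (simp add: scaleR_tempered_distribution.rep_eq)

lemma pairing_zero: "pairing 0 \<phi> = 0"
  by (simp add: zero_tempered_distribution.rep_eq)

lemma pairing_diff: "pairing (u - v) \<phi> = pairing u \<phi> - pairing v \<phi>"
  using pairing_add[of "u - v" v \<phi>] by simp

lemma pairing_nonschwartz: "\<not> schwartz \<phi> \<Longrightarrow> pairing u \<phi> = 0"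
  using pairing[of u] by blast

lemma has_fourier_add:
  assumes "has_fourier u g" "has_fourier v h"
  shows "has_fourier (u + v) (\<lambda>\<xi>. g \<xi> + h \<xi>)"
proof -
  have "pairing_complex (u + v) \<phi> = pairing_complex u \<phi> + pairing_complex v \<phi>" for \<phi>
    by (simp add: pairing_complex_def pairing_add complex_eq_iff)
  then show ?thesis
    using assms by (auto simp: has_fourier_def distrib_right)
qed

lemma has_fourier_scaleR:
  assumes "has_fourier u g"
  shows "has_fourier (c *\<^sub>R u) (\<lambda>\<xi>. c *\<^sub>R g \<xi>)"
proof -
  have "pairing_complex (c *\<^sub>R u) \<phi> = c *\<^sub>R pairing_complex u \<phi>" for \<phi>
    by (simp add: pairing_complex_def pairing_scaleR complex_eq_iff)
  then show ?thesis
    using assms by (auto simp: has_fourier_def)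
qed

lemma has_fourier_diff:
  assumes "has_fourier u g" "has_fourier v h"
  shows "has_fourier (u - v) (\<lambda>\<xi>. g \<xi> - h \<xi>)"
  using has_fourier_add[OF assms(1) has_fourier_scaleR[OF assms(2), of "-1"]] by simp

lemma has_fourier_zero: "has_fourier 0 (\<lambda>\<xi>. 0)"
  by (simp add: has_fourier_def pairing_complex_def pairing_zero complex_eq_iff)

lemma has_fourier_unique:
  assumes g: "has_fourier u g" and h: "has_fourier u h"
  shows "AE \<xi> in lborel. g \<xi> = h \<xi>"
proof -
  have "AE \<xi> in lborel. g \<xi> - h \<xi> = 0"
    using assms unfolding has_fourier_def
    by (intro AE_zero_if_schwartz_integrals_zero) (auto simp: left_diff_distrib)
  then show ?thesis by simp
qed

text \<open>Any two representatives of the transform agree almost everywhere, so the one hidden in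
  \<open>sobolev_norm\<close> may be replaced by a known one. Later norm computations go through
  this.\<close>

lemma sobolev_has_fourier:
  assumes "u \<in> sobolev s" and g: "has_fourier u g"
  shows "weighted_L2 s g"
    and "(sobolev_norm s u)\<^sup>2 = weighted_L2_sq s g"
    and "sobolev_norm s u = sqrt (weighted_L2_sq s g)"
proof -
  have [measurable]: "g \<in> borel_measurable borel" using g by (simp add: has_fourier_def)
  obtain f where f: "has_fourier u f" "weighted_L2 s f"
    using assms(1) by (auto simp: sobolev_def bessel_weight_def)
  show "weighted_L2 s g"
  proof (rule integrable_cong_AE_imp[OF f(2)])
    show "AE \<xi> in lborel. bessel_weight s \<xi> * (norm (f \<xi>))\<^sup>2 = bessel_weight s \<xi> * (norm (g \<xi>))\<^sup>2"
      using has_fourier_unique[OF f(1) g] by eventually_elim simp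
  qed measurable
  let ?k = "SOME g. has_fourier u g"
  have k: "has_fourier u ?k" by (rule someI[of _ g]) (rule g)
  have [measurable]: "?k \<in> borel_measurable borel" using k by (simp only: has_fourier_def)
  have "weighted_L2_sq s ?k = weighted_L2_sq s g"
  proof (rule integral_cong_AE)
    show "AE \<xi> in lborel. bessel_weight s \<xi> * (norm (?k \<xi>))\<^sup>2 = bessel_weight s \<xi> * (norm (g \<xi>))\<^sup>2"
      using has_fourier_unique[OF k g] by eventually_elim simp
  qed measurable
  then show *: "sobolev_norm s u = sqrt (weighted_L2_sq s g)"
    by (simp add: sobolev_norm_def bessel_weight_def)
  have "0 \<le> weighted_L2_sq s g"
    by (intro integral_nonneg_AE AE_I2) simp
  then show "(sobolev_norm s u)\<^sup>2 = weighted_L2_sq s g"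
    unfolding * by simp
qed

lemma sobolev_obtain_fourier:
  assumes "u \<in> sobolev s"
  obtains g where "has_fourier u g" "g \<in> borel_measurable borel"
  using assms by (auto simp: sobolev_def has_fourier_def)

lemma sobolevI:
  assumes "has_fourier u g" "weighted_L2 s g"
  shows "u \<in> sobolev s"
  using assms by (auto simp: sobolev_def bessel_weight_def)

lemma sobolev_zero: "0 \<in> sobolev s"
  by (rule sobolevI[OF has_fourier_zero]) simp

lemma norm_add_square_le:
  fixes x y :: "'b::real_normed_vector"
  shows "(norm (x + y))\<^sup>2 \<le> 2 * (norm x)\<^sup>2 + 2 * (norm y)\<^sup>2"
proof -
  have "(norm (x + y))\<^sup>2 \<le> (norm x + norm y)\<^sup>2" by (intro power_mono norm_triangle_ineq) auto
  also have "\<dots> \<le> 2 * (norm x)\<^sup>2 + 2 * (norm y)\<^sup>2"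
    using zero_le_power2[of "norm x - norm y"] by (simp add: power2_eq_square algebra_simps)
  finally show ?thesis .
qed

lemma weighted_L2_add:
  fixes g h :: "'a::euclidean_space \<Rightarrow> complex"
  assumes [measurable]: "g \<in> borel_measurable borel" "h \<in> borel_measurable borel"
    and i: "weighted_L2 s g"
      "weighted_L2 s h"
  shows "weighted_L2 s (\<lambda>\<xi>. g \<xi> + h \<xi>)"
    and "weighted_L2_sq s (\<lambda>\<xi>. g \<xi> + h \<xi>) \<le>
      2 * weighted_L2_sq s g + 2 * weighted_L2_sq s h"
proof -
  let ?r = "\<lambda>\<xi>. 2 * (bessel_weight s \<xi> * (norm (g \<xi>))\<^sup>2) + 2 * (bessel_weight s \<xi> * (norm (h \<xi>))\<^sup>2)"
  have le: "bessel_weight s \<xi> * (norm (g \<xi> + h \<xi>))\<^sup>2 \<le> ?r \<xi>" for \<xi>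
    using mult_left_mono[OF norm_add_square_le[of "g \<xi>" "h \<xi>"] less_imp_le[OF bessel_weight_pos[of s \<xi>]]]
    by (simp add: algebra_simps)
  have nn: "0 \<le> bessel_weight s \<xi> * (norm (g \<xi> + h \<xi>))\<^sup>2" for \<xi>
    by simp
  have ir: "integrable lborel ?r" by (intro Bochner_Integration.integrable_add integrable_mult_right i)
  show j: "weighted_L2 s (\<lambda>\<xi>. g \<xi> + h \<xi>)"
  proof (rule Bochner_Integration.integrable_bound[OF ir])
    show "AE \<xi> in lborel. norm (bessel_weight s \<xi> * (norm (g \<xi> + h \<xi>))\<^sup>2) \<le> norm (?r \<xi>)"
      using le nn by (intro AE_I2) (simp only: real_norm_def abs_of_nonneg order_trans[OF _ abs_ge_self])
  qed measurable
  have "weighted_L2_sq s (\<lambda>\<xi>. g \<xi> + h \<xi>) \<le> (\<integral>\<xi>. ?r \<xi> \<partial>lborel)"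
    by (rule integral_mono[OF j ir le])
  also have "\<dots> = 2 * weighted_L2_sq s g + 2 * weighted_L2_sq s h"
    using i by simp
  finally show "weighted_L2_sq s (\<lambda>\<xi>. g \<xi> + h \<xi>) \<le>
      2 * weighted_L2_sq s g + 2 * weighted_L2_sq s h" .
qed

lemma sobolev_norm_nonneg: "0 \<le> sobolev_norm s u"
  unfolding sobolev_norm_def by (intro real_sqrt_ge_zero integral_nonneg_AE AE_I2) simp

text \<open>The factor 2 comes from |x + y|^2 \<le> 2 |x|^2 + 2 |y|^2, applied pointwise under the
  integral; it explains the tolerances e / 4 in later limit arguments.\<close>

lemma sobolev_add:
  assumes u: "u \<in> sobolev s" and v: "v \<in> sobolev s"
  shows "u + v \<in> sobolev s" and "sobolev_norm s (u + v) \<le> 2 * (sobolev_norm s u + sobolev_norm s v)"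
proof -
  obtain g where g: "has_fourier u g" "g \<in> borel_measurable borel" using sobolev_obtain_fourier[OF u] by blast
  obtain h where h: "has_fourier v h" "h \<in> borel_measurable borel" using sobolev_obtain_fourier[OF v] by blast
  note gh = weighted_L2_add[OF g(2) h(2) sobolev_has_fourier(1)[OF u g(1)] sobolev_has_fourier(1)[OF v h(1)]]
  show uv: "u + v \<in> sobolev s"
    by (rule sobolevI[OF has_fourier_add[OF g(1) h(1)] gh(1)])
  have "(sobolev_norm s (u + v))\<^sup>2 \<le> 2 * (sobolev_norm s u)\<^sup>2 + 2 * (sobolev_norm s v)\<^sup>2"
    using gh(2) by (simp only: sobolev_has_fourier(2)[OF u g(1)] sobolev_has_fourier(2)[OF v h(1)]
        sobolev_has_fourier(2)[OF uv has_fourier_add[OF g(1) h(1)]])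
  also have "\<dots> \<le> (2 * (sobolev_norm s u + sobolev_norm s v))\<^sup>2"
    using mult_nonneg_nonneg[OF sobolev_norm_nonneg[of s u] sobolev_norm_nonneg[of s v]]
    by (simp add: power2_eq_square algebra_simps)
  finally show "sobolev_norm s (u + v) \<le> 2 * (sobolev_norm s u + sobolev_norm s v)"
    by (rule power2_le_imp_le) (simp add: sobolev_norm_nonneg)
qed

lemma sobolev_scaleR:
  assumes u: "u \<in> sobolev s"
  shows "c *\<^sub>R u \<in> sobolev s" and "sobolev_norm s (c *\<^sub>R u) = \<bar>c\<bar> * sobolev_norm s u"
proof -
  obtain g where g: "has_fourier u g" "g \<in> borel_measurable borel" using sobolev_obtain_fourier[OF u] by blast
  have eq: "bessel_weight s \<xi> * (norm (c *\<^sub>R g \<xi>))\<^sup>2 = c\<^sup>2 * (bessel_weight s \<xi> * (norm (g \<xi>))\<^sup>2)" for \<xi>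
    by (simp add: power_mult_distrib)
  show cu: "c *\<^sub>R u \<in> sobolev s"
    using sobolev_has_fourier(1)[OF u g(1)]
    by (intro sobolevI[OF has_fourier_scaleR[OF g(1), of c]]) (unfold eq, intro integrable_mult_right)
  show "sobolev_norm s (c *\<^sub>R u) = \<bar>c\<bar> * sobolev_norm s u"
    unfolding sobolev_has_fourier(3)[OF cu has_fourier_scaleR[OF g(1), of c]] sobolev_has_fourier(3)[OF u g(1)] eq
    by (simp add: real_sqrt_mult)
qed

lemma sobolev_diff:
  assumes u: "u \<in> sobolev s" and v: "v \<in> sobolev s"
  shows "u - v \<in> sobolev s" and "sobolev_norm s (u - v) \<le> 2 * (sobolev_norm s u + sobolev_norm s v)"
  using sobolev_add[OF u sobolev_scaleR(1)[OF v, of "-1"]] sobolev_scaleR(2)[OF v, of "-1"] by auto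

lemma sobolev_norm_minus_commute:
  assumes "u \<in> sobolev s" "v \<in> sobolev s"
  shows "sobolev_norm s (u - v) = sobolev_norm s (v - u)"
  using sobolev_scaleR(2)[OF sobolev_diff(1)[OF assms], of "-1"] by simp

lemma sobolev_dist_triangle:
  assumes "u \<in> sobolev s" "v \<in> sobolev s" "w \<in> sobolev s"
  shows "sobolev_norm s (u - w) \<le> 2 * (sobolev_norm s (u - v) + sobolev_norm s (v - w))"
  using sobolev_add(2)[OF sobolev_diff(1)[OF assms(1,2)] sobolev_diff(1)[OF assms(2,3)]] by simp

text \<open>Continuity of the embedding of H^s into the tempered distributions. With \<psi> written
  as \<open>fourier \<phi>\<close>, the pairing is an integral of the transform of \<open>u\<close>
  against \<phi>, and the weighted Cauchy-Schwarz estimate applies with constants independent of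
  \<open>u\<close> and \<psi>.\<close>

lemma sobolev_pairing_bound:
  "\<exists>C\<ge>0. \<exists>K. \<forall>u\<in>sobolev s. \<forall>\<psi>::'a::euclidean_space \<Rightarrow> real. schwartz \<psi> \<longrightarrow>
     \<bar>pairing u \<psi>\<bar> \<le> C * sobolev_norm s u * schwartz_seminorm K \<psi>"
proof -
  obtain m where m: "\<And>\<xi>::'a. bessel_weight (- s / 2) \<xi> \<le> (1 + norm \<xi>) ^ m"
    using bessel_weight_le_power by blast
  \<comment> \<open>Of these powers of decay, \<open>m\<close> pay for the weight with exponent -s/2
    and the remaining ones for \<open>decay_weight\<close>.\<close>
  obtain C K where C: "0 \<le> C" and pre: "\<And>\<psi>::'a \<Rightarrow> real. schwartz \<psi> \<Longrightarrow>
     (\<exists>\<phi>. schwartz \<phi> \<and> fourier \<phi> = (\<lambda>x. complex_of_real (\<psi> x)) \<and>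
        (\<forall>x. (1 + norm x) ^ (m + 2 * DIM('a)) * norm (\<phi> x) \<le> C * schwartz_seminorm K \<psi>))"
    using real_schwartz_fourier_preimage[of "m + 2 * DIM('a)", where 'a = 'a] by blast
  have "\<bar>pairing u \<psi>\<bar> \<le> (C * pairing_const TYPE('a)) * sobolev_norm s u * schwartz_seminorm K \<psi>"
    if u: "u \<in> sobolev s" and \<psi>: "schwartz \<psi>" for u :: "'a tempered_distribution" and \<psi>
  proof -
    obtain \<phi> where \<phi>: "schwartz \<phi>" "fourier \<phi> = (\<lambda>x. complex_of_real (\<psi> x))"
      and b: "\<And>x. (1 + norm x) ^ (m + 2 * DIM('a)) * norm (\<phi> x) \<le> C * schwartz_seminorm K \<psi>"
      using pre[OF \<psi>] by blast
    obtain g where g: "has_fourier u g" "g \<in> borel_measurable borel" using sobolev_obtain_fourier[OF u] by blast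
    have "(1 + norm \<xi>) ^ m * norm (\<phi> \<xi>) \<le> (C * schwartz_seminorm K \<psi>) * decay_weight \<xi>" for \<xi>
      using b[of \<xi>] zero_less_power[of "1 + norm \<xi>" "2 * DIM('a)"]
      by (simp add: decay_weight_def power_add pos_le_divide_eq add_pos_nonneg mult_ac)
    from le_bessel_weight_decay_weight[OF m this norm_ge_zero]
    have d: "norm (\<phi> \<xi>) \<le> (C * schwartz_seminorm K \<psi>) * (bessel_weight (s / 2) \<xi> * decay_weight \<xi>)" for \<xi> .
    have "pairing u \<psi> = Re (pairing_complex u (fourier \<phi>))"
      by (simp add: pairing_complex_def \<phi>(2))
    also have "pairing_complex u (fourier \<phi>) = (\<integral>\<xi>. g \<xi> * \<phi> \<xi> \<partial>lborel)"
      using g(1) \<phi>(1) unfolding has_fourier_def by blast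
    finally have "\<bar>pairing u \<psi>\<bar> \<le> norm (\<integral>\<xi>. g \<xi> * \<phi> \<xi> \<partial>lborel)"
      by (simp only: abs_Re_le_cmod)
    also have "\<dots> \<le> (C * schwartz_seminorm K \<psi>) * pairing_const TYPE('a) * sobolev_norm s u"
      unfolding sobolev_has_fourier(3)[OF u g(1)]
      by (rule weighted_L2_pairing(2)[OF g(2) schwartz_measurable[OF \<phi>(1)] sobolev_has_fourier(1)[OF u g(1)] _ d])
        (use C schwartz_seminorm_nonneg[OF \<psi>] in simp)
    finally show ?thesis by (simp add: mult_ac)
  qed
  then show ?thesis
    using C less_imp_le[OF pairing_const_pos[where 'a = 'a]]
    by (intro exI[of _ "C * pairing_const TYPE('a)"] conjI exI[of _ K]) auto
qed

lemma sobolev_norm_eq_0: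
  assumes "u \<in> sobolev s" "sobolev_norm s u = 0"
  shows "u = 0"
proof -
  obtain C K where b: "\<forall>u\<in>sobolev s. \<forall>\<psi>::'a \<Rightarrow> real. schwartz \<psi> \<longrightarrow>
     \<bar>pairing u \<psi>\<bar> \<le> C * sobolev_norm s u * schwartz_seminorm K \<psi>"
    using sobolev_pairing_bound by blast
  have "pairing u \<psi> = pairing 0 \<psi>" for \<psi>
    using b[rule_format, OF assms(1), of \<psi>] pairing_nonschwartz[of \<psi> u] assms(2)
    by (cases "schwartz \<psi>") (auto simp: pairing_zero)
  then show ?thesis by (metis ext pairing_inject)
qed

text \<open>By the multiplication formula the distributional transform of \<open>f\<close> is its
  classical one, whose rapid decay beats the polynomially bounded weight.\<close>

lemma test_function_in_sobolev:
  assumes f: "f \<in> C\<^sub>c\<^sup>\<infinity> W"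
  shows "distr_of f \<in> sobolev s"
proof -
  let ?f = "\<lambda>x. complex_of_real (f x)"
  have sf: "schwartz ?f" by (rule schwartz_of_real[OF schwartz_test_function[OF f]])
  have sF: "schwartz (fourier ?f)" by (rule schwartz_fourier[OF sf])
  have hf: "has_fourier (distr_of f) (fourier ?f)"
    unfolding has_fourier_def
  proof (intro conjI allI impI)
    show "fourier ?f \<in> borel_measurable borel" by (rule schwartz_measurable[OF sF])
    fix \<phi> :: "'a \<Rightarrow> complex" assume \<phi>: "schwartz \<phi>"
    show "integrable lborel (\<lambda>\<xi>. fourier ?f \<xi> * \<phi> \<xi>)"
      by (rule schwartz_integrable[OF schwartz_mult[OF sF \<phi>]])
    have s\<phi>: "schwartz (fourier \<phi>)" by (rule schwartz_fourier[OF \<phi>])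
    have i: "integrable lborel (\<lambda>x. ?f x * fourier \<phi> x)"
      by (rule schwartz_integrable[OF schwartz_mult[OF sf s\<phi>]])
    have "pairing_complex (distr_of f) (fourier \<phi>) = (\<integral>x. ?f x * fourier \<phi> x \<partial>lborel)"
      unfolding pairing_complex_def pairing_distr_of[OF f] complex_eq_iff
      using integral_Re[OF i] integral_Im[OF i]
        schwartz_bounded_linear[OF bounded_linear_Re s\<phi>] schwartz_bounded_linear[OF bounded_linear_Im s\<phi>] by simp
    also have "\<dots> = (\<integral>\<xi>. fourier ?f \<xi> * \<phi> \<xi> \<partial>lborel)"
      by (rule fourier_multiplication_formula[OF schwartz_integrable[OF sf] schwartz_integrable[OF \<phi>], symmetric])
    finally show "pairing_complex (distr_of f) (fourier \<phi>) = (\<integral>\<xi>. fourier ?f \<xi> * \<phi> \<xi> \<partial>lborel)" .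
  qed
  obtain m where m: "\<And>\<xi>::'a. bessel_weight s \<xi> \<le> (1 + norm \<xi>) ^ m"
    using bessel_weight_le_power by blast
  obtain C where C: "0 \<le> C" "\<And>\<xi>. norm (fourier ?f \<xi>) \<le> C" using schwartz_bounded[OF sF] by blast
  obtain D where D: "0 \<le> D" "\<And>\<xi>. (1 + norm \<xi>) ^ m * norm (fourier ?f \<xi>) \<le> D * decay_weight \<xi>"
    using rapidly_decreasing_power_bound[OF schwartz_rapidly_decreasing[OF sF]] by blast
  have [measurable]: "fourier ?f \<in> borel_measurable borel" by (rule schwartz_measurable[OF sF])
  have "weighted_L2 s (fourier ?f)"
  proof (rule integrable_by_decay)
    fix \<xi> :: 'a
    have "norm (bessel_weight s \<xi> * (norm (fourier ?f \<xi>))\<^sup>2) = (bessel_weight s \<xi> * norm (fourier ?f \<xi>)) * norm (fourier ?f \<xi>)"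
      using less_imp_le[OF bessel_weight_pos[of s \<xi>]] by (simp add: power2_eq_square abs_mult)
    also have "\<dots> \<le> ((1 + norm \<xi>) ^ m * norm (fourier ?f \<xi>)) * norm (fourier ?f \<xi>)"
      by (intro mult_right_mono m) auto
    also have "\<dots> \<le> (D * decay_weight \<xi>) * C"
      using D(1) less_imp_le[OF decay_weight_pos[of \<xi>]] by (intro mult_mono D C) auto
    finally show "norm (bessel_weight s \<xi> * (norm (fourier ?f \<xi>))\<^sup>2) \<le> (D * C) * decay_weight \<xi>"
      by (simp add: mult_ac)
  qed measurable
  then show ?thesis by (rule sobolevI[OF hf])
qed


section \<open>Completeness of H^s\<close>

lemma weighted_L2_diff_integrable:
  fixes g h :: "'a::euclidean_space \<Rightarrow> complex"
  assumes "g \<in> borel_measurable borel" "h \<in> borel_measurable borel"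
    "weighted_L2 s g"
    "weighted_L2 s h"
  shows "weighted_L2 s (\<lambda>\<xi>. g \<xi> - h \<xi>)"
  using weighted_L2_add(1)[of g "\<lambda>\<xi>. - h \<xi>" s] assms by simp

text \<open>Expanding (2^k y - 1)^2 \<ge> 0 gives y \<le> 2^k y^2 + 2^(-k), so the weighted squares
  dominate the norms up to a geometric series.\<close>

lemma summable_norm_from_squares:
  fixes x :: "nat \<Rightarrow> 'b::banach"
  assumes "summable (\<lambda>k. 2 ^ k * (norm (x k))\<^sup>2)"
  shows "summable x"
proof (rule summable_comparison_test)
  show "summable (\<lambda>k. 2 ^ k * (norm (x k))\<^sup>2 + (1 / 2) ^ k)"
    using assms by (intro summable_add) (auto intro!: summable_geometric)
  have "norm (x k) \<le> 2 ^ k * (norm (x k))\<^sup>2 + (1 / 2) ^ k" for k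
  proof -
    have "0 \<le> (2 ^ k * norm (x k) - 1)\<^sup>2" by simp
    then have "2 * (2 ^ k * norm (x k)) \<le> 2 ^ k * (2 ^ k * (norm (x k))\<^sup>2) + 1"
      by (simp add: power2_eq_square algebra_simps)
    also have "\<dots> = 2 ^ k * (2 ^ k * (norm (x k))\<^sup>2 + (1 / 2) ^ k)"
      by (simp add: distrib_left power_one_over)
    finally have dbl: "2 * (2 ^ k * norm (x k)) \<le> 2 ^ k * (2 ^ k * (norm (x k))\<^sup>2 + (1 / 2) ^ k)" .
    then have "2 ^ k * norm (x k) \<le> 2 ^ k * (2 ^ k * (norm (x k))\<^sup>2 + (1 / 2) ^ k)"
    proof -
      have "u \<le> v" if "2 * u \<le> v" "0 \<le> u" for u v :: real using that by simp
      then show ?thesis using dbl by (meson mult_nonneg_nonneg norm_ge_zero zero_le_numeral zero_le_power)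
    qed
    then show ?thesis by (simp only: mult_le_cancel_left_pos zero_less_power zero_less_numeral)
  qed
  then show "\<exists>N. \<forall>k\<ge>N. norm (x k) \<le> 2 ^ k * (norm (x k))\<^sup>2 + (1 / 2) ^ k" by blast
qed

lemma convergent_from_summable_differences:
  fixes x :: "nat \<Rightarrow> 'b::real_normed_vector"
  assumes "summable (\<lambda>k. x (Suc k) - x k)"
  shows "convergent x"
proof -
  have "(\<lambda>n. x n - x 0) \<longlonglongrightarrow> (\<Sum>k. x (Suc k) - x k)"
    using summable_LIMSEQ[OF assms] by (simp add: sum_lessThan_telescope)
  from tendsto_add[OF this tendsto_const[of "x 0"]] show ?thesis
    by (auto simp: convergent_def)
qed

text \<open>The Riesz-Fischer argument. Consecutive differences have weighted square integral at
  most 4^(-k), so they stay summable after multiplication by 2^k, and the sequence converges almost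
  everywhere.\<close>

lemma weighted_L2_limit:
  fixes g :: "nat \<Rightarrow> 'a::euclidean_space \<Rightarrow> complex"
  assumes gm [measurable]: "\<And>k. g k \<in> borel_measurable borel"
    and ig: "\<And>k. weighted_L2 s (g k)"
    and dist: "\<And>j k. k \<le> j \<Longrightarrow> weighted_L2_sq s (\<lambda>\<xi>. g k \<xi> - g j \<xi>) \<le> (1 / 4) ^ k"
  obtains f where "f \<in> borel_measurable borel"
    "weighted_L2 s f"
    "\<And>k. weighted_L2 s (\<lambda>\<xi>. g k \<xi> - f \<xi>)"
    "\<And>k. (weighted_L2_sq s (\<lambda>\<xi>. g k \<xi> - f \<xi>)) \<le> (1 / 4) ^ k"
proof -
  let ?d = "\<lambda>k j \<xi>. bessel_weight s \<xi> * (norm (g k \<xi> - g j \<xi>))\<^sup>2"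
  have id: "integrable lborel (?d k j)" for k j
    by (intro weighted_L2_diff_integrable gm ig)
  have nd: "(\<integral>\<^sup>+\<xi>. ennreal (?d k j \<xi>) \<partial>lborel) \<le> ennreal ((1 / 4) ^ k)" if "k \<le> j" for k j
    by (subst nn_integral_eq_integral[OF id]) (auto intro!: ennreal_leI dist that)
  let ?D = "\<lambda>k \<xi>. 2 ^ k * ?d k (Suc k) \<xi>"
  have "(\<integral>\<^sup>+\<xi>. (\<Sum>k. ennreal (?D k \<xi>)) \<partial>lborel) = (\<Sum>k. \<integral>\<^sup>+\<xi>. ennreal (?D k \<xi>) \<partial>lborel)"
    by (rule nn_integral_suminf) measurable
  also have "\<dots> \<le> (\<Sum>k. ennreal ((1 / 2) ^ k))"
  proof (intro suminf_le)
    fix k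
    have "(\<integral>\<^sup>+\<xi>. ennreal (?D k \<xi>) \<partial>lborel) = ennreal (2 ^ k) * (\<integral>\<^sup>+\<xi>. ennreal (?d k (Suc k) \<xi>) \<partial>lborel)"
      by (subst nn_integral_cmult[symmetric]) (auto simp: ennreal_mult)
    also have "\<dots> \<le> ennreal (2 ^ k) * ennreal ((1 / 4) ^ k)"
      by (intro mult_left_mono nd) auto
    also have "\<dots> = ennreal ((1 / 2) ^ k)"
      by (simp add: ennreal_mult[symmetric] power_mult_distrib[symmetric])
    finally show "(\<integral>\<^sup>+\<xi>. ennreal (?D k \<xi>) \<partial>lborel) \<le> ennreal ((1 / 2) ^ k)" .
  qed auto
  also have "\<dots> = ennreal (\<Sum>k. (1 / 2) ^ k)"
    by (intro suminf_ennreal2) (auto intro!: summable_geometric)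
  finally have "(\<integral>\<^sup>+\<xi>. (\<Sum>k. ennreal (?D k \<xi>)) \<partial>lborel) \<noteq> \<infinity>"
    by (auto simp: top_unique)
  then have "AE \<xi> in lborel. (\<Sum>k. ennreal (?D k \<xi>)) \<noteq> \<infinity>"
    by (intro nn_integral_PInf_AE) auto
  then have conv: "AE \<xi> in lborel. convergent (\<lambda>k. g k \<xi>)"
  proof eventually_elim
    case (elim \<xi>)
    then have "summable (\<lambda>k. ?D k \<xi>)"
      by (intro summable_suminf_not_top) auto
    then have "summable (\<lambda>k. 1 / bessel_weight s \<xi> * (?D k \<xi>))"
      by (rule summable_mult)
    also have "(\<lambda>k. 1 / bessel_weight s \<xi> * (?D k \<xi>)) = (\<lambda>k. 2 ^ k * (norm (g (Suc k) \<xi> - g k \<xi>))\<^sup>2)"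
      using bessel_weight_pos[of s \<xi>] by (auto simp: norm_minus_commute)
    finally show ?case
      by (rule convergent_from_summable_differences[OF summable_norm_from_squares])
  qed
  define f where "f \<xi> = lim (\<lambda>k. g k \<xi>)" for \<xi>
  have [measurable]: "f \<in> borel_measurable borel"
    unfolding f_def by measurable
  have flim: "AE \<xi> in lborel. (\<lambda>k. g k \<xi>) \<longlonglongrightarrow> f \<xi>"
    using conv by eventually_elim (simp add: convergent_LIMSEQ_iff f_def)
  \<comment> \<open>The distance from member \<open>k\<close> to member \<open>j\<close> is bounded
    uniformly in j \<ge> k; Fatou's lemma in \<open>j\<close> transfers the bound to the limit
    function.\<close>
  have nf: "(\<integral>\<^sup>+\<xi>. ennreal (bessel_weight s \<xi> * (norm (g k \<xi> - f \<xi>))\<^sup>2) \<partial>lborel) \<le> ennreal ((1 / 4) ^ k)" for k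
  proof -
    have "(\<integral>\<^sup>+\<xi>. ennreal (bessel_weight s \<xi> * (norm (g k \<xi> - f \<xi>))\<^sup>2) \<partial>lborel)
        = (\<integral>\<^sup>+\<xi>. liminf (\<lambda>j. ennreal (?d k j \<xi>)) \<partial>lborel)"
    proof (rule nn_integral_cong_AE)
      show "AE \<xi> in lborel. ennreal (bessel_weight s \<xi> * (norm (g k \<xi> - f \<xi>))\<^sup>2) = liminf (\<lambda>j. ennreal (?d k j \<xi>))"
        using flim
      proof eventually_elim
        case (elim \<xi>)
        then have "(\<lambda>j. ennreal (?d k j \<xi>)) \<longlonglongrightarrow> ennreal (bessel_weight s \<xi> * (norm (g k \<xi> - f \<xi>))\<^sup>2)"
          by (intro tendsto_ennrealI tendsto_intros)
        then show ?case by (intro lim_imp_Liminf[symmetric]) auto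
      qed
    qed
    also have "\<dots> \<le> liminf (\<lambda>j. \<integral>\<^sup>+\<xi>. ennreal (?d k j \<xi>) \<partial>lborel)"
      by (rule nn_integral_liminf) measurable
    also have "\<dots> \<le> liminf (\<lambda>j::nat. ennreal ((1 / 4) ^ k))"
      by (intro Liminf_mono) (auto simp: eventually_sequentially intro!: exI[of _ k] nd)
    also have "\<dots> = ennreal ((1 / 4) ^ k)" by (simp add: Liminf_const)
    finally show ?thesis .
  qed
  have kf: "weighted_L2 s (\<lambda>\<xi>. g k \<xi> - f \<xi>)" for k
  proof (rule integrableI_nonneg)
    show "(\<integral>\<^sup>+\<xi>. ennreal (bessel_weight s \<xi> * (norm (g k \<xi> - f \<xi>))\<^sup>2) \<partial>lborel) < \<infinity>"
      using order.strict_trans1[OF nf[of k] ennreal_less_top] by simp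
  qed auto
  show ?thesis
  proof (rule that[of f])
    show "weighted_L2_sq s (\<lambda>\<xi>. g k \<xi> - f \<xi>) \<le> (1 / 4) ^ k" for k
      using nf[of k] by (subst (asm) nn_integral_eq_integral[OF kf]) auto
    have "weighted_L2 s (\<lambda>\<xi>. g 0 \<xi> - (g 0 \<xi> - f \<xi>))"
      by (intro weighted_L2_diff_integrable ig kf) measurable
    then show "weighted_L2 s f" by simp
  qed (auto intro: kf)
qed

lemma pairing_add_right:
  "schwartz \<phi> \<Longrightarrow> schwartz \<psi> \<Longrightarrow> pairing u (\<lambda>x. \<phi> x + \<psi> x) = pairing u \<phi> + pairing u \<psi>"
  using pairing[of u] by blast

lemma pairing_scale_right:
  "schwartz \<phi> \<Longrightarrow> pairing u (\<lambda>x. c * \<phi> x) = c * pairing u \<phi>"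
  using pairing[of u] by blast

text \<open>A seminorm bound uniform in \<open>k\<close> survives the pointwise limit, which is
  therefore continuous. On functions that are not Schwartz all values are 0 by convention.\<close>

lemma tendsto_tempered_distribution:
  fixes u :: "nat \<Rightarrow> 'a::euclidean_space tempered_distribution"
  assumes conv: "\<And>\<psi>. schwartz \<psi> \<Longrightarrow> convergent (\<lambda>k. pairing (u k) \<psi>)"
    and bound: "\<And>k \<psi>. schwartz \<psi> \<Longrightarrow> \<bar>pairing (u k) \<psi>\<bar> \<le> C * schwartz_seminorm K \<psi>"
  obtains v where "\<And>\<psi>. (\<lambda>k. pairing (u k) \<psi>) \<longlonglongrightarrow> pairing v \<psi>"
proof -
  define l where "l \<psi> = lim (\<lambda>k. pairing (u k) \<psi>)" for \<psi>
  have l: "(\<lambda>k. pairing (u k) \<psi>) \<longlonglongrightarrow> l \<psi>" for \<psi>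
  proof (cases "schwartz \<psi>")
    case True
    then show ?thesis using conv by (simp add: l_def convergent_LIMSEQ_iff)
  qed (simp add: l_def pairing_nonschwartz)
  have "pairing (Abs_tempered_distribution l) = l"
  proof (rule Abs_tempered_distribution_inverse, intro CollectI conjI allI impI)
    show "l \<phi> = 0" if "\<not> schwartz \<phi>" for \<phi>
      using that by (simp add: l_def pairing_nonschwartz)
    show "l (\<lambda>x. \<phi> x + \<psi> x) = l \<phi> + l \<psi>" if "schwartz \<phi>" "schwartz \<psi>" for \<phi> \<psi>
      using tendsto_add[OF l[of \<phi>] l[of \<psi>]] l[of "\<lambda>x. \<phi> x + \<psi> x"] that
      by (simp add: pairing_add_right LIMSEQ_unique)
    show "l (\<lambda>x. c * \<phi> x) = c * l \<phi>" if "schwartz \<phi>" for c \<phi>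
      using tendsto_mult_left[OF l[of \<phi>], of c] l[of "\<lambda>x. c * \<phi> x"] that
      by (simp add: pairing_scale_right LIMSEQ_unique)
    have "\<bar>l \<phi>\<bar> \<le> C * schwartz_seminorm K \<phi>" if "schwartz \<phi>" for \<phi>
      by (rule LIMSEQ_le_const2[OF tendsto_rabs[OF l[of \<phi>]]]) (use bound[OF that] in auto)
    then show "\<exists>C N. \<forall>\<phi>. schwartz \<phi> \<longrightarrow> \<bar>l \<phi>\<bar> \<le> C * schwartz_seminorm N \<phi>" by blast
  qed
  then show ?thesis using l that[of "Abs_tempered_distribution l"] by simp
qed

text \<open>The transforms converge to some \<open>f\<close> in the weighted space, but a
  distribution with transform \<open>f\<close> is still to be found. It is the pointwise limit of
  the functionals \<open>Y k\<close>, real because they are; testing with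
  \<open>fourier \<phi>\<close> identifies its transform.\<close>

lemma sobolev_complete_fast:
  fixes Y :: "nat \<Rightarrow> 'a::euclidean_space tempered_distribution"
  assumes Y: "\<And>k. Y k \<in> sobolev s"
    and fast: "\<And>j k. k \<le> j \<Longrightarrow> sobolev_norm s (Y k - Y j) \<le> (1 / 2) ^ k"
  obtains u where "u \<in> sobolev s" "\<And>k. sobolev_norm s (Y k - u) \<le> (1 / 2) ^ k"
proof -
  have "\<exists>g. has_fourier (Y k) g \<and> g \<in> borel_measurable borel" for k
    using sobolev_obtain_fourier[OF Y[of k]] by blast
  then obtain g where g: "\<And>k. has_fourier (Y k) (g k)" "\<And>k. g k \<in> borel_measurable borel"
    by metis
  have ig: "weighted_L2 s (g k)" for k
    by (rule sobolev_has_fourier(1)[OF Y g(1)])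
  have quarter: "((1 / 2) ^ k)\<^sup>2 = ((1 / 4) ^ k :: real)" for k
    by (simp add: power_mult[symmetric] mult.commute[of k 2]) (simp add: power_mult power2_eq_square)
  have "weighted_L2_sq s (\<lambda>\<xi>. g k \<xi> - g j \<xi>) \<le> (1 / 4) ^ k" if "k \<le> j" for j k
  proof -
    have "(sobolev_norm s (Y k - Y j))\<^sup>2 \<le> ((1 / 2) ^ k)\<^sup>2"
      by (intro power_mono fast that sobolev_norm_nonneg)
    then show ?thesis
      by (simp only: quarter sobolev_has_fourier(2)[OF sobolev_diff(1)[OF Y Y] has_fourier_diff[OF g(1) g(1)]])
  qed
  from weighted_L2_limit[OF g(2) ig this]
  obtain f where f: "f \<in> borel_measurable borel"
    "weighted_L2 s f"
    "\<And>k. weighted_L2 s (\<lambda>\<xi>. g k \<xi> - f \<xi>)"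
    "\<And>k. (weighted_L2_sq s (\<lambda>\<xi>. g k \<xi> - f \<xi>)) \<le> (1 / 4) ^ k"
    by blast
  have [measurable]: "f \<in> borel_measurable borel" "\<And>k. g k \<in> borel_measurable borel" by (fact f g)+
  have if\<phi>: "integrable lborel (\<lambda>\<xi>. f \<xi> * \<phi> \<xi>)"
    and lim\<phi>: "(\<lambda>k. pairing_complex (Y k) (fourier \<phi>)) \<longlonglongrightarrow> (\<integral>\<xi>. f \<xi> * \<phi> \<xi> \<partial>lborel)"
    if \<phi>: "schwartz \<phi>" for \<phi>
  proof -
    obtain D where D: "0 \<le> D" "\<And>\<xi>. norm (\<phi> \<xi>) \<le> D * (bessel_weight (s / 2) \<xi> * decay_weight \<xi>)"
      using schwartz_weight_bound[OF \<phi>] by blast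
    have [measurable]: "\<phi> \<in> borel_measurable borel" by (rule schwartz_measurable[OF \<phi>])
    show i: "integrable lborel (\<lambda>\<xi>. f \<xi> * \<phi> \<xi>)"
      by (rule weighted_L2_pairing(1)[OF f(1) _ f(2) D]) measurable
    have eq: "pairing_complex (Y k) (fourier \<phi>) = (\<integral>\<xi>. g k \<xi> * \<phi> \<xi> \<partial>lborel)"
      and ik: "integrable lborel (\<lambda>\<xi>. g k \<xi> * \<phi> \<xi>)" for k
      using g(1)[of k] \<phi> unfolding has_fourier_def by blast+
    let ?A = "D * pairing_const TYPE('a)"
    have A: "0 \<le> ?A" using D(1) less_imp_le[OF pairing_const_pos[where 'a = 'a]] by simp
    have "norm (pairing_complex (Y k) (fourier \<phi>) - (\<integral>\<xi>. f \<xi> * \<phi> \<xi> \<partial>lborel)) \<le> ?A * (1 / 2) ^ k" for k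
    proof -
      have "pairing_complex (Y k) (fourier \<phi>) - (\<integral>\<xi>. f \<xi> * \<phi> \<xi> \<partial>lborel) = (\<integral>\<xi>. (g k \<xi> - f \<xi>) * \<phi> \<xi> \<partial>lborel)"
        unfolding eq left_diff_distrib by (rule Bochner_Integration.integral_diff[OF ik i, symmetric])
      also have "norm \<dots> \<le> ?A * sqrt (weighted_L2_sq s (\<lambda>\<xi>. g k \<xi> - f \<xi>))"
        by (rule weighted_L2_pairing(2)[OF _ _ f(3) D]) measurable
      also have "\<dots> \<le> ?A * sqrt ((1 / 4) ^ k)"
        by (intro mult_left_mono real_sqrt_le_mono f(4) A)
      also have "sqrt ((1 / 4) ^ k) = (1 / 2) ^ k"
        by (simp add: quarter[symmetric])
      finally show ?thesis .
    qed
    note le = this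
    have lim0: "(\<lambda>k. ?A * (1 / 2) ^ k) \<longlonglongrightarrow> 0"
      by (intro tendsto_mult_right_zero LIMSEQ_power_zero) simp
    have "(\<lambda>k. pairing_complex (Y k) (fourier \<phi>) - (\<integral>\<xi>. f \<xi> * \<phi> \<xi> \<partial>lborel)) \<longlonglongrightarrow> 0"
      by (rule Lim_null_comparison[OF always_eventually lim0]) (use le in blast)
    then show "(\<lambda>k. pairing_complex (Y k) (fourier \<phi>)) \<longlonglongrightarrow> (\<integral>\<xi>. f \<xi> * \<phi> \<xi> \<partial>lborel)"
      by (simp add: LIM_zero_iff)
  qed
  obtain C K where C: "0 \<le> C" and CK: "\<And>u \<psi>. u \<in> sobolev s \<Longrightarrow> schwartz (\<psi>::'a \<Rightarrow> real) \<Longrightarrow>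
     \<bar>pairing u \<psi>\<bar> \<le> C * sobolev_norm s u * schwartz_seminorm K \<psi>"
    using sobolev_pairing_bound[of s, where 'a = 'a] by blast
  \<comment> \<open>So far convergence is known only on transforms; every real Schwartz function is
    one.\<close>
  have conv: "convergent (\<lambda>k. pairing (Y k) \<psi>)" if \<psi>: "schwartz \<psi>" for \<psi>
  proof -
    obtain \<phi> where \<phi>: "schwartz \<phi>" "fourier \<phi> = (\<lambda>x. complex_of_real (\<psi> x))"
      using real_schwartz_fourier_preimage[of 0, where 'a = 'a] \<psi> by blast
    from tendsto_Re[OF lim\<phi>[OF \<phi>(1)]] show ?thesis
      by (auto simp: \<phi>(2) pairing_complex_def convergent_def)
  qed
  \<comment> \<open>The distance from \<open>Y 0\<close> to \<open>Y k\<close> is at most 1; the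
    outer 2 is the factor of the weakened triangle inequality.\<close>
  define B where "B = 2 * (1 + sobolev_norm s (Y 0))"
  have bound: "\<bar>pairing (Y k) \<psi>\<bar> \<le> (C * B) * schwartz_seminorm K \<psi>" if \<psi>: "schwartz \<psi>" for k \<psi>
  proof -
    have "sobolev_norm s (Y k) \<le> 2 * (sobolev_norm s (Y 0 - Y k) + sobolev_norm s (Y 0))"
      using sobolev_diff(2)[OF Y[of 0] sobolev_diff(1)[OF Y[of 0] Y[of k]]] by (simp add: add.commute)
    also have "\<dots> \<le> B" using fast[of 0 k] by (simp add: B_def)
    finally have "C * sobolev_norm s (Y k) * schwartz_seminorm K \<psi> \<le> C * B * schwartz_seminorm K \<psi>"
      by (intro mult_right_mono mult_left_mono C schwartz_seminorm_nonneg[OF \<psi>])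
    then show ?thesis using CK[OF Y \<psi>, of k] by linarith
  qed
  obtain u where u: "\<And>\<psi>. (\<lambda>k. pairing (Y k) \<psi>) \<longlonglongrightarrow> pairing u \<psi>"
    using tendsto_tempered_distribution[of Y "C * B" K, OF conv bound] by blast
  have hu: "has_fourier u f"
    unfolding has_fourier_def
  proof (intro conjI allI impI)
    fix \<phi> :: "'a \<Rightarrow> complex" assume \<phi>: "schwartz \<phi>"
    show "integrable lborel (\<lambda>\<xi>. f \<xi> * \<phi> \<xi>)" by (rule if\<phi>[OF \<phi>])
    have "(\<lambda>k. pairing_complex (Y k) (fourier \<phi>)) \<longlonglongrightarrow> pairing_complex u (fourier \<phi>)"
      unfolding pairing_complex_def by (intro tendsto_Complex u)
    then show "pairing_complex u (fourier \<phi>) = (\<integral>\<xi>. f \<xi> * \<phi> \<xi> \<partial>lborel)"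
      using lim\<phi>[OF \<phi>] by (rule LIMSEQ_unique)
  qed (rule f)
  have us: "u \<in> sobolev s" by (rule sobolevI[OF hu f(2)])
  have "sobolev_norm s (Y k - u) \<le> (1 / 2) ^ k" for k
  proof -
    have "(sobolev_norm s (Y k - u))\<^sup>2 \<le> ((1 / 2) ^ k)\<^sup>2"
      unfolding quarter sobolev_has_fourier(2)[OF sobolev_diff(1)[OF Y us] has_fourier_diff[OF g(1) hu]]
      by (rule f(4))
    then show ?thesis by (rule power2_le_imp_le) simp
  qed
  then show ?thesis using us that by blast
qed

lemma sobolev_complete:
  fixes X :: "nat \<Rightarrow> 'a::euclidean_space tempered_distribution"
  assumes X: "\<And>n. X n \<in> sobolev s"
    and Cauchy: "\<And>e. 0 < e \<Longrightarrow> \<exists>M. \<forall>m\<ge>M. \<forall>n\<ge>M. sobolev_norm s (X m - X n) < e"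
  obtains u where "u \<in> sobolev s" "(\<lambda>n. sobolev_norm s (X n - u)) \<longlonglongrightarrow> 0"
proof -
  have "\<exists>M. \<forall>m\<ge>M. \<forall>n\<ge>M. sobolev_norm s (X m - X n) < (1 / 2) ^ k" for k
    by (rule Cauchy) simp
  then obtain r where r: "\<And>k m n. r k \<le> m \<Longrightarrow> r k \<le> n \<Longrightarrow> sobolev_norm s (X m - X n) < (1 / 2) ^ k"
    by metis
  \<comment> \<open>Partial sums of \<open>r\<close> dominate every earlier \<open>r k\<close>, so
    all indices \<open>R j\<close> with j \<ge> k lie where the k-th tolerance holds.\<close>
  define R where "R k = (\<Sum>i\<le>k. r i)" for k
  have R: "r k \<le> R j" if "k \<le> j" for k j
    unfolding R_def using that by (intro member_le_sum) auto
  obtain u where u: "u \<in> sobolev s" "\<And>k. sobolev_norm s (X (R k) - u) \<le> (1 / 2) ^ k"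
  proof (rule sobolev_complete_fast[of "\<lambda>k. X (R k)" s])
    show "sobolev_norm s (X (R k) - X (R j)) \<le> (1 / 2) ^ k" if "k \<le> j" for j k
      using r[of k "R k" "R j"] R[of k k] R[OF that] by simp
  qed (use X in auto)
  have "(\<lambda>n. sobolev_norm s (X n - u)) \<longlonglongrightarrow> 0"
  proof (rule LIMSEQ_I)
    fix e :: real assume "0 < e"
    then obtain k where k: "(1 / 2) ^ k < e / 4"
      using real_arch_pow_inv[of "e / 4" "1 / 2"] by auto
    have "norm (sobolev_norm s (X n - u) - 0) < e" if "R k \<le> n" for n
    proof -
      have "sobolev_norm s (X n - u) \<le> 2 * (sobolev_norm s (X n - X (R k)) + sobolev_norm s (X (R k) - u))"
        by (rule sobolev_dist_triangle[OF X X u(1)])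
      also have "\<dots> \<le> 2 * ((1 / 2) ^ k + (1 / 2) ^ k)"
        using r[of k n "R k"] R[of k k] that u(2)[of k] by simp
      also have "\<dots> < e" using k by simp
      finally show ?thesis by (simp add: sobolev_norm_nonneg)
    qed
    then show "\<exists>M. \<forall>n\<ge>M. norm (sobolev_norm s (X n - u) - 0) < e" by blast
  qed
  then show ?thesis using u(1) that by blast
qed

section \<open>The Lax--Milgram theorem\<close>

text \<open>At t = -B / (A + 1) the expression equals -(B^2 (A + 2)) / (A + 1)^2; the added 1 covers
  A = 0.\<close>

lemma quadratic_nonneg_imp_linear_coeff_0:
  fixes A B :: real
  assumes "0 \<le> A" and "\<And>t. 0 \<le> t\<^sup>2 * A + 2 * t * B"
  shows "B = 0"
proof -
  let ?t = "- B / (A + 1)"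
  have "0 \<le> (A + 1)\<^sup>2 * (?t\<^sup>2 * A + 2 * ?t * B)"
    by (intro mult_nonneg_nonneg assms) simp
  also have "\<dots> = ((A + 1) * ?t)\<^sup>2 * A + 2 * (A + 1) * ((A + 1) * ?t) * B"
    by (simp only: power_mult_distrib power2_eq_square) (simp only: algebra_simps)
  also have "(A + 1) * ?t = - B" using assms(1) by simp
  also have "(- B)\<^sup>2 * A + 2 * (A + 1) * (- B) * B = - (B\<^sup>2 * (A + 2))"
    by (simp add: power2_eq_square algebra_simps)
  finally have "B\<^sup>2 * (A + 2) \<le> 0" by simp
  then have "B\<^sup>2 \<le> 0" using assms(1) by (simp add: mult_le_0_iff)
  then show ?thesis by simp
qed

text \<open>A Hilbert space carried by a subset of a vector space, with its norm encoded by the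
  inner product \<open>a\<close>. It is instantiated with the symmetric part of a coercive
  form.\<close>

locale hilbert_form =
  fixes V :: "'v::real_vector set" and a :: "'v \<Rightarrow> 'v \<Rightarrow> real"
  assumes subspace: "subspace V"
    and add_left: "u \<in> V \<Longrightarrow> v \<in> V \<Longrightarrow> w \<in> V \<Longrightarrow> a (u + v) w = a u w + a v w"
    and scale_left: "u \<in> V \<Longrightarrow> w \<in> V \<Longrightarrow> a (c *\<^sub>R u) w = c * a u w"
    and sym: "u \<in> V \<Longrightarrow> v \<in> V \<Longrightarrow> a u v = a v u"
    and pos: "u \<in> V \<Longrightarrow> u \<noteq> 0 \<Longrightarrow> 0 < a u u"
    and complete: "(\<And>n. X n \<in> V) \<Longrightarrow>
      (\<And>e. 0 < e \<Longrightarrow> \<exists>M::nat. \<forall>m\<ge>M. \<forall>n\<ge>M. a (X m - X n) (X m - X n) < e) \<Longrightarrow>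
      \<exists>x\<in>V. (\<lambda>n. a (X n - x) (X n - x)) \<longlonglongrightarrow> 0"
begin

lemmas V_closed [simp, intro] =
  subspace_0[OF subspace] subspace_add[OF subspace] subspace_scale[OF subspace] subspace_diff[OF subspace]

lemma add_right: "u \<in> V \<Longrightarrow> v \<in> V \<Longrightarrow> w \<in> V \<Longrightarrow> a w (u + v) = a w u + a w v"
  by (metis V_closed(2) add_left sym)

lemma scale_right: "u \<in> V \<Longrightarrow> w \<in> V \<Longrightarrow> a w (c *\<^sub>R u) = c * a w u"
  by (metis V_closed(3) scale_left sym)

lemma diff_left: "u \<in> V \<Longrightarrow> v \<in> V \<Longrightarrow> w \<in> V \<Longrightarrow> a (u - v) w = a u w - a v w"
  using add_left[of "u - v" v w] by simp

lemma diff_right: "u \<in> V \<Longrightarrow> v \<in> V \<Longrightarrow> w \<in> V \<Longrightarrow> a w (u - v) = a w u - a w v"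
  using add_right[of "u - v" v w] by simp

lemma zero_left: "v \<in> V \<Longrightarrow> a 0 v = 0"
  using scale_left[of 0 v 0] by simp

lemma nonneg: "u \<in> V \<Longrightarrow> 0 \<le> a u u"
  using pos[of u] zero_left[of 0] by (cases "u = 0") auto

lemmas expand = add_left add_right scale_left scale_right diff_left diff_right

definition nrm :: "'v \<Rightarrow> real" where "nrm u = sqrt (a u u)"

lemma nrm_nonneg: "u \<in> V \<Longrightarrow> 0 \<le> nrm u"
  by (simp add: nrm_def nonneg)

lemma nrm_square: "u \<in> V \<Longrightarrow> (nrm u)\<^sup>2 = a u u"
  by (simp add: nrm_def nonneg)

lemma nrm_eq_0_iff: "u \<in> V \<Longrightarrow> nrm u = 0 \<longleftrightarrow> u = 0"
  using pos[of u] zero_left[of 0] by (cases "u = 0") (auto simp: nrm_def)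

lemma Cauchy_Schwarz: "u \<in> V \<Longrightarrow> v \<in> V \<Longrightarrow> \<bar>a u v\<bar> \<le> nrm u * nrm v"
proof -
  assume u: "u \<in> V" and v: "v \<in> V"
  show ?thesis
  proof (cases "v = 0")
    case True
    then have "a u v = 0" "nrm v = 0" using sym[OF u v] zero_left[OF u] zero_left[of 0] by (auto simp: nrm_def)
    then show ?thesis by simp
  next
    case False
    then have vv: "0 < a v v" using pos v by blast
    let ?c = "a u v / a v v"
    have "0 \<le> a (u - ?c *\<^sub>R v) (u - ?c *\<^sub>R v)" using u v by (intro nonneg) auto
    also have "\<dots> = a u u - 2 * ?c * a u v + ?c\<^sup>2 * a v v"
      using u v sym[OF v u] by (simp add: expand power2_eq_square algebra_simps)
    also have "\<dots> = a u u - (a u v)\<^sup>2 / a v v"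
      using vv by (simp add: power2_eq_square field_simps)
    finally have "(a u v)\<^sup>2 \<le> (nrm u * nrm v)\<^sup>2"
      using vv u v by (simp add: power_mult_distrib nrm_square divide_le_eq)
    then show ?thesis
      using abs_le_square_iff[of "a u v" "nrm u * nrm v"] nrm_nonneg[OF u] nrm_nonneg[OF v] by simp
  qed
qed

lemma nrm_triangle: "u \<in> V \<Longrightarrow> v \<in> V \<Longrightarrow> nrm (u + v) \<le> nrm u + nrm v"
proof -
  assume u: "u \<in> V" and v: "v \<in> V"
  have "(nrm (u + v))\<^sup>2 = (nrm u)\<^sup>2 + 2 * a u v + (nrm v)\<^sup>2"
    using u v sym[OF v u] by (simp add: nrm_square expand)
  also have "\<dots> \<le> (nrm u + nrm v)\<^sup>2"
    using Cauchy_Schwarz[OF u v] by (simp add: power2_eq_square algebra_simps)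
  finally show ?thesis
    by (rule power2_le_imp_le) (simp add: u v nrm_nonneg)
qed

text \<open>The representing vector is the limit of a minimising sequence for the energy a v v - 2 l
  v, which the bound on \<open>l\<close> keeps bounded below.\<close>

lemma riesz:
  assumes l_add: "\<And>u v. u \<in> V \<Longrightarrow> v \<in> V \<Longrightarrow> l (u + v) = l u + l v"
    and l_scale: "\<And>c u. u \<in> V \<Longrightarrow> l (c *\<^sub>R u) = c * l u"
    and l_bound: "\<And>u. u \<in> V \<Longrightarrow> \<bar>l u\<bar> \<le> K * nrm u"
  obtains f where "f \<in> V" "\<And>v. v \<in> V \<Longrightarrow> a f v = l v"
proof -
  define J where "J v = a v v - 2 * l v" for v
  have lb: "- K\<^sup>2 \<le> J v" if "v \<in> V" for v
  proof -
    have "0 \<le> (nrm v - K)\<^sup>2" by simp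
    also have "\<dots> = (nrm v)\<^sup>2 - 2 * (K * nrm v) + K\<^sup>2" by (simp add: power2_eq_square algebra_simps)
    finally show ?thesis
      using l_bound[OF that] by (simp add: J_def nrm_square[OF that])
  qed
  define I where "I = Inf (J ` V)"
  have bdd: "bdd_below (J ` V)" using lb by (intro bdd_belowI2) auto
  have I_le: "I \<le> J v" if "v \<in> V" for v
    unfolding I_def using that bdd by (intro cInf_lower) auto
  have "\<exists>x\<in>V. J x < I + 1 / real (Suc n)" for n
  proof -
    have "Inf (J ` V) < I + 1 / real (Suc n)" by (simp add: I_def)
    then show ?thesis using cInf_lessD[of "J ` V"] V_closed(1) by blast
  qed
  then obtain x where x: "\<And>n. x n \<in> V" "\<And>n. J (x n) < I + 1 / real (Suc n)"
    by metis
  \<comment> \<open>The parallelogram law; the linear parts of the energy cancel. As the energy at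
    the midpoint is at least the infimum, a minimising sequence is Cauchy.\<close>
  have midpoint: "a (u - v) (u - v) = 2 * J u + 2 * J v - 4 * J ((1 / 2) *\<^sub>R (u + v))" if "u \<in> V" "v \<in> V" for u v
    using that sym[of v u] by (simp add: J_def expand l_add l_scale algebra_simps)
  have "\<exists>M. \<forall>m\<ge>M. \<forall>n\<ge>M. a (x m - x n) (x m - x n) < e" if e: "0 < e" for e
  proof -
    obtain M where M: "1 / real (Suc M) < e / 4"
    proof (rule nat_approx_posE[of "e / 4"])
      show "0 < e / 4" using e by simp
    qed
    have "a (x m - x n) (x m - x n) < e" if "M \<le> m" "M \<le> n" for m n
    proof -
      have "1 / real (Suc m) \<le> 1 / real (Suc M)" "1 / real (Suc n) \<le> 1 / real (Suc M)"
        using that by (auto intro!: divide_left_mono)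
      then have "J (x m) < I + e / 4" "J (x n) < I + e / 4" using x(2)[of m] x(2)[of n] M by linarith+
      moreover have "I \<le> J ((1 / 2) *\<^sub>R (x m + x n))" by (intro I_le V_closed x)
      ultimately show ?thesis unfolding midpoint[OF x(1) x(1)] by linarith
    qed
    then show ?thesis by blast
  qed
  from complete[of x, OF x(1) this]
  obtain f where f: "f \<in> V" "(\<lambda>n. a (x n - f) (x n - f)) \<longlonglongrightarrow> 0" by blast
  have "a f v = l v" if v: "v \<in> V" for v
  proof -
    have "(\<lambda>n. nrm (x n - f) * nrm v) \<longlonglongrightarrow> sqrt 0 * nrm v"
      unfolding nrm_def by (intro tendsto_mult_right tendsto_real_sqrt f)
    then have "(\<lambda>n. nrm (x n - f) * nrm v) \<longlonglongrightarrow> 0" by simp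
    then have "(\<lambda>n. a (x n - f) v) \<longlonglongrightarrow> 0"
      by (rule Lim_null_comparison[rotated]) (use Cauchy_Schwarz v x f in auto)
    then have "(\<lambda>n. a (x n) v - a f v) \<longlonglongrightarrow> 0"
      using v x f by (simp add: expand)
    then have lim: "(\<lambda>n. a (x n) v) \<longlonglongrightarrow> a f v" by (simp add: LIM_zero_iff)
    \<comment> \<open>The variation is taken at the members of the sequence, whose energy is within
      1 / (n + 1) of the infimum, so that only the linear terms \<open>a (x n) v\<close> have to
      converge.\<close>
    have "0 \<le> t\<^sup>2 * a v v + 2 * t * (a f v - l v)" for t
    proof (rule LIMSEQ_le_const)
      show "(\<lambda>n. t\<^sup>2 * a v v + 2 * t * (a (x n) v - l v) + 1 / real (Suc n)) \<longlonglongrightarrow> t\<^sup>2 * a v v + 2 * t * (a f v - l v)"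
      proof (rule tendsto_eq_rhs[OF tendsto_add[OF _ inverse_Suc_tendsto_0]])
        show "(\<lambda>n. t\<^sup>2 * a v v + 2 * t * (a (x n) v - l v)) \<longlonglongrightarrow> t\<^sup>2 * a v v + 2 * t * (a f v - l v)"
          by (intro tendsto_add tendsto_const tendsto_mult_left tendsto_diff lim)
      qed simp
      have "0 \<le> t\<^sup>2 * a v v + 2 * t * (a (x n) v - l v) + 1 / real (Suc n)" for n
      proof -
        have "J (x n) - 1 / real (Suc n) \<le> J (x n + t *\<^sub>R v)"
          using x(2)[of n] I_le[of "x n + t *\<^sub>R v"] x(1)[of n] v by fastforce
        also have "J (x n + t *\<^sub>R v) = J (x n) + (t\<^sup>2 * a v v + 2 * t * (a (x n) v - l v))"
          using x(1)[of n] v sym[OF v x(1)[of n]]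
          by (simp add: J_def expand l_add l_scale power2_eq_square algebra_simps)
        finally show ?thesis by linarith
      qed
      then show "\<exists>N. \<forall>n\<ge>N. 0 \<le> t\<^sup>2 * a v v + 2 * t * (a (x n) v - l v) + 1 / real (Suc n)" by blast
    qed
    from quadratic_nonneg_imp_linear_coeff_0[OF nonneg[OF v] this] show ?thesis by simp
  qed
  then show ?thesis using f(1) that by blast
qed

text \<open>Riesz turns the equation into T u = f, solved by a fixed point of u - r (T u - f). The
  coercivity constant is 1 because \<open>a\<close> stands for the symmetric part of
  \<open>b\<close>. The squared contraction factor is then at most 1 - 2r + r^2 C'^2, which is 1 - r
  for r = 1 / C'^2.\<close>

lemma lax_milgram:
  assumes b_add_left: "\<And>u v w. u \<in> V \<Longrightarrow> v \<in> V \<Longrightarrow> w \<in> V \<Longrightarrow> b (u + v) w = b u w + b v w"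
    and b_add_right: "\<And>u v w. u \<in> V \<Longrightarrow> v \<in> V \<Longrightarrow> w \<in> V \<Longrightarrow> b w (u + v) = b w u + b w v"
    and b_scale_right: "\<And>c u w. u \<in> V \<Longrightarrow> w \<in> V \<Longrightarrow> b w (c *\<^sub>R u) = c * b w u"
    and b_bound: "\<And>u v. u \<in> V \<Longrightarrow> v \<in> V \<Longrightarrow> \<bar>b u v\<bar> \<le> C * nrm u * nrm v"
    and b_coercive: "\<And>u. u \<in> V \<Longrightarrow> a u u \<le> b u u"
    and l_add: "\<And>u v. u \<in> V \<Longrightarrow> v \<in> V \<Longrightarrow> l (u + v) = l u + l v"
    and l_scale: "\<And>c u. u \<in> V \<Longrightarrow> l (c *\<^sub>R u) = c * l u"
    and l_bound: "\<And>u. u \<in> V \<Longrightarrow> \<bar>l u\<bar> \<le> K * nrm u"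
  obtains u where "u \<in> V" "\<And>v. v \<in> V \<Longrightarrow> b u v = l v"
proof -
  \<comment> \<open>A bound of at least 1 gives r \<le> 1, so that the square root of 1 - r is
    meaningful.\<close>
  define C' where "C' = max C 1"
  have C': "1 \<le> C'" and b_bound': "\<And>u v. u \<in> V \<Longrightarrow> v \<in> V \<Longrightarrow> \<bar>b u v\<bar> \<le> C' * nrm u * nrm v"
  proof -
    show "\<bar>b u v\<bar> \<le> C' * nrm u * nrm v" if "u \<in> V" "v \<in> V" for u v
    proof -
      have "C * nrm u * nrm v \<le> C' * nrm u * nrm v"
        using that by (intro mult_right_mono) (auto simp: C'_def nrm_nonneg)
      then show ?thesis using b_bound[OF that] by linarith
    qed
  qed (simp add: C'_def)
  have "\<exists>y\<in>V. \<forall>v\<in>V. a y v = b u v" if "u \<in> V" for u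
  proof (rule riesz[of "b u" "C' * nrm u"])
    fix y assume "y \<in> V" "\<And>v. v \<in> V \<Longrightarrow> a y v = b u v"
    then show ?thesis by blast
  qed (use that in \<open>auto simp: b_add_right b_scale_right b_bound'\<close>)
  then obtain T where T: "\<And>u. u \<in> V \<Longrightarrow> T u \<in> V" "\<And>u v. u \<in> V \<Longrightarrow> v \<in> V \<Longrightarrow> a (T u) v = b u v"
    by metis
  obtain f where f: "f \<in> V" "\<And>v. v \<in> V \<Longrightarrow> a f v = l v"
  proof (rule riesz[OF l_add l_scale l_bound])
    fix f assume "f \<in> V" "\<And>v. v \<in> V \<Longrightarrow> a f v = l v"
    then show ?thesis by (rule that)
  qed
  define r where "r = 1 / C'\<^sup>2"
  have r: "0 < r" "r \<le> 1" using C' by (auto simp: r_def divide_le_eq_1 one_le_power)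
  \<comment> \<open>The 0 outside \<open>V\<close> is a default: \<open>Metric_space\<close> demands
    nonnegativity and symmetry for all arguments, its other axioms only on \<open>V\<close>.\<close>
  define d where "d x y = (if x \<in> V \<and> y \<in> V then nrm (x - y) else 0)" for x y
  interpret Metric_space V d
  proof
    show "0 \<le> d x y" for x y by (simp add: d_def nrm_nonneg)
    show "d x y = d y x" for x y
    proof (cases "x \<in> V \<and> y \<in> V")
      case True
      then have "a (y - x) (y - x) = a (x - y) (x - y)" by (simp add: expand)
      then show ?thesis using True by (simp add: d_def nrm_def)
    qed (auto simp: d_def)
    show "d x y = 0 \<longleftrightarrow> x = y" if "x \<in> V" "y \<in> V" for x y
      using that by (simp add: d_def nrm_eq_0_iff)
    show "d x z \<le> d x y + d y z" if "x \<in> V" "y \<in> V" "z \<in> V" for x y z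
      using nrm_triangle[of "x - y" "y - z"] that by (simp add: d_def)
  qed
  have mc: mcomplete
    unfolding mcomplete_def
  proof (intro allI impI)
    fix X assume X: "MCauchy X"
    then have XV: "X n \<in> V" for n by (auto simp: MCauchy_def)
    have "\<exists>M. \<forall>m\<ge>M. \<forall>n\<ge>M. a (X m - X n) (X m - X n) < e" if "0 < e" for e
    proof -
      have "0 < sqrt e" using that by simp
      from X[unfolded MCauchy_def, THEN conjunct2, rule_format, OF this]
      obtain M where M: "\<And>m n. M \<le> m \<Longrightarrow> M \<le> n \<Longrightarrow> d (X m) (X n) < sqrt e" by metis
      have "a (X m - X n) (X m - X n) < e" if "M \<le> m" "M \<le> n" for m n
        using M[OF that] XV by (simp add: d_def nrm_def)
      then show ?thesis by blast
    qed
    then obtain x where x: "x \<in> V" "(\<lambda>n. a (X n - x) (X n - x)) \<longlonglongrightarrow> 0"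
      using complete[of X, OF XV] by blast
    have "(\<lambda>n. d (X n) x) \<longlonglongrightarrow> 0"
      using tendsto_real_sqrt[OF x(2)] x(1) XV by (simp add: d_def nrm_def)
    then show "\<exists>x. limitin mtopology X x sequentially"
      using x(1) XV by (intro exI[of _ x]) (auto simp: limitin_metric dest: order_tendstoD(2))
  qed
  define \<Phi> where "\<Phi> u = u - r *\<^sub>R (T u - f)" for u
  have contraction: "d (\<Phi> u) (\<Phi> w) \<le> sqrt (1 - r) * d u w" if u: "u \<in> V" and w: "w \<in> V" for u w
  proof -
    let ?z = "u - w" and ?y = "T u - T w"
    have zy: "?z \<in> V" "?y \<in> V" using u w T(1) by auto
    have ya: "a ?y v = b ?z v" if v: "v \<in> V" for v
      using b_add_left[of ?z w v] u w v T by (simp add: expand)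
    have "(nrm ?y)\<^sup>2 \<le> (C' * nrm ?z) * nrm ?y"
      using ya[OF zy(2)] b_bound'[OF zy] by (simp add: nrm_square[OF zy(2)])
    then have "nrm ?y \<le> C' * nrm ?z"
      using nrm_nonneg[OF zy(1)] nrm_nonneg[OF zy(2)] C'
      by (cases "nrm ?y = 0") (auto simp: power2_eq_square)
    then have "(nrm ?y)\<^sup>2 \<le> (C' * nrm ?z)\<^sup>2"
      using nrm_nonneg[OF zy(2)] by (rule power_mono)
    then have yy: "a ?y ?y \<le> C'\<^sup>2 * a ?z ?z"
      by (simp add: power_mult_distrib nrm_square zy)
    have "\<Phi> u - \<Phi> w = ?z - r *\<^sub>R ?y" by (simp add: \<Phi>_def algebra_simps)
    then have "a (\<Phi> u - \<Phi> w) (\<Phi> u - \<Phi> w) = a ?z ?z - 2 * r * a ?y ?z + r\<^sup>2 * a ?y ?y"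
      using zy sym[OF zy] by (simp only: expand V_closed power2_eq_square) (simp add: algebra_simps)
    also have "\<dots> \<le> a ?z ?z - 2 * r * a ?z ?z + r\<^sup>2 * (C'\<^sup>2 * a ?z ?z)"
    proof (intro add_mono diff_mono mult_left_mono yy)
      show "a ?z ?z \<le> a ?y ?z" using ya[OF zy(1)] b_coercive[OF zy(1)] by simp
    qed (use r in auto)
    also have "r\<^sup>2 * (C'\<^sup>2 * a ?z ?z) = r * a ?z ?z"
      using C' by (simp add: r_def power2_eq_square)
    finally have "a (\<Phi> u - \<Phi> w) (\<Phi> u - \<Phi> w) \<le> (1 - r) * a ?z ?z"
      by (simp add: algebra_simps)
    then have "nrm (\<Phi> u - \<Phi> w) \<le> sqrt (1 - r) * nrm ?z"
      unfolding nrm_def real_sqrt_mult[symmetric] by (rule real_sqrt_le_mono)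
    moreover have "\<Phi> u \<in> V" "\<Phi> w \<in> V" using u w T(1) f(1) by (auto simp: \<Phi>_def)
    ultimately show ?thesis using u w by (simp add: d_def)
  qed
  obtain u where u: "u \<in> V" "\<Phi> u = u"
  proof (rule Banach_fixedpoint_thm[OF mc, of \<Phi> "sqrt (1 - r)"])
    show "\<Phi> \<in> V \<rightarrow> V" using T(1) f(1) by (auto simp: \<Phi>_def)
    show "sqrt (1 - r) < 1" using r by simp
  qed (use contraction V_closed(1) in auto)
  then have "T u = f" using r by (simp add: \<Phi>_def)
  then show ?thesis using u(1) T(2)[OF u(1)] f(2) that[of u] by simp
qed

end


section \<open>Bounded bilinear forms on H^s\<close>

lemma bounded_bilinear_formD:
  assumes "bounded_bilinear_form s B" "u \<in> sobolev s" "v \<in> sobolev s" "w \<in> sobolev s"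
  shows "B (u + v) w = B u w + B v w" "B w (u + v) = B w u + B w v"
    and "B (c *\<^sub>R u) w = c * B u w" "B w (c *\<^sub>R u) = c * B w u"
    and "B (u - v) w = B u w - B v w" "B w (u - v) = B w u - B w v"
proof -
  have *: "B (u + v) w = B u w + B v w" "B w (u + v) = B w u + B w v"
    "B (c *\<^sub>R u) w = c * B u w" "B w (c *\<^sub>R u) = c * B w u"
    if "u \<in> sobolev s" "v \<in> sobolev s" for u v c
    using assms(1,4) that unfolding bounded_bilinear_form_def by blast+
  show "B (u + v) w = B u w + B v w" "B w (u + v) = B w u + B w v"
    "B (c *\<^sub>R u) w = c * B u w" "B w (c *\<^sub>R u) = c * B w u"
    by (rule *(1)[OF assms(2,3)], rule *(2)[OF assms(2,3)], rule *(3)[OF assms(2,2)], rule *(4)[OF assms(2,2)])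
  have "B ((u - v) + v) w = B (u - v) w + B v w" "B w ((u - v) + v) = B w (u - v) + B w v"
    by (rule *(1)[OF sobolev_diff(1)[OF assms(2,3)] assms(3)], rule *(2)[OF sobolev_diff(1)[OF assms(2,3)] assms(3)])
  then show "B (u - v) w = B u w - B v w" "B w (u - v) = B w u - B w v" by simp_all
qed

lemma bounded_bilinear_form_bound:
  assumes "bounded_bilinear_form s B"
  shows "\<exists>C\<ge>0. \<forall>u\<in>sobolev s. \<forall>v\<in>sobolev s. \<bar>B u v\<bar> \<le> C * sobolev_norm s u * sobolev_norm s v"
proof -
  obtain C where C: "\<And>u v. u \<in> sobolev s \<Longrightarrow> v \<in> sobolev s \<Longrightarrow> \<bar>B u v\<bar> \<le> C * sobolev_norm s u * sobolev_norm s v"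
    using assms unfolding bounded_bilinear_form_def by blast
  have "\<bar>B u v\<bar> \<le> \<bar>C\<bar> * sobolev_norm s u * sobolev_norm s v" if "u \<in> sobolev s" "v \<in> sobolev s" for u v
  proof -
    have "C * sobolev_norm s u * sobolev_norm s v \<le> \<bar>C\<bar> * sobolev_norm s u * sobolev_norm s v"
      by (intro mult_right_mono sobolev_norm_nonneg) simp
    then show ?thesis using C[OF that] by linarith
  qed
  then show ?thesis by (intro exI[of _ "\<bar>C\<bar>"]) auto
qed

lemma bounded_bilinear_form_add:
  assumes L: "bounded_bilinear_form s L" and q: "bounded_bilinear_form s q"
  shows "bounded_bilinear_form s (\<lambda>u v. L u v + q u v)"
proof -
  obtain C where C0: "0 \<le> C" and Cb: "\<forall>u\<in>sobolev s. \<forall>v\<in>sobolev s. \<bar>L u v\<bar> \<le> C * sobolev_norm s u * sobolev_norm s v"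
    using bounded_bilinear_form_bound[OF L] by blast
  note C = Cb[rule_format]
  obtain D where D0: "0 \<le> D" and Db: "\<forall>u\<in>sobolev s. \<forall>v\<in>sobolev s. \<bar>q u v\<bar> \<le> D * sobolev_norm s u * sobolev_norm s v"
    using bounded_bilinear_form_bound[OF q] by blast
  note D = Db[rule_format]
  have "\<bar>L u v + q u v\<bar> \<le> (C + D) * sobolev_norm s u * sobolev_norm s v" if "u \<in> sobolev s" "v \<in> sobolev s" for u v
    using C[OF that] D[OF that] abs_triangle_ineq[of "L u v" "q u v"] by (simp add: distrib_right)
  then show ?thesis
    unfolding bounded_bilinear_form_def
    by (auto simp: bounded_bilinear_formD[OF L] bounded_bilinear_formD[OF q] distrib_left)
qed

lemma bounded_bilinear_form_adjoint:
  assumes "bounded_bilinear_form s B" shows "bounded_bilinear_form s (adjoint_form B)"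
proof -
  obtain C where C0: "0 \<le> C" and Cb: "\<forall>u\<in>sobolev s. \<forall>v\<in>sobolev s. \<bar>B u v\<bar> \<le> C * sobolev_norm s u * sobolev_norm s v"
    using bounded_bilinear_form_bound[OF assms] by blast
  note C = Cb[rule_format]
  have "\<bar>B v u\<bar> \<le> C * sobolev_norm s u * sobolev_norm s v" if "u \<in> sobolev s" "v \<in> sobolev s" for u v
    using C[OF that(2,1)] by (simp add: mult_ac)
  then show ?thesis
    unfolding bounded_bilinear_form_def adjoint_form_def
    by (auto simp: bounded_bilinear_formD[OF assms])
qed

text \<open>The symmetric part of \<open>B\<close> is taken as inner product. Coercivity and
  boundedness make its norm equivalent to that of H^s on \<open>V\<close>, so completeness comes
  from H^s and the closedness of \<open>V\<close>; on the diagonal it agrees with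
  \<open>B\<close>.\<close>

lemma lax_milgram_sobolev:
  assumes V: "subspace V" "V \<subseteq> sobolev s"
    and closed: "\<And>X x. (\<And>n. X n \<in> V) \<Longrightarrow> x \<in> sobolev s \<Longrightarrow> (\<lambda>n. sobolev_norm s (X n - x)) \<longlonglongrightarrow> 0 \<Longrightarrow> x \<in> V"
    and B: "bounded_bilinear_form s B"
    and c: "0 < c" "\<And>u. u \<in> V \<Longrightarrow> c * (sobolev_norm s u)\<^sup>2 \<le> B u u"
    and l_add: "\<And>u v. u \<in> V \<Longrightarrow> v \<in> V \<Longrightarrow> l (u + v) = l u + l v"
    and l_scale: "\<And>r u. u \<in> V \<Longrightarrow> l (r *\<^sub>R u) = r * l u"
    and l_bound: "\<And>u. u \<in> V \<Longrightarrow> \<bar>l u\<bar> \<le> K * sobolev_norm s u"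
  obtains u where "u \<in> V" "\<And>v. v \<in> V \<Longrightarrow> B u v = l v"
proof -
  define a where "a u v = (B u v + B v u) / 2" for u v
  have aa: "a u u = B u u" for u by (simp add: a_def)
  note S [simp] = subsetD[OF V(2)]
  note Bs = bounded_bilinear_formD[OF B]
  obtain C where C0: "0 \<le> C" and Cb: "\<forall>u\<in>sobolev s. \<forall>v\<in>sobolev s. \<bar>B u v\<bar> \<le> C * sobolev_norm s u * sobolev_norm s v"
    using bounded_bilinear_form_bound[OF B] by blast
  note C = C0 Cb[rule_format]
  interpret hilbert_form V a
  proof
    show "subspace V" by (rule V)
    show "a (u + v) w = a u w + a v w" if "u \<in> V" "v \<in> V" "w \<in> V" for u v w
      using that by (simp add: a_def Bs add_divide_distrib[symmetric])
    show "a (r *\<^sub>R u) w = r * a u w" if "u \<in> V" "w \<in> V" for r u w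
    proof -
      have "B (r *\<^sub>R u) w = r * B u w" "B w (r *\<^sub>R u) = r * B w u"
        using that Bs(3,4)[of u u w r] by simp_all
      then show ?thesis by (simp add: a_def distrib_left[symmetric])
    qed
    show "a u v = a v u" for u v by (simp add: a_def add.commute)
    show "0 < a u u" if "u \<in> V" "u \<noteq> 0" for u
    proof -
      have "sobolev_norm s u \<noteq> 0" using sobolev_norm_eq_0[OF S] that by auto
      then have "0 < c * (sobolev_norm s u)\<^sup>2" using c(1) by simp
      then show ?thesis using c(2)[OF that(1)] by (simp add: aa)
    qed
    fix X :: "nat \<Rightarrow> _"
    assume X: "\<And>n. X n \<in> V" and Cy: "\<And>e. 0 < e \<Longrightarrow> \<exists>M. \<forall>m\<ge>M. \<forall>n\<ge>M. a (X m - X n) (X m - X n) < e"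
    have Xd: "X m - X n \<in> V" for m n by (rule subspace_diff[OF V(1) X X])
    have "\<exists>M. \<forall>m\<ge>M. \<forall>n\<ge>M. sobolev_norm s (X m - X n) < e" if "0 < e" for e
    proof -
      have "0 < c * e\<^sup>2" using that c(1) by simp
      then obtain M where M: "\<forall>m\<ge>M. \<forall>n\<ge>M. a (X m - X n) (X m - X n) < c * e\<^sup>2" using Cy by blast
      have "sobolev_norm s (X m - X n) < e" if "M \<le> m" "M \<le> n" for m n
      proof -
        have "c * (sobolev_norm s (X m - X n))\<^sup>2 < c * e\<^sup>2"
          using order.strict_trans1[OF c(2)[OF Xd, of m n]] M that unfolding aa by blast
        then have "(sobolev_norm s (X m - X n))\<^sup>2 < e\<^sup>2" using c(1) by simp
        then show ?thesis by (rule power2_less_imp_less) (use \<open>0 < e\<close> in simp)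
      qed
      then show ?thesis by blast
    qed
    then obtain x where x: "x \<in> sobolev s" "(\<lambda>n. sobolev_norm s (X n - x)) \<longlonglongrightarrow> 0"
      using sobolev_complete[of X s, OF S[OF X]] by blast
    have xV: "x \<in> V" by (rule closed[OF X x])
    have "(\<lambda>n. C * sobolev_norm s (X n - x) * sobolev_norm s (X n - x)) \<longlonglongrightarrow> C * 0 * 0"
      by (intro tendsto_mult tendsto_const x)
    then have lim0: "(\<lambda>n. C * sobolev_norm s (X n - x) * sobolev_norm s (X n - x)) \<longlonglongrightarrow> 0" by simp
    have "(\<lambda>n. a (X n - x) (X n - x)) \<longlonglongrightarrow> 0"
      by (rule Lim_null_comparison[OF always_eventually lim0]) (simp add: aa C(2) sobolev_diff(1) X x(1))
    then show "\<exists>x\<in>V. (\<lambda>n. a (X n - x) (X n - x)) \<longlonglongrightarrow> 0" using xV by blast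
  qed
  \<comment> \<open>Coercivity bounds the Sobolev norm by this multiple of the energy norm; each
    Sobolev norm in an estimate contributes one such factor.\<close>
  let ?d = "1 / sqrt c"
  have N: "sobolev_norm s u \<le> ?d * nrm u" if "u \<in> V" for u
  proof -
    have "sqrt (c * (sobolev_norm s u)\<^sup>2) \<le> nrm u"
      unfolding nrm_def aa by (intro real_sqrt_le_mono c that)
    then show ?thesis using c(1) by (simp add: real_sqrt_mult sobolev_norm_nonneg field_simps)
  qed
  have d: "0 \<le> ?d" using c(1) by simp
  obtain u where "u \<in> V" "\<And>v. v \<in> V \<Longrightarrow> B u v = l v"
  proof (rule lax_milgram[of B "C * ?d * ?d" l "\<bar>K\<bar> * ?d"])
    show "\<bar>B u v\<bar> \<le> C * ?d * ?d * nrm u * nrm v" if "u \<in> V" "v \<in> V" for u v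
    proof -
      have "C * sobolev_norm s u * sobolev_norm s v \<le> C * (?d * nrm u) * (?d * nrm v)"
        using that d by (intro mult_mono N mult_nonneg_nonneg C sobolev_norm_nonneg order_refl nrm_nonneg) auto
      then show ?thesis using C(2)[of u v] that by (simp add: mult_ac)
    qed
    show "\<bar>l v\<bar> \<le> \<bar>K\<bar> * ?d * nrm v" if "v \<in> V" for v
    proof -
      have "K * sobolev_norm s v \<le> \<bar>K\<bar> * (?d * nrm v)"
        using N[OF that] by (intro mult_mono sobolev_norm_nonneg) auto
      then show ?thesis using l_bound[OF that] by (simp add: mult.assoc)
    qed
    show "B w (r *\<^sub>R u) = r * B w u" if "u \<in> V" "w \<in> V" for r u w
      using that Bs(4)[of u u w r] by simp
  qed (auto simp: aa Bs(1,2) l_add l_scale)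
  then show ?thesis using that by blast
qed

section \<open>Closures and test functions\<close>

lemma sobolev_norm_zero: "sobolev_norm s 0 = 0"
  using sobolev_scaleR(2)[OF sobolev_zero, of s 0] by simp

lemma sobolev_closure_subset: "sobolev_closure s A \<subseteq> sobolev s"
  by (auto simp: sobolev_closure_def)

lemma subset_sobolev_closure: "A \<subseteq> sobolev s \<Longrightarrow> A \<subseteq> sobolev_closure s A"
  by (auto simp: sobolev_closure_def sobolev_norm_zero intro!: bexI)

lemma subspace_sobolev_closure:
  assumes A: "subspace A" "A \<subseteq> sobolev s"
  shows "subspace (sobolev_closure s A)"
proof (rule subspaceI)
  show "0 \<in> sobolev_closure s A"
    using subset_sobolev_closure[OF A(2)] subspace_0[OF A(1)] by blast
  show "u + v \<in> sobolev_closure s A" if u: "u \<in> sobolev_closure s A" and v: "v \<in> sobolev_closure s A" for u v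
    unfolding sobolev_closure_def
  proof (intro CollectI conjI allI impI)
    have uv: "u \<in> sobolev s" "v \<in> sobolev s" using u v by (auto simp: sobolev_closure_def)
    then show "u + v \<in> sobolev s" by (rule sobolev_add)
    fix e :: real assume "0 < e"
    \<comment> \<open>A quarter for each summand compensates for the factor 2 in
      \<open>sobolev_add\<close>.\<close>
    then have "0 < e / 4" by simp
    then obtain u' v' where 1: "u' \<in> A" "sobolev_norm s (u - u') < e / 4" "v' \<in> A" "sobolev_norm s (v - v') < e / 4"
      using u v unfolding sobolev_closure_def by blast
    have "sobolev_norm s ((u - u') + (v - v')) \<le> 2 * (sobolev_norm s (u - u') + sobolev_norm s (v - v'))"
      using uv 1 A(2) by (intro sobolev_add sobolev_diff) auto
    moreover have "n < e" if "n \<le> 2 * (a + b)" "a < e / 4" "b < e / 4" for n a b :: real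
      using that by simp
    ultimately have "sobolev_norm s ((u - u') + (v - v')) < e" using 1(2,4) by blast
    moreover have "(u + v) - (u' + v') = (u - u') + (v - v')" by simp
    ultimately have "sobolev_norm s ((u + v) - (u' + v')) < e" by (simp only:)
    then show "\<exists>w\<in>A. sobolev_norm s (u + v - w) < e" using subspace_add[OF A(1) 1(1,3)] by blast
  qed
  show "c *\<^sub>R u \<in> sobolev_closure s A" if u: "u \<in> sobolev_closure s A" for c u
    unfolding sobolev_closure_def
  proof (intro CollectI conjI allI impI)
    have us: "u \<in> sobolev s" using u by (auto simp: sobolev_closure_def)
    then show "c *\<^sub>R u \<in> sobolev s" by (rule sobolev_scaleR)
    fix e :: real assume "0 < e"
    then have "0 < e / (\<bar>c\<bar> + 1)" by (simp add: add_nonneg_pos)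
    then obtain u' where 1: "u' \<in> A" "sobolev_norm s (u - u') < e / (\<bar>c\<bar> + 1)"
      using u unfolding sobolev_closure_def by blast
    have "sobolev_norm s (c *\<^sub>R (u - u')) = \<bar>c\<bar> * sobolev_norm s (u - u')"
      using us 1 A(2) by (intro sobolev_scaleR sobolev_diff) auto
    also have "\<dots> \<le> (\<bar>c\<bar> + 1) * sobolev_norm s (u - u')"
      by (intro mult_right_mono sobolev_norm_nonneg) simp
    also have "\<dots> < e" using 1(2) by (simp add: pos_less_divide_eq add_nonneg_pos mult.commute)
    finally have "sobolev_norm s (c *\<^sub>R u - c *\<^sub>R u') < e" by (simp add: scaleR_right_diff_distrib)
    then show "\<exists>w\<in>A. sobolev_norm s (c *\<^sub>R u - w) < e" using subspace_scale[OF A(1) 1(1)] by blast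
  qed
qed

lemma sobolev_closure_closure:
  assumes A: "A \<subseteq> sobolev s" and D: "D \<subseteq> sobolev_closure s A"
  shows "sobolev_closure s D \<subseteq> sobolev_closure s A"
proof
  fix x assume x: "x \<in> sobolev_closure s D"
  then have xs: "x \<in> sobolev s" by (auto simp: sobolev_closure_def)
  have "\<exists>v\<in>A. sobolev_norm s (x - v) < e" if "0 < e" for e
  proof -
    have e: "0 < e / 4" using that by simp
    then obtain y where y: "y \<in> D" "sobolev_norm s (x - y) < e / 4"
      using x unfolding sobolev_closure_def by blast
    then have yc: "y \<in> sobolev_closure s A" using D by blast
    then obtain v where v: "v \<in> A" "sobolev_norm s (y - v) < e / 4"
      using e unfolding sobolev_closure_def by blast
    have "sobolev_norm s (x - v) \<le> 2 * (sobolev_norm s (x - y) + sobolev_norm s (y - v))"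
      using xs yc v(1) A sobolev_closure_subset by (intro sobolev_dist_triangle) auto
    then show ?thesis using y v by (intro bexI[of _ v]) auto
  qed
  then show "x \<in> sobolev_closure s A" using xs by (simp add: sobolev_closure_def)
qed

text \<open>The limit lies in the closure of the range of \<open>X\<close>, and closing twice adds
  nothing.\<close>

lemma sobolev_closure_sequentially_closed:
  assumes A: "A \<subseteq> sobolev s" and X: "\<And>n. X n \<in> sobolev_closure s A"
    and x: "x \<in> sobolev s" and lim: "(\<lambda>n. sobolev_norm s (X n - x)) \<longlonglongrightarrow> 0"
  shows "x \<in> sobolev_closure s A"
proof -
  have "\<exists>v\<in>range X. sobolev_norm s (x - v) < e" if "0 < e" for e
  proof -
    have "\<forall>\<^sub>F n in sequentially. sobolev_norm s (X n - x) < e" by (rule order_tendstoD(2)[OF lim that])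
    then obtain n where "sobolev_norm s (X n - x) < e" by (auto simp: eventually_sequentially)
    then show ?thesis
      using sobolev_norm_minus_commute[OF x subsetD[OF sobolev_closure_subset X], of n] by (intro bexI[of _ "X n"]) auto
  qed
  then have "x \<in> sobolev_closure s (range X)" using x by (simp add: sobolev_closure_def)
  moreover have "range X \<subseteq> sobolev_closure s A" using X by blast
  ultimately show ?thesis using sobolev_closure_closure[OF A] by blast
qed

section \<open>Linearity of the space of test functions\<close>

lemma test_functions_zero: "(\<lambda>x. 0) \<in> C\<^sub>c\<^sup>\<infinity> W"
  using schwartz_zero by (auto simp: test_functions_def schwartz_def)

lemma test_functions_add:
  assumes f: "f \<in> C\<^sub>c\<^sup>\<infinity> W" and g: "g \<in> C\<^sub>c\<^sup>\<infinity> W"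
  shows "(\<lambda>x. f x + g x) \<in> C\<^sub>c\<^sup>\<infinity> W"
proof -
  have "smooth (\<lambda>x. f x + g x)"
    using schwartz_add[OF schwartz_test_function[OF f] schwartz_test_function[OF g]] by (simp add: schwartz_def)
  moreover have sub: "{x. f x + g x \<noteq> 0} \<subseteq> {x. f x \<noteq> 0} \<union> {x. g x \<noteq> 0}" by auto
  moreover have "bounded ({x. f x \<noteq> 0} \<union> {x. g x \<noteq> 0})"
    using f g by (simp add: test_functions_def compact_closure)
  ultimately show ?thesis
    using closure_mono[OF sub] f g bounded_subset
    unfolding test_functions_def closure_Un compact_closure by blast
qed

lemma test_functions_scale:
  assumes f: "f \<in> C\<^sub>c\<^sup>\<infinity> W"
  shows "(\<lambda>x. c * f x) \<in> C\<^sub>c\<^sup>\<infinity> W"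
proof -
  have "smooth (\<lambda>x. c * f x)"
    using schwartz_scale[OF schwartz_test_function[OF f]] by (simp add: schwartz_def)
  moreover have sub: "{x. c * f x \<noteq> 0} \<subseteq> {x. f x \<noteq> 0}" by auto
  ultimately show ?thesis
    using closure_mono[OF sub] f bounded_subset
    unfolding test_functions_def compact_closure by blast
qed

lemma tempered_distribution_eqI: "(\<And>\<phi>. schwartz \<phi> \<Longrightarrow> pairing u \<phi> = pairing v \<phi>) \<Longrightarrow> u = v"
proof -
  assume *: "\<And>\<phi>. schwartz \<phi> \<Longrightarrow> pairing u \<phi> = pairing v \<phi>"
  have "pairing u = pairing v"
  proof
    show "pairing u \<phi> = pairing v \<phi>" for \<phi> using * by (cases "schwartz \<phi>") (auto simp: pairing_nonschwartz)
  qed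
  then show ?thesis by (simp add: pairing_inject)
qed

lemma distr_of_add:
  assumes f: "f \<in> C\<^sub>c\<^sup>\<infinity> W" and g: "g \<in> C\<^sub>c\<^sup>\<infinity> W"
  shows "distr_of (\<lambda>x. f x + g x) = distr_of f + distr_of g"
  by (rule tempered_distribution_eqI)
    (simp add: pairing_add pairing_distr_of[OF f] pairing_distr_of[OF g] pairing_distr_of[OF test_functions_add[OF f g]]
      distrib_right test_function_times_integrable[OF f] test_function_times_integrable[OF g] schwartz_continuous)

lemma distr_of_scale:
  assumes f: "f \<in> C\<^sub>c\<^sup>\<infinity> W"
  shows "distr_of (\<lambda>x. c * f x) = c *\<^sub>R distr_of f"
  by (rule tempered_distribution_eqI)
    (simp add: pairing_scaleR pairing_distr_of[OF f] pairing_distr_of[OF test_functions_scale[OF f]] mult.assoc)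

lemma distr_of_zero: "distr_of (\<lambda>x. 0) = 0"
  by (rule tempered_distribution_eqI) (simp add: pairing_zero pairing_distr_of[OF test_functions_zero])

lemma subspace_distr_of_test_functions: "subspace (distr_of ` C\<^sub>c\<^sup>\<infinity> W)"
proof (rule subspaceI)
  show "0 \<in> distr_of ` C\<^sub>c\<^sup>\<infinity> W"
    by (rule image_eqI[where x = "\<lambda>x. 0"]) (simp_all add: distr_of_zero test_functions_zero)
  show "u + v \<in> distr_of ` C\<^sub>c\<^sup>\<infinity> W" if h: "u \<in> distr_of ` C\<^sub>c\<^sup>\<infinity> W" "v \<in> distr_of ` C\<^sub>c\<^sup>\<infinity> W" for u v :: "'a tempered_distribution"
  proof -
    obtain f g where "f \<in> C\<^sub>c\<^sup>\<infinity> W" "g \<in> C\<^sub>c\<^sup>\<infinity> W" "u = distr_of f" "v = distr_of g" using h by blast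
    then show ?thesis
      by (intro image_eqI[of _ _ "\<lambda>x. f x + g x"]) (auto intro: test_functions_add simp: distr_of_add)
  qed
  show "c *\<^sub>R u \<in> distr_of ` C\<^sub>c\<^sup>\<infinity> W" if h: "u \<in> distr_of ` C\<^sub>c\<^sup>\<infinity> W" for c and u :: "'a tempered_distribution"
  proof -
    obtain f where "f \<in> C\<^sub>c\<^sup>\<infinity> W" "u = distr_of f" using h by blast
    then show ?thesis
      by (intro image_eqI[of _ _ "\<lambda>x. c * f x"]) (auto intro: test_functions_scale simp: distr_of_scale)
  qed
qed

lemma distr_of_test_functions_sobolev: "distr_of ` C\<^sub>c\<^sup>\<infinity> W \<subseteq> sobolev s"
  using test_function_in_sobolev by blast

text \<open>A test function in \<Omega> and one off its closure have product 0, so the approximants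
  pair to 0; \<open>sobolev_pairing_bound\<close> carries this to the limit.\<close>

lemma sobolev_tilde_vanishes_outside:
  assumes z: "z \<in> sobolev_tilde s \<Omega>"
  shows "vanishes_on z (- closure \<Omega>)"
  unfolding vanishes_on_def
proof
  fix \<phi> assume \<phi>: "\<phi> \<in> C\<^sub>c\<^sup>\<infinity> (- closure \<Omega>)"
  have s\<phi>: "schwartz \<phi>" by (rule schwartz_test_function[OF \<phi>])
  have zs: "z \<in> sobolev s" using z by (auto simp: sobolev_tilde_def sobolev_closure_def)
  obtain C K where C: "0 \<le> C" and CK: "\<And>u \<psi>. u \<in> sobolev s \<Longrightarrow> schwartz (\<psi>::'a \<Rightarrow> real) \<Longrightarrow>
     \<bar>pairing u \<psi>\<bar> \<le> C * sobolev_norm s u * schwartz_seminorm K \<psi>"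
    using sobolev_pairing_bound[of s, where 'a = 'a] by blast
  let ?D = "C * schwartz_seminorm K \<phi>"
  have D: "0 \<le> ?D" using C schwartz_seminorm_nonneg[OF s\<phi>] by simp
  have "\<bar>pairing z \<phi>\<bar> \<le> 0 + e" if "0 < e" for e
  proof -
    \<comment> \<open>The added 1 allows for \<open>?D\<close> being 0.\<close>
    have "0 < e / (?D + 1)" using that D by (simp add: add_nonneg_pos)
    then obtain f where f: "f \<in> C\<^sub>c\<^sup>\<infinity> \<Omega>" "sobolev_norm s (z - distr_of f) < e / (?D + 1)"
      using z unfolding sobolev_tilde_def sobolev_closure_def by blast
    have "f x * \<phi> x = 0" for x
    proof (rule ccontr)
      assume "f x * \<phi> x \<noteq> 0"
      then have "x \<in> closure {x. f x \<noteq> 0}" "x \<in> closure {x. \<phi> x \<noteq> 0}"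
        using closure_subset[of "{x. f x \<noteq> 0}"] closure_subset[of "{x. \<phi> x \<noteq> 0}"] by auto
      then have "x \<in> \<Omega>" "x \<in> - closure \<Omega>" using f(1) \<phi> by (auto simp: test_functions_def)
      then show False using closure_subset[of \<Omega>] by blast
    qed
    then have "pairing (distr_of f) \<phi> = 0" unfolding pairing_distr_of[OF f(1)] by (simp only: integral_zero if_cancel)
    then have "\<bar>pairing z \<phi>\<bar> = \<bar>pairing (z - distr_of f) \<phi>\<bar>" by (simp add: pairing_diff)
    also have "\<dots> \<le> C * sobolev_norm s (z - distr_of f) * schwartz_seminorm K \<phi>"
      by (rule CK[OF sobolev_diff(1)[OF zs test_function_in_sobolev[OF f(1)]] s\<phi>])
    also have "\<dots> = ?D * sobolev_norm s (z - distr_of f)" by (simp add: mult_ac)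
    also have "\<dots> \<le> (?D + 1) * (e / (?D + 1))"
      using f(2) D by (intro mult_mono sobolev_norm_nonneg) auto
    also have "\<dots> = e" using D by simp
    finally show ?thesis by simp
  qed
  then have "\<bar>pairing z \<phi>\<bar> \<le> 0" by (rule field_le_epsilon)
  then show "pairing z \<phi> = 0" by simp
qed

lemma distr_support_sobolev_tilde:
  "z \<in> sobolev_tilde s \<Omega> \<Longrightarrow> distr_support z \<subseteq> closure \<Omega>"
  using sobolev_tilde_vanishes_outside[of z s \<Omega>] open_Compl[OF closed_closure[of \<Omega>]]
  unfolding distr_support_def by blast

text \<open>The closure of the nonzero set already lies in \<open>W\<close>, so the support stays
  inside \<open>W\<close> itself. It therefore avoids the closure of \<Omega> even when the closures
  of \<open>W\<close> and \<Omega> meet.\<close>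

lemma distr_support_distr_of:
  assumes f: "f \<in> C\<^sub>c\<^sup>\<infinity> W"
  shows "distr_support (distr_of f) \<subseteq> W"
proof -
  let ?K = "closure {x. f x \<noteq> 0}"
  have "vanishes_on (distr_of f) (- ?K)"
    unfolding vanishes_on_def
  proof
    fix \<phi> assume \<phi>: "\<phi> \<in> C\<^sub>c\<^sup>\<infinity> (- ?K)"
    have "f x * \<phi> x = 0" for x
      using \<phi> closure_subset[of "{x. f x \<noteq> 0}"] closure_subset[of "{x. \<phi> x \<noteq> 0}"]
      by (auto simp: test_functions_def)
    then show "pairing (distr_of f) \<phi> = 0" unfolding pairing_distr_of[OF f] by (simp only: integral_zero if_cancel)
  qed
  then have "distr_support (distr_of f) \<subseteq> ?K"
    using open_Compl[OF closed_closure[of "{x. f x \<noteq> 0}"]] unfolding distr_support_def by blast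
  then show ?thesis using f by (auto simp: test_functions_def)
qed

lemma subspace_sobolev_tilde: "subspace (sobolev_tilde s \<Omega>)"
  unfolding sobolev_tilde_def
  by (intro subspace_sobolev_closure subspace_distr_of_test_functions distr_of_test_functions_sobolev)

lemma sobolev_tilde_subset: "sobolev_tilde s \<Omega> \<subseteq> sobolev s"
  unfolding sobolev_tilde_def by (rule sobolev_closure_subset)

section \<open>The Runge approximation property\<close>

context
  fixes s :: real and \<Omega> :: "'a::euclidean_space set" and B :: "'a form" and c :: real
  assumes B: "bounded_bilinear_form s B"
    and c: "0 < c" "\<And>u. u \<in> sobolev_tilde s \<Omega> \<Longrightarrow> c * (sobolev_norm s u)\<^sup>2 \<le> B u u"
begin

abbreviation "T \<equiv> sobolev_tilde s \<Omega>"

text \<open>Two solutions differ by an element of \<open>T\<close>, which is admissible as a test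
  for both equations; coercivity then applies to the difference.\<close>

lemma exterior_solution_unique:
  assumes "u \<in> sobolev s" "u - f \<in> T" "\<And>\<phi>. \<phi> \<in> T \<Longrightarrow> B u \<phi> = 0"
    and "v \<in> sobolev s" "v - f \<in> T" "\<And>\<phi>. \<phi> \<in> T \<Longrightarrow> B v \<phi> = 0"
  shows "u = v"
proof -
  have d: "u - v \<in> T"
    using subspace_diff[OF subspace_sobolev_tilde assms(2,5)] by simp
  then have ds: "u - v \<in> sobolev s" using sobolev_tilde_subset by blast
  have "B (u - v) (u - v) = B u (u - v) - B v (u - v)"
    by (rule bounded_bilinear_formD(5)[OF B assms(1,4) ds])
  also have "\<dots> = 0" using assms(3,6)[OF d] by simp
  finally have "c * (sobolev_norm s (u - v))\<^sup>2 \<le> 0" using c(2)[OF d] by simp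
  then have "sobolev_norm s (u - v) = 0" using c(1) by (simp add: mult_le_0_iff)
  then show ?thesis using sobolev_norm_eq_0[OF ds] by simp
qed

lemma exterior_solution_eqI:
  assumes "u \<in> sobolev s" "u - f \<in> T" "\<And>\<phi>. \<phi> \<in> T \<Longrightarrow> B u \<phi> = 0"
  shows "exterior_solution s \<Omega> B f = u"
  unfolding exterior_solution_def
proof (rule the_equality)
  fix v
  assume "v \<in> sobolev s \<and> v - f \<in> T \<and> (\<forall>\<phi>\<in>T. B v \<phi> = 0)"
  then show "v = u" using assms by (intro exterior_solution_unique[of v f u]) auto
qed (use assms in auto)

text \<open>The solution is sought as w + f with \<open>w\<close> in \<open>T\<close>, which leaves
  a Lax-Milgram problem on \<open>T\<close> with the functional -B(f, v).\<close>

lemma exterior_solution: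
  assumes f: "f \<in> sobolev s"
  shows "exterior_solution s \<Omega> B f \<in> sobolev s" (is ?a)
    and "exterior_solution s \<Omega> B f - f \<in> T" (is ?b)
    and "\<phi> \<in> T \<Longrightarrow> B (exterior_solution s \<Omega> B f) \<phi> = 0"
proof -
  note S [simp] = subsetD[OF sobolev_tilde_subset[of s \<Omega>]]
  obtain C where C0: "0 \<le> C" and Cb: "\<forall>u\<in>sobolev s. \<forall>v\<in>sobolev s. \<bar>B u v\<bar> \<le> C * sobolev_norm s u * sobolev_norm s v"
    using bounded_bilinear_form_bound[OF B] by blast
  note C = Cb[rule_format]
  obtain w where w: "w \<in> T" "\<And>v. v \<in> T \<Longrightarrow> B w v = - B f v"
  proof (rule lax_milgram_sobolev[OF subspace_sobolev_tilde sobolev_tilde_subset _ B c, of \<Omega> "\<lambda>v. - B f v" "C * sobolev_norm s f"])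
    show "x \<in> T" if "\<And>n. X n \<in> T" "x \<in> sobolev s" "(\<lambda>n. sobolev_norm s (X n - x)) \<longlonglongrightarrow> 0" for X x
      using that unfolding sobolev_tilde_def
      by (rule sobolev_closure_sequentially_closed[OF distr_of_test_functions_sobolev])
    show "- B f (r *\<^sub>R u) = r * - B f u" if "u \<in> T" for r u
      using bounded_bilinear_formD(4)[OF B _ _ f, of u u r] that by simp
  qed (use f C bounded_bilinear_formD(2)[OF B _ _ f] in auto)
  have ws: "w + f \<in> sobolev s" using w(1) f by (intro sobolev_add) auto
  have z: "B (w + f) \<phi> = 0" if "\<phi> \<in> T" for \<phi>
    using w(2)[OF that] bounded_bilinear_formD(1)[OF B _ f, of w \<phi>] w(1) that by simp
  have eq: "exterior_solution s \<Omega> B f = w + f"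
    using w(1) by (intro exterior_solution_eqI ws z) auto
  show ?a ?b and "\<phi> \<in> T \<Longrightarrow> B (exterior_solution s \<Omega> B f) \<phi> = 0"
    unfolding eq using ws w(1) z by auto
qed

lemma runge_set_subset: "runge_set s \<Omega> B W \<subseteq> T"
  using exterior_solution(2)[OF test_function_in_sobolev] by (auto simp: runge_set_def)

text \<open>Eliminates the definite description: with existence and uniqueness at hand, membership
  is a linear condition on the pair (w, f), which is what \<open>subspace_runge_set\<close>
  needs.\<close>

lemma runge_set_eq:
  "runge_set s \<Omega> B W =
    {w \<in> T. \<exists>f\<in>C\<^sub>c\<^sup>\<infinity> W. \<forall>\<phi>\<in>T. B (w + distr_of f) \<phi> = 0}"
proof (intro Set.set_eqI iffI)
  fix w assume "w \<in> runge_set s \<Omega> B W"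
  then obtain f where f: "f \<in> C\<^sub>c\<^sup>\<infinity> W" "w = exterior_solution s \<Omega> B (distr_of f) - distr_of f"
    by (auto simp: runge_set_def)
  then show "w \<in> {w \<in> T. \<exists>f\<in>C\<^sub>c\<^sup>\<infinity> W. \<forall>\<phi>\<in>T. B (w + distr_of f) \<phi> = 0}"
    using exterior_solution[OF test_function_in_sobolev[OF f(1)]] by (intro CollectI conjI bexI[of _ f]) auto
next
  fix w assume "w \<in> {w \<in> T. \<exists>f\<in>C\<^sub>c\<^sup>\<infinity> W. \<forall>\<phi>\<in>T. B (w + distr_of f) \<phi> = 0}"
  then obtain f where w: "w \<in> T" and f: "f \<in> C\<^sub>c\<^sup>\<infinity> W"
    and 0: "\<And>\<phi>. \<phi> \<in> T \<Longrightarrow> B (w + distr_of f) \<phi> = 0" by auto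
  have "w + distr_of f \<in> sobolev s"
    using w sobolev_tilde_subset by (intro sobolev_add test_function_in_sobolev[OF f]) auto
  then have "exterior_solution s \<Omega> B (distr_of f) = w + distr_of f"
    using w 0 by (intro exterior_solution_eqI) auto
  then show "w \<in> runge_set s \<Omega> B W"
    using f unfolding runge_set_def by (intro CollectI exI[of _ f]) simp
qed

lemma subspace_runge_set: "subspace (runge_set s \<Omega> B W)"
proof -
  note tilde = subspace_sobolev_tilde[of s \<Omega>]
  note S [simp] = subsetD[OF sobolev_tilde_subset[of s \<Omega>]]
  have S' [simp]: "w + distr_of f \<in> sobolev s" if "w \<in> T" "f \<in> C\<^sub>c\<^sup>\<infinity> W" for w f
    using that by (intro sobolev_add test_function_in_sobolev) auto
  show ?thesis
    unfolding runge_set_eq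
  proof (rule subspaceI; clarsimp)
    show "0 \<in> T \<and> (\<exists>f\<in>C\<^sub>c\<^sup>\<infinity> W. \<forall>\<phi>\<in>T. B (distr_of f) \<phi> = 0)"
      using bounded_bilinear_formD(3)[OF B sobolev_zero sobolev_zero, of _ 0] subspace_0[OF tilde]
      by (intro conjI bexI[OF _ test_functions_zero]) (auto simp: distr_of_zero)
  next
    fix u v f g
    assume uv: "u \<in> T" "v \<in> T" and fg: "f \<in> C\<^sub>c\<^sup>\<infinity> W" "g \<in> C\<^sub>c\<^sup>\<infinity> W"
      and 0: "\<forall>\<phi>\<in>T. B (u + distr_of f) \<phi> = 0" "\<forall>\<phi>\<in>T. B (v + distr_of g) \<phi> = 0"
    have eq: "u + v + distr_of (\<lambda>x. f x + g x) = (u + distr_of f) + (v + distr_of g)"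
      by (simp add: distr_of_add[OF fg] algebra_simps)
    have "B ((u + distr_of f) + (v + distr_of g)) \<phi> = 0" if "\<phi> \<in> T" for \<phi>
      using bounded_bilinear_formD(1)[OF B S'[OF uv(1) fg(1)] S'[OF uv(2) fg(2)] S[OF that]] 0 that by simp
    then have "\<forall>\<phi>\<in>T. B (u + v + distr_of (\<lambda>x. f x + g x)) \<phi> = 0"
      unfolding eq by blast
    then show "u + v \<in> T \<and> (\<exists>h\<in>C\<^sub>c\<^sup>\<infinity> W. \<forall>\<phi>\<in>T. B (u + v + distr_of h) \<phi> = 0)"
      using subspace_add[OF tilde uv] by (intro conjI bexI[OF _ test_functions_add[OF fg]])
  next
    fix r u f
    assume u: "u \<in> T" and f: "f \<in> C\<^sub>c\<^sup>\<infinity> W"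
      and 0: "\<forall>\<phi>\<in>T. B (u + distr_of f) \<phi> = 0"
    have eq: "r *\<^sub>R u + distr_of (\<lambda>x. r * f x) = r *\<^sub>R (u + distr_of f)"
      by (simp add: distr_of_scale[OF f] scaleR_right_distrib)
    have "B (r *\<^sub>R (u + distr_of f)) \<phi> = 0" if "\<phi> \<in> T" for \<phi>
      using bounded_bilinear_formD(3)[OF B S'[OF u f] S'[OF u f] S[OF that]] 0 that by simp
    then have "\<forall>\<phi>\<in>T. B (r *\<^sub>R u + distr_of (\<lambda>x. r * f x)) \<phi> = 0"
      unfolding eq by blast
    then show "r *\<^sub>R u \<in> T \<and> (\<exists>h\<in>C\<^sub>c\<^sup>\<infinity> W. \<forall>\<phi>\<in>T. B (r *\<^sub>R u + distr_of h) \<phi> = 0)"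
      using subspace_scale[OF tilde u] by (intro conjI bexI[OF _ test_functions_scale[OF f]])
  qed
qed

end

lemma runge_dense:
  fixes L q :: "'a::euclidean_space form"
  defines "B \<equiv> \<lambda>u v. L u v + q u v"
  assumes L: "bounded_bilinear_form s L" and q: "bounded_bilinear_form s q"
    and loc: "local_form s q" and coercive: "coercive_form s \<Omega> B"
    and W: "W \<subseteq> - closure \<Omega>" and ucp: "right_UCP s L W"
  shows "dense_in s (runge_set s \<Omega> B W) (sobolev_tilde s \<Omega>)"
proof -
  have B: "bounded_bilinear_form s B"
    unfolding B_def by (rule bounded_bilinear_form_add[OF L q])
  obtain c where c: "0 < c" "\<And>u. u \<in> sobolev_tilde s \<Omega> \<Longrightarrow> c * (sobolev_norm s u)\<^sup>2 \<le> B u u"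
    using coercive unfolding coercive_form_def by blast
  let ?R = "runge_set s \<Omega> B W"
  let ?M = "sobolev_closure s ?R"
  have R: "?R \<subseteq> sobolev_tilde s \<Omega>" by (rule runge_set_subset[OF B c])
  have Rs: "?R \<subseteq> sobolev s" using R sobolev_tilde_subset by blast
  have M_tilde: "?M \<subseteq> sobolev_tilde s \<Omega>"
    using sobolev_closure_closure[OF distr_of_test_functions_sobolev R[unfolded sobolev_tilde_def]]
    by (simp add: sobolev_tilde_def)
  have RM: "?R \<subseteq> ?M" by (rule subset_sobolev_closure[OF Rs])
  have Ms: "subspace ?M" by (rule subspace_sobolev_closure[OF subspace_runge_set[OF B c] Rs])
  obtain C where C0: "0 \<le> C" and Cb: "\<forall>u\<in>sobolev s. \<forall>v\<in>sobolev s. \<bar>B u v\<bar> \<le> C * sobolev_norm s u * sobolev_norm s v"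
    using bounded_bilinear_form_bound[OF B] by blast
  note C = Cb[rule_format]
  have "w \<in> ?M" if w: "w \<in> sobolev_tilde s \<Omega>" for w
  proof -
    have ws: "w \<in> sobolev s" using w sobolev_tilde_subset by blast
    note S [simp] = subsetD[OF sobolev_closure_subset[of s ?R]]
    \<comment> \<open>The adjoint form puts the unknown \<open>m\<close> into the second slot of
      \<open>B\<close>, the slot in which the right UCP of \<open>L\<close> expects the function to
      be annihilated.\<close>
    obtain m where m: "m \<in> ?M" "\<And>v. v \<in> ?M \<Longrightarrow> adjoint_form B m v = B v w"
    proof (rule lax_milgram_sobolev[OF Ms sobolev_closure_subset _ bounded_bilinear_form_adjoint[OF B] c(1),
          of "\<lambda>v. B v w" "C * sobolev_norm s w"])
      show "x \<in> ?M" if "\<And>n. X n \<in> ?M" "x \<in> sobolev s" "(\<lambda>n. sobolev_norm s (X n - x)) \<longlonglongrightarrow> 0" for X x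
        using that by (rule sobolev_closure_sequentially_closed[OF Rs])
      show "c * (sobolev_norm s u)\<^sup>2 \<le> adjoint_form B u u" if "u \<in> ?M" for u
        using that M_tilde c(2) by (auto simp: adjoint_form_def)
      show "B (r *\<^sub>R u) w = r * B u w" if "u \<in> ?M" for r u
        using bounded_bilinear_formD(3)[OF B _ _ ws, of u u r] that by simp
      show "\<bar>B u w\<bar> \<le> C * sobolev_norm s w * sobolev_norm s u" if "u \<in> ?M" for u
        using C[of u w] that ws by (simp add: mult_ac)
    qed (use bounded_bilinear_formD(1)[OF B _ _ ws] in auto)
    define z where "z = w - m"
    have z: "z \<in> sobolev_tilde s \<Omega>"
      unfolding z_def using m(1) M_tilde by (intro subspace_diff[OF subspace_sobolev_tilde w]) auto
    then have zs: "z \<in> sobolev s" using sobolev_tilde_subset by blast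
    have "L (distr_of f) z = 0" if f: "f \<in> C\<^sub>c\<^sup>\<infinity> W" for f
    proof -
      have fs: "distr_of f \<in> sobolev s" by (rule test_function_in_sobolev[OF f])
      let ?u = "exterior_solution s \<Omega> B (distr_of f)"
      have r: "?u - distr_of f \<in> ?M" using RM f by (auto simp: runge_set_def)
      have "B (?u - distr_of f) z = 0"
        using m(2)[OF r] bounded_bilinear_formD(6)[OF B ws, of m "?u - distr_of f"] m(1) r
        by (simp add: adjoint_form_def z_def)
      moreover have "B (?u - distr_of f) z = B ?u z - B (distr_of f) z"
        by (rule bounded_bilinear_formD(5)[OF B exterior_solution(1)[OF B c fs] fs zs])
      moreover have "B ?u z = 0" by (rule exterior_solution(3)[OF B c fs z])
      ultimately have "B (distr_of f) z = 0" by simp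
      moreover have "q (distr_of f) z = 0"
        using loc fs zs distr_support_distr_of[OF f] distr_support_sobolev_tilde[OF z] W
        unfolding local_form_def by blast
      ultimately show ?thesis by (simp add: B_def)
    qed
    moreover have "vanishes_on z W"
      using sobolev_tilde_vanishes_outside[OF z] W unfolding vanishes_on_def test_functions_def by blast
    ultimately have "z = 0" using ucp zs unfolding right_UCP_def by blast
    then show ?thesis using m(1) by (simp add: z_def)
  qed
  then show ?thesis using R unfolding dense_in_def by blast
qed

theorem theorem4p3:
  fixes s :: real
    and \<Omega> :: "(real ^ 'n) set"
    and L q :: "(real ^ 'n) form"
  assumes "open \<Omega>"
    and "- closure \<Omega> \<noteq> {}"
    and "bounded_bilinear_form s L"
    and "bounded_bilinear_form s q"
    and "local_form s q"
    and "coercive_form s \<Omega> (\<lambda>u v. L u v + q u v)"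
  shows "(\<forall>W. open W \<longrightarrow> W \<noteq> {} \<longrightarrow> W \<subseteq> - closure \<Omega> \<longrightarrow> right_UCP s L W \<longrightarrow>
            dense_in s (runge_set s \<Omega> (\<lambda>u v. L u v + q u v) W) (sobolev_tilde s \<Omega>)) \<and>
         (\<forall>W. open W \<longrightarrow> W \<noteq> {} \<longrightarrow> W \<subseteq> - closure \<Omega> \<longrightarrow> left_UCP s L W \<longrightarrow>
            dense_in s (runge_set s \<Omega> (adjoint_form (\<lambda>u v. L u v + q u v)) W) (sobolev_tilde s \<Omega>))"
proof (intro conjI allI impI)
  fix W assume "W \<subseteq> - closure \<Omega>" "right_UCP s L W"
  then show "dense_in s (runge_set s \<Omega> (\<lambda>u v. L u v + q u v) W) (sobolev_tilde s \<Omega>)"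
    by (rule runge_dense[OF assms(3-6)])
next
  fix W assume W: "W \<subseteq> - closure \<Omega>" and ucp: "left_UCP s L W"
  \<comment> \<open>Transposition commutes with addition, which brings the adjoint into the shape
    required by \<open>runge_dense\<close>. Coercivity only sees the diagonal, where a form and its
    adjoint agree, and the left UCP of \<open>L\<close> is literally the right UCP of its
    adjoint.\<close>
  have eq: "adjoint_form (\<lambda>u v. L u v + q u v) = (\<lambda>u v. adjoint_form L u v + adjoint_form q u v)"
    by (simp add: adjoint_form_def fun_eq_iff)
  show "dense_in s (runge_set s \<Omega> (adjoint_form (\<lambda>u v. L u v + q u v)) W) (sobolev_tilde s \<Omega>)"
    unfolding eq
  proof (rule runge_dense[OF bounded_bilinear_form_adjoint bounded_bilinear_form_adjoint])
    show "local_form s (adjoint_form q)"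
      using assms(5) unfolding local_form_def adjoint_form_def by (metis inf_commute)
    show "coercive_form s \<Omega> (\<lambda>u v. adjoint_form L u v + adjoint_form q u v)"
      using assms(6) by (simp add: coercive_form_def adjoint_form_def)
    show "right_UCP s (adjoint_form L) W"
      using ucp by (simp add: left_UCP_def right_UCP_def adjoint_form_def)
  qed (use assms(3,4) W in auto)
qed

end
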